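(* Let $\mathbf X$ be an s-manifold of dimension $n$. Then there exists a proper embedding $f:\mathbf X\to\mathbb R^{2n+1}$.
   Context: **S-manifolds.** An s-manifold of dimension $n\ge 0$ is data $\mathbf X=(X,\{X^i:i\in I\})$ such that: (a) $X$ is a locally compact, Hausdorff, second countable topological space. (b) $I$ is finite or countable, and the $X^i$ (the strata) are nonempty, locally closed, pairwise disjoint subsets with $X=\coprod_{i\in I}X^i$ as sets. (c) Each $X^i$, with the subspace topology, is equipped with the structure of a smooth manifold (without boundary) of dimension $\dim X^i\le n$. (d) Each $x\in X$ has an open neighbourhood $U$ and a continuous map $f:U\to\mathbb R^N$ for some $N$ such that $f:U\to f(U)$ is a homeomorphism and $f|_{U\cap X^i}$ is a smooth embedding of manifolds for all $i\in I$. (e) Each $x\in X$ has an open neighbourhood $V$ such that $I_V=\{i\in I:V\cap X^i\ne\emptyset\}$ is finite, and there is a partial order $\preceq$ on $I_V$ such that: (i) for each $i\in I_V$ the closure of $V\cap X^i$ in $V$ is contained in $\coprod_{j\in I_V:\,i\preceq j}(V\cap X^j)$; (ii) if $i\ne j$ in $I_V$ with $i\preceq j$, then either $\dim X^i\in\{n-1,n\}$ and $\dim X^j<\dim X^i$, or $\dim X^i\le n-2$ and $\dim X^j\le n-2$. **Embeddings.** A smooth map $f:\mathbf X\to\mathbb R^N$ is a continuous map $f:X\to\mathbb R^N$ whose restriction $f|_{X^i}$ to each stratum is a smooth map of manifolds. It is an embedding if $f|_{X^i}:X^i\to\mathbb R^N$ is an embedding of manifolds for all strata $X^i$ of $\mathbf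 X$, and $f:X\to f(X)$ is a homeomorphism. It is proper if preimages of compact sets are compact. *)

theory Defs
  imports "HOL-Analysis.Analysis"
begin

text \<open>
  Because dimensions vary from stratum to stratum, $\mathbb{R}^d$ is rendered throughout as the
  topological space \<^const>\<open>Euclidean_space\<close> $d$, i.e. the sequences \<open>x :: nat \<Rightarrow> real\<close>
  with \<open>x i = 0\<close> for all \<open>i \<ge> d\<close>.
\<close>

section \<open>Smooth functions on open subsets of $\mathbb{R}^d$\<close>

definition partial_deriv :: "nat \<Rightarrow> ((nat \<Rightarrow> real) \<Rightarrow> real) \<Rightarrow> (nat \<Rightarrow> real) \<Rightarrow> real" where
  "partial_deriv i f x = deriv (\<lambda>t. f (x(i := t))) (x i)"

text \<open>
  \<open>Ck_on k d D f\<close>: all iterated partial derivatives of \<open>f\<close> of order at most \<open>k\<close> exist and are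
  continuous on \<open>D\<close>. It is used only for \<open>D\<close> open in $\mathbb{R}^d$; the values of \<open>f\<close>
  outside \<open>D\<close> are then irrelevant.
\<close>

primrec Ck_on :: "nat \<Rightarrow> nat \<Rightarrow> (nat \<Rightarrow> real) set \<Rightarrow> ((nat \<Rightarrow> real) \<Rightarrow> real) \<Rightarrow> bool" where
  "Ck_on 0 d D f \<longleftrightarrow> continuous_map (subtopology (Euclidean_space d) D) euclideanreal f"
| "Ck_on (Suc k) d D f \<longleftrightarrow>
     continuous_map (subtopology (Euclidean_space d) D) euclideanreal f \<and>
     (\<forall>i<d. (\<forall>x\<in>D. (\<lambda>t. f (x(i := t))) differentiable at (x i)) \<and>
            Ck_on k d D (partial_deriv i f))"

definition smooth_on :: "nat \<Rightarrow> (nat \<Rightarrow> real) set \<Rightarrow> ((nat \<Rightarrow> real) \<Rightarrow> real) \<Rightarrow> bool" where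
  "smooth_on d D f \<longleftrightarrow> (\<forall>k. Ck_on k d D f)"

section \<open>Smooth manifolds and their embeddings into $\mathbb{R}^N$\<close>

text \<open>
  A chart is a pair \<open>(W, \<phi>)\<close> of its domain and its coordinate map, of which only the values on
  \<open>W\<close> matter. A smooth structure is given by an atlas, not required to be maximal.
\<close>

type_synonym 'a chart = "'a set \<times> ('a \<Rightarrow> nat \<Rightarrow> real)"

definition is_chart :: "'a topology \<Rightarrow> nat \<Rightarrow> 'a chart \<Rightarrow> bool" where
  "is_chart T d = (\<lambda>(W, \<phi>).
     openin T W \<and> openin (Euclidean_space d) (\<phi> ` W) \<and>
     embedding_map (subtopology T W) (Euclidean_space d) \<phi>)"

definition smooth_transition :: "nat \<Rightarrow> 'a chart \<Rightarrow> 'a chart \<Rightarrow> bool" where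
  "smooth_transition d = (\<lambda>(W, \<phi>) (W', \<psi>).
     \<forall>k<d. smooth_on d (\<phi> ` (W \<inter> W')) (\<lambda>y. \<psi> (inv_into W \<phi> y) k))"

definition smooth_manifold :: "'a topology \<Rightarrow> nat \<Rightarrow> 'a chart set \<Rightarrow> bool" where
  "smooth_manifold T d A \<longleftrightarrow>
     Hausdorff_space T \<and> second_countable T \<and>
     (\<forall>c\<in>A. is_chart T d c) \<and>
     topspace T = (\<Union>c\<in>A. fst c) \<and>
     (\<forall>c\<in>A. \<forall>c'\<in>A. smooth_transition d c c')"

text \<open>The induced atlas on an open subset \<open>U\<close>.\<close>

definition restrict_atlas :: "'a set \<Rightarrow> 'a chart set \<Rightarrow> 'a chart set" where
  "restrict_atlas U A = (\<lambda>(W, \<phi>). (W \<inter> U, \<phi>)) ` A"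

definition manifold_smooth_map :: "nat \<Rightarrow> 'a chart set \<Rightarrow> nat \<Rightarrow> ('a \<Rightarrow> nat \<Rightarrow> real) \<Rightarrow> bool" where
  "manifold_smooth_map d A N f \<longleftrightarrow>
     (\<forall>(W, \<phi>)\<in>A. \<forall>k<N. smooth_on d (\<phi> ` W) (\<lambda>y. f (inv_into W \<phi> y) k))"

text \<open>The differential of \<open>f\<close> at \<open>\<phi>\<^sup>-\<^sup>1 y\<close>, in the chart \<open>(W, \<phi>)\<close>, as a map from
  $\mathbb{R}^d$ to $\mathbb{R}^N$.\<close>

definition chart_differential ::
  "nat \<Rightarrow> nat \<Rightarrow> 'a chart \<Rightarrow> ('a \<Rightarrow> nat \<Rightarrow> real) \<Rightarrow> (nat \<Rightarrow> real) \<Rightarrow> (nat \<Rightarrow> real) \<Rightarrow> nat \<Rightarrow> real" where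
  "chart_differential d N = (\<lambda>(W, \<phi>) f y v k.
     if k < N then \<Sum>j<d. v j * partial_deriv j (\<lambda>z. f (inv_into W \<phi> z) k) y else 0)"

definition manifold_immersion :: "nat \<Rightarrow> 'a chart set \<Rightarrow> nat \<Rightarrow> ('a \<Rightarrow> nat \<Rightarrow> real) \<Rightarrow> bool" where
  "manifold_immersion d A N f \<longleftrightarrow>
     manifold_smooth_map d A N f \<and>
     (\<forall>(W, \<phi>)\<in>A. \<forall>y\<in>\<phi> ` W.
        inj_on (chart_differential d N (W, \<phi>) f y) (topspace (Euclidean_space d)))"

definition manifold_embedding ::
  "'a topology \<Rightarrow> nat \<Rightarrow> 'a chart set \<Rightarrow> nat \<Rightarrow> ('a \<Rightarrow> nat \<Rightarrow> real) \<Rightarrow> bool" where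
  "manifold_embedding T d A N f \<longleftrightarrow>
     manifold_immersion d A N f \<and> embedding_map T (Euclidean_space N) f"

section \<open>S-manifolds\<close>

definition locally_closed_in :: "'a topology \<Rightarrow> 'a set \<Rightarrow> bool" where
  "locally_closed_in X S \<longleftrightarrow> (\<exists>U C. openin X U \<and> closedin X C \<and> S = U \<inter> C)"

definition strata_meeting :: "'i set \<Rightarrow> ('i \<Rightarrow> 'a set) \<Rightarrow> 'a set \<Rightarrow> 'i set" where
  "strata_meeting I S V = {i \<in> I. V \<inter> S i \<noteq> {}}"

text \<open>
  The s-manifold with underlying space \<open>X\<close> has strata \<open>S i\<close> for \<open>i \<in> I\<close>, where \<open>S i\<close> is a
  manifold of dimension \<open>dm i\<close> with atlas \<open>A i\<close>. The last two conjuncts are the local embedding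
  condition and the local finiteness and frontier condition. To avoid truncated subtraction,
  \<open>dm i \<in> {n - 1, n}\<close> and \<open>dm i \<le> n - 2\<close> are written additively.
\<close>

definition s_manifold ::
  "nat \<Rightarrow> 'a topology \<Rightarrow> 'i set \<Rightarrow> ('i \<Rightarrow> 'a set) \<Rightarrow> ('i \<Rightarrow> nat) \<Rightarrow> ('i \<Rightarrow> 'a chart set) \<Rightarrow> bool" where
  "s_manifold n X I S dm A \<longleftrightarrow>
     locally_compact_space X \<and> Hausdorff_space X \<and> second_countable X \<and>
     countable I \<and>
     (\<forall>i\<in>I. S i \<noteq> {} \<and> locally_closed_in X (S i)) \<and>
     disjoint_family_on S I \<and>
     topspace X = (\<Union>i\<in>I. S i) \<and>
     (\<forall>i\<in>I. dm i \<le> n \<and> smooth_manifold (subtopology X (S i)) (dm i) (A i)) \<and>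
     (\<forall>x\<in>topspace X. \<exists>U N f.
        openin X U \<and> x \<in> U \<and>
        embedding_map (subtopology X U) (Euclidean_space N) f \<and>
        (\<forall>i\<in>I. manifold_embedding (subtopology X (U \<inter> S i)) (dm i) (restrict_atlas U (A i)) N f)) \<and>
     (\<forall>x\<in>topspace X. \<exists>V r.
        openin X V \<and> x \<in> V \<and>
        finite (strata_meeting I S V) \<and>
        partial_order_on (strata_meeting I S V) r \<and>
        (\<forall>i\<in>strata_meeting I S V.
           subtopology X V closure_of (V \<inter> S i)
             \<subseteq> (\<Union>j\<in>{j \<in> strata_meeting I S V. (i, j) \<in> r}. V \<inter> S j)) \<and>
        (\<forall>i\<in>strata_meeting I S V. \<forall>j\<in>strata_meeting I S V.
           i \<noteq> j \<and> (i, j) \<in> r \<longrightarrow>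
             (dm i = n \<or> dm i + 1 = n) \<and> dm j < dm i \<or>
             dm i + 2 \<le> n \<and> dm j + 2 \<le> n))"

definition s_smooth_map ::
  "'a topology \<Rightarrow> 'i set \<Rightarrow> ('i \<Rightarrow> 'a set) \<Rightarrow> ('i \<Rightarrow> nat) \<Rightarrow> ('i \<Rightarrow> 'a chart set) \<Rightarrow>
     nat \<Rightarrow> ('a \<Rightarrow> nat \<Rightarrow> real) \<Rightarrow> bool" where
  "s_smooth_map X I S dm A N f \<longleftrightarrow>
     continuous_map X (Euclidean_space N) f \<and>
     (\<forall>i\<in>I. manifold_smooth_map (dm i) (A i) N f)"

definition s_embedding ::
  "'a topology \<Rightarrow> 'i set \<Rightarrow> ('i \<Rightarrow> 'a set) \<Rightarrow> ('i \<Rightarrow> nat) \<Rightarrow> ('i \<Rightarrow> 'a chart set) \<Rightarrow>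
     nat \<Rightarrow> ('a \<Rightarrow> nat \<Rightarrow> real) \<Rightarrow> bool" where
  "s_embedding X I S dm A N f \<longleftrightarrow>
     s_smooth_map X I S dm A N f \<and>
     (\<forall>i\<in>I. manifold_embedding (subtopology X (S i)) (dm i) (A i) N f) \<and>
     embedding_map X (Euclidean_space N) f"

text \<open>The library's \<^const>\<open>proper_map\<close> is a different definition (closed with compact fibres).\<close>

definition preimage_proper :: "'a topology \<Rightarrow> nat \<Rightarrow> ('a \<Rightarrow> nat \<Rightarrow> real) \<Rightarrow> bool" where
  "preimage_proper X N f \<longleftrightarrow>
     (\<forall>K. compactin (Euclidean_space N) K \<longrightarrow> compactin X {x \<in> topspace X. f x \<in> K})"

end

theory Submission
  imports Defs
begin

text \<open>
  The proof follows Whitney. Choose a locally finite sequence of smooth functions $G_m$ on $X$ whose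
  values separate points and whose differentials separate tangent vectors of all strata, and a proper
  smooth function $\rho$. Starting from $f_0 = (\rho, 0, \dots, 0)$, put
  $f_{m+1} = f_m + a_m G_m$ with small vectors $a_m \in \mathbb{R}^{2n+1}$. If $a_m$ avoids all
  quotients $-(f_m(x) - f_m(y)) / (G_m(x) - G_m(y))$ and $-df_m(v) / dG_m(v)$, then a coincidence
  $f_{m+1}(x) = f_{m+1}(y)$ forces $G_m(x) = G_m(y)$ and $f_m(x) = f_m(y)$, and likewise for
  differentials. These quotients depend smoothly on at most $2n$ parameters, since all strata have
  dimension at most $n$, so they form a null set. Hence the limit $f$ is an injective immersion, and it
  is proper because its first coordinate stays within distance 1 of $\rho$.
\<close>

section \<open>Smooth functions of finitely many real variables\<close>

text \<open>Distinct strata share no smooth structure: differentials exist only along a stratum, and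
  across strata there is only continuity. All functions are therefore built from the coordinates of
  local embeddings, which are at once continuous on \<open>X\<close>, smooth and immersive on every
  stratum, and injective across strata. In the null-set argument a pair of points is read in one
  chart for each point, so points of different strata need no separate case; only the sum of the two
  dimensions counts. Denominators may vanish and tangent vectors are unbounded, so the quotients are
  split into countably many pieces: closed cubes in charts, denominators at least 1 / (m + 1),
  vectors in a cube of radius m. On such a piece the quotients are Lipschitz, and a direct covering
  by boxes shows that the image is null. Adding one scalar function at a time makes the forbidden
  coefficients explicit quotients. The price is that nothing is known about injectivity at a finite
  stage; it is recovered by descending from a stage where the sequence is stationary near the given
  points. That the limit is a homeomorphism onto its image comes from properness alone.\<close>

abbreviation Espace :: "nat \<Rightarrow> (nat \<Rightarrow> real) set" where
  "Espace d \<equiv> topspace (Euclidean_space d)"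

definition cube :: "nat \<Rightarrow> (nat \<Rightarrow> real) \<Rightarrow> real \<Rightarrow> (nat \<Rightarrow> real) set" where
  "cube d c r = {x \<in> Espace d. \<forall>i<d. \<bar>x i - c i\<bar> \<le> r}"

definition open_cube :: "nat \<Rightarrow> (nat \<Rightarrow> real) \<Rightarrow> real \<Rightarrow> (nat \<Rightarrow> real) set" where
  "open_cube d c r = {x \<in> Espace d. \<forall>i<d. \<bar>x i - c i\<bar> < r}"

text \<open>\<open>Euclidean_space d\<close> is a subspace of the product topology on all sequences,
  and that topology is the one of the type class on functions. This makes
  \<open>continuous_on\<close> and its calculus available.\<close>

lemma subtopology_Euclidean_space:
  "D \<subseteq> Espace d \<Longrightarrow> subtopology (Euclidean_space d) D = top_of_set D"
  unfolding Euclidean_space_def euclidean_product_topology subtopology_subtopology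
  by (simp add: Int_absorb1 Int_commute inf.absorb_iff2)

lemma continuous_map_Euclidean_subset:
  assumes "D \<subseteq> Espace d"
  shows "continuous_map (subtopology (Euclidean_space d) D) euclideanreal f \<longleftrightarrow> continuous_on D f"
  by (simp add: subtopology_Euclidean_space[OF assms])

lemma openin_Euclidean_space_iff:
  "openin (Euclidean_space d) D \<longleftrightarrow> (\<exists>T. open T \<and> D = T \<inter> Espace d)"
  unfolding Euclidean_space_def euclidean_product_topology
  by (auto simp: openin_subtopology)

lemma openin_open_cube: "openin (Euclidean_space d) (open_cube d c r)"
proof -
  let ?T = "\<Inter>i\<in>{..<d}. {x :: nat \<Rightarrow> real. \<bar>x i - c i\<bar> < r}"
  have "open {x :: nat \<Rightarrow> real. \<bar>x i - c i\<bar> < r}" for i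
    by (intro open_Collect_less continuous_intros) auto
  then have "open ?T" by (intro open_INT) auto
  moreover have "open_cube d c r = ?T \<inter> Espace d" by (auto simp: open_cube_def)
  ultimately show ?thesis by (auto simp: openin_Euclidean_space_iff)
qed

lemma openin_contains_cube:
  assumes "openin (Euclidean_space d) D" "x \<in> D"
  obtains r where "r > 0" "cube d x r \<subseteq> D"
proof -
  obtain T where T: "open T" "D = T \<inter> Espace d"
    using assms openin_Euclidean_space_iff by auto
  have "openin (powertop_real UNIV) T" "x \<in> T"
    using T assms by (auto simp: euclidean_product_topology)
  then obtain B where B: "x \<in> Pi\<^sub>E UNIV B" "\<And>i. open (B i)" "Pi\<^sub>E UNIV B \<subseteq> T"
    using product_topology_open_contains_basis[of "\<lambda>_. euclideanreal" UNIV T x] by (auto simp flip: open_openin)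
  have "\<exists>r>0. \<forall>t. \<bar>t - x i\<bar> \<le> r \<longrightarrow> t \<in> B i" for i
  proof -
    have "x i \<in> B i" using B(1) by auto
    then obtain r where "r > 0" "cball (x i) r \<subseteq> B i"
      using B(2)[of i] open_contains_cball by blast
    then show ?thesis by (intro exI[of _ r]) (auto simp: dist_real_def abs_minus_commute subset_iff)
  qed
  then obtain r where r: "\<And>i. r i > 0" "\<And>i t. \<bar>t - x i\<bar> \<le> r i \<Longrightarrow> t \<in> B i" by metis
  \<comment> \<open>Only the first \<open>d\<close> radii matter, because the other coordinates of
    points of \<open>Espace d\<close> are 0. The inserted 1 keeps the minimum defined for
    \<open>d = 0\<close>.\<close>
  define R where "R = Min (insert 1 (r ` {..<d}))"
  have R: "R > 0" "\<And>i. i < d \<Longrightarrow> R \<le> r i"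
    using r(1) by (auto simp: R_def)
  have "cube d x R \<subseteq> D"
  proof
    fix z assume z: "z \<in> cube d x R"
    have "z i \<in> B i" for i
    proof (cases "i < d")
      case True
      then show ?thesis using z R(2)[of i] by (intro r(2)) (auto simp: cube_def)
    next
      case False
      then have "z i = x i" using z assms T by (auto simp: cube_def topspace_Euclidean_space)
      then show ?thesis using r(1)[of i] r(2)[of "z i" i] by simp
    qed
    then show "z \<in> D" using B(3) z T by (auto simp: cube_def)
  qed
  with R show ?thesis using that by blast
qed

lemma compact_cube: "compact (cube d c r)"
proof -
  have "cube d c r = Pi\<^sub>E UNIV (\<lambda>i. if i < d then cball (c i) r else {0})"
    by (auto simp: cube_def topspace_Euclidean_space PiE_UNIV_domain Pi_iff dist_real_def abs_minus_commute
        split: if_splits)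
  moreover have "compactin (powertop_real UNIV) \<dots>"
    by (subst compactin_PiE) auto
  ultimately show ?thesis by (simp add: euclidean_product_topology)
qed

lemma openin_line_eventually:
  assumes "openin (Euclidean_space d) D" "x \<in> D" "i < d"
  shows "eventually (\<lambda>t. x(i := t) \<in> D) (nhds (x i))"
proof -
  obtain r where r: "r > 0" "cube d x r \<subseteq> D"
    using openin_contains_cube[OF assms(1,2)] .
  have "x \<in> Espace d" using assms openin_subset by blast
  then have "x(i := t) \<in> D" if "dist t (x i) < r" for t
    using that r assms(3) by (intro subsetD[OF r(2)]) (auto simp: cube_def topspace_Euclidean_space dist_real_def)
  then show ?thesis using r(1) eventually_nhds_metric by blast
qed

section \<open>Locality of partial derivatives and of \<open>Ck_on\<close>\<close>

lemma partial_deriv_cong: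
  assumes "openin (Euclidean_space d) D" "\<And>x. x \<in> D \<Longrightarrow> f x = g x" "x \<in> D" "i < d"
  shows "partial_deriv i f x = partial_deriv i g x"
    and "(\<lambda>t. f (x(i := t))) differentiable at (x i) \<longleftrightarrow> (\<lambda>t. g (x(i := t))) differentiable at (x i)"
proof -
  have ev: "eventually (\<lambda>t. f (x(i := t)) = g (x(i := t))) (nhds (x i))"
    using openin_line_eventually[OF assms(1,3,4)] by eventually_elim (use assms(2) in auto)
  show "partial_deriv i f x = partial_deriv i g x"
    unfolding partial_deriv_def by (rule deriv_cong_ev[OF ev]) simp
  show "(\<lambda>t. f (x(i := t))) differentiable at (x i) \<longleftrightarrow> (\<lambda>t. g (x(i := t))) differentiable at (x i)"
    unfolding real_differentiable_def using DERIV_cong_ev[OF refl ev refl] by simp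
qed

lemma Ck_on_imp_continuous_on:
  "Ck_on k d D f \<Longrightarrow> D \<subseteq> Espace d \<Longrightarrow> continuous_on D f"
  by (cases k) (auto simp: continuous_map_Euclidean_subset)

lemma Ck_on_0_iff: "D \<subseteq> Espace d \<Longrightarrow> Ck_on 0 d D f \<longleftrightarrow> continuous_on D f"
  by (simp add: continuous_map_Euclidean_subset)

lemma Ck_on_Suc_iff:
  assumes "openin (Euclidean_space d) D"
  shows "Ck_on (Suc k) d D f \<longleftrightarrow> continuous_on D f \<and>
     (\<forall>i<d. (\<forall>x\<in>D. ((\<lambda>t. f (x(i := t))) has_real_derivative partial_deriv i f x) (at (x i))) \<and>
            Ck_on k d D (partial_deriv i f))"
  using openin_subset[OF assms]
  by (auto simp: continuous_map_Euclidean_subset partial_deriv_def DERIV_deriv_iff_real_differentiable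
      real_differentiable_def)

declare Ck_on.simps [simp del]

text \<open>Difference quotients at a point of an open \<open>D\<close> eventually see only values
  in \<open>D\<close>. Arbitrary values of \<open>inv_into\<close> off a chart image are therefore
  harmless, and \<open>inv_into\<close> may be exchanged between a chart domain and a smaller
  one.\<close>

lemma Ck_on_cong:
  assumes "openin (Euclidean_space d) D" "\<And>x. x \<in> D \<Longrightarrow> f x = g x" "Ck_on k d D f"
  shows "Ck_on k d D g"
  using assms(2,3)
proof (induction k arbitrary: f g)
  case 0
  then show ?case using openin_subset[OF assms(1)]
    by (metis Ck_on_0_iff continuous_on_cong)
next
  case (Suc k)
  note pd = partial_deriv_cong[OF assms(1), of f g]
  show ?case unfolding Ck_on.simps
  proof (intro conjI allI impI ballI)
    have "continuous_on D f" using Suc.prems openin_subset[OF assms(1)] Ck_on_imp_continuous_on by blast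
    then have "continuous_on D g" using Suc.prems(1) continuous_on_cong by metis
    then show "continuous_map (subtopology (Euclidean_space d) D) euclideanreal g"
      using openin_subset[OF assms(1)] by (simp add: continuous_map_Euclidean_subset)
  next
    fix i x assume "i < d" "x \<in> D"
    then show "(\<lambda>t. g (x(i := t))) differentiable at (x i)"
      using pd(2)[of x i] Suc.prems unfolding Ck_on.simps by blast
  next
    fix i assume i: "i < d"
    show "Ck_on k d D (partial_deriv i g)"
    proof (rule Suc.IH)
      show "Ck_on k d D (partial_deriv i f)" using Suc.prems(2) i unfolding Ck_on.simps by blast
      show "partial_deriv i f x = partial_deriv i g x" if "x \<in> D" for x
        using pd(1)[OF _ that i] Suc.prems(1) by blast
    qed
  qed
qed

lemma Ck_on_subset:
  assumes "Ck_on k d D f" "D' \<subseteq> D"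
  shows "Ck_on k d D' f"
  using assms(1)
proof (induction k arbitrary: f)
  case 0
  then show ?case using assms(2) unfolding Ck_on.simps
    by (metis continuous_map_from_subtopology_mono)
next
  case (Suc k)
  then show ?case using assms(2) continuous_map_from_subtopology_mono unfolding Ck_on.simps
    by blast
qed

lemma continuous_on_Euclidean_local:
  assumes "D \<subseteq> Espace d"
    and "\<And>x. x \<in> D \<Longrightarrow> \<exists>D'. openin (Euclidean_space d) D' \<and> x \<in> D' \<and> continuous_on D' f"
  shows "continuous_on D f"
  unfolding continuous_on_eq_continuous_within
proof
  fix x assume "x \<in> D"
  then obtain D' where D': "openin (Euclidean_space d) D'" "x \<in> D'" "continuous_on D' f"
    using assms(2) by blast
  then obtain T where T: "open T" "D' = T \<inter> Espace d"
    using openin_Euclidean_space_iff by auto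
  have "continuous (at x within D') f"
    using D' by (simp add: continuous_on_eq_continuous_within)
  moreover have "at x within D' = at x within Espace d"
    using T D'(2) at_within_nhd[of x T D' "Espace d"] by auto
  ultimately have "continuous (at x within Espace d) f"
    by (simp add: continuous_within)
  then show "continuous (at x within D) f"
    using assms(1) continuous_within_subset by blast
qed

lemma Ck_on_local:
  assumes "D \<subseteq> Espace d" "\<And>x. x \<in> D \<Longrightarrow> \<exists>D'. openin (Euclidean_space d) D' \<and> x \<in> D' \<and> Ck_on k d D' f"
  shows "Ck_on k d D f"
  using assms(2)
proof (induction k arbitrary: f)
  case 0
  then have "continuous_on D f"
    by (intro continuous_on_Euclidean_local[OF assms(1)])
      (metis Ck_on_imp_continuous_on openin_subset)
  then show ?case using assms(1) by (simp add: Ck_on_0_iff)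
next
  case (Suc k)
  show ?case unfolding Ck_on.simps
  proof (intro conjI allI impI ballI)
    have "continuous_on D f"
      using Suc.prems by (intro continuous_on_Euclidean_local[OF assms(1)])
        (metis Ck_on_imp_continuous_on openin_subset)
    then show "continuous_map (subtopology (Euclidean_space d) D) euclideanreal f"
      using assms(1) by (simp add: continuous_map_Euclidean_subset)
    show "(\<lambda>t. f (x(i := t))) differentiable at (x i)" if "i < d" "x \<in> D" for i x
      using Suc.prems[OF that(2)] that unfolding Ck_on.simps by blast
    show "Ck_on k d D (partial_deriv i f)" if "i < d" for i
    proof (rule Suc.IH)
      show "\<exists>D'. openin (Euclidean_space d) D' \<and> x \<in> D' \<and> Ck_on k d D' (partial_deriv i f)"
        if "x \<in> D" for x
        using Suc.prems[OF that] \<open>i < d\<close> unfolding Ck_on.simps by blast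
    qed
  qed
qed

lemma Ck_on_SucD:
  assumes "openin (Euclidean_space d) D" "Ck_on (Suc k) d D f"
  shows "Ck_on k d D f"
  using assms(2)
proof (induction k arbitrary: f)
  case 0
  then show ?case unfolding Ck_on.simps by blast
next
  case (Suc k)
  show ?case unfolding Ck_on.simps(2)
    using Suc.prems Suc.IH unfolding Ck_on.simps(2)[of "Suc k"] Ck_on.simps(2)[of k] by blast
qed

text \<open>Allows derivatives to be supplied by a formula that is valid on \<open>D\<close> only,
  in place of the function \<open>partial_deriv i f\<close>.\<close>

lemma Ck_on_SucI:
  assumes "openin (Euclidean_space d) D" "continuous_on D f"
    and "\<And>i x. i < d \<Longrightarrow> x \<in> D \<Longrightarrow> ((\<lambda>t. f (x(i := t))) has_real_derivative f' i x) (at (x i))"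
    and "\<And>i. i < d \<Longrightarrow> Ck_on k d D (f' i)"
  shows "Ck_on (Suc k) d D f"
proof -
  have pd: "partial_deriv i f x = f' i x" if "i < d" "x \<in> D" for i x
    unfolding partial_deriv_def using assms(3)[OF that] by (rule DERIV_imp_deriv)
  have "Ck_on k d D (partial_deriv i f)" if "i < d" for i
    by (rule Ck_on_cong[OF assms(1) _ assms(4)[OF that]]) (simp add: pd that)
  then show ?thesis
    using assms(2,3) pd by (simp add: Ck_on_Suc_iff[OF assms(1)])
qed

lemma Ck_on_SucE:
  assumes "openin (Euclidean_space d) D" "Ck_on (Suc k) d D f"
  shows "continuous_on D f"
    and "\<And>i x. i < d \<Longrightarrow> x \<in> D \<Longrightarrow>
      ((\<lambda>t. f (x(i := t))) has_real_derivative partial_deriv i f x) (at (x i))"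
    and "\<And>i. i < d \<Longrightarrow> Ck_on k d D (partial_deriv i f)"
  using assms(2) Ck_on_Suc_iff[OF assms(1)] by auto

section \<open>Algebra and composition of \<open>Ck_on\<close> functions\<close>

lemma Ck_on_const:
  assumes "openin (Euclidean_space d) D"
  shows "Ck_on k d D (\<lambda>_. c)"
proof (induction k arbitrary: c)
  case 0
  then show ?case using openin_subset[OF assms] by (simp add: Ck_on_0_iff)
next
  case (Suc k)
  then show ?case by (intro Ck_on_SucI[OF assms, of _ "\<lambda>_ _. 0"]) auto
qed

lemma Ck_on_add:
  assumes D: "openin (Euclidean_space d) D" and "Ck_on k d D f" "Ck_on k d D g"
  shows "Ck_on k d D (\<lambda>x. f x + g x)"
  using assms(2,3)
proof (induction k arbitrary: f g)
  case 0
  then show ?case using openin_subset[OF D] by (simp add: Ck_on_0_iff continuous_on_add)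
next
  case (Suc k)
  note f = Ck_on_SucE[OF D Suc.prems(1)] and g = Ck_on_SucE[OF D Suc.prems(2)]
  show ?case
    by (rule Ck_on_SucI[OF D, of _ "\<lambda>i x. partial_deriv i f x + partial_deriv i g x"])
      (use f g Suc.IH in \<open>auto intro!: continuous_on_add DERIV_add\<close>)
qed

lemma Ck_on_mult:
  assumes D: "openin (Euclidean_space d) D" and "Ck_on k d D f" "Ck_on k d D g"
  shows "Ck_on k d D (\<lambda>x. f x * g x)"
  using assms(2,3)
proof (induction k arbitrary: f g)
  case 0
  then show ?case using openin_subset[OF D] by (simp add: Ck_on_0_iff continuous_on_mult)
next
  case (Suc k)
  note f = Ck_on_SucE[OF D Suc.prems(1)] and g = Ck_on_SucE[OF D Suc.prems(2)]
  show ?case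
  proof (rule Ck_on_SucI[OF D, of _ "\<lambda>i x. partial_deriv i f x * g x + f x * partial_deriv i g x"])
    show "continuous_on D (\<lambda>x. f x * g x)" using f(1) g(1) by (rule continuous_on_mult)
    fix i assume i: "i < d"
    show "((\<lambda>t. f (x(i := t)) * g (x(i := t))) has_real_derivative
        partial_deriv i f x * g x + f x * partial_deriv i g x) (at (x i))" if "x \<in> D" for x
      by (rule DERIV_cong[OF DERIV_mult[OF f(2)[OF i that] g(2)[OF i that]]]) simp
    show "Ck_on k d D (\<lambda>x. partial_deriv i f x * g x + f x * partial_deriv i g x)"
      using Suc.prems f(3)[OF i] g(3)[OF i] Ck_on_SucD[OF D] by (intro Ck_on_add[OF D] Suc.IH)
  qed
qed

text \<open>The outer function comes with its whole sequence of derivatives, so the factor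
  \<open>h (Suc m) (f x)\<close> from the chain rule is again of the form treated. Hence the
  induction on \<open>k\<close> runs for all \<open>m\<close> at once.\<close>

lemma Ck_on_compose:
  assumes D: "openin (Euclidean_space d) D" and "Ck_on k d D f"
    and h: "\<And>m t. (h m has_real_derivative h (Suc m) t) (at t)"
  shows "Ck_on k d D (\<lambda>x. h m (f x))"
  using assms(2)
proof (induction k arbitrary: m)
  case 0
  have "continuous_on UNIV (h m)" by (rule DERIV_continuous_on, rule has_field_derivative_at_within, rule h)
  then have "continuous_on D f \<Longrightarrow> continuous_on D (\<lambda>x. h m (f x))"
    by (rule continuous_on_compose2) auto
  then show ?case using 0 openin_subset[OF D] by (simp add: Ck_on_0_iff)
next
  case (Suc k)
  note f = Ck_on_SucE[OF D Suc.prems]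
  show ?case
  proof (rule Ck_on_SucI[OF D, of _ "\<lambda>i x. h (Suc m) (f x) * partial_deriv i f x"])
    have "continuous_on UNIV (h m)" by (rule DERIV_continuous_on, rule has_field_derivative_at_within, rule h)
    then show "continuous_on D (\<lambda>x. h m (f x))"
      using f(1) by (rule continuous_on_compose2) auto
    fix i assume i: "i < d"
    show "((\<lambda>t. h m (f (x(i := t)))) has_real_derivative h (Suc m) (f x) * partial_deriv i f x) (at (x i))"
      if "x \<in> D" for x
      by (rule DERIV_chain2[where f = "h m" and g = "\<lambda>t. f (x(i := t))", OF _ f(2)[OF i that]])
        (simp add: h)
    show "Ck_on k d D (\<lambda>x. h (Suc m) (f x) * partial_deriv i f x)"
      using Suc.IH[of "Suc m"] Ck_on_SucD[OF D Suc.prems] f(3)[OF i] by (intro Ck_on_mult[OF D])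
  qed
qed

lemma partial_deriv_add_scaled:
  assumes D: "openin (Euclidean_space d) D" and "Ck_on 1 d D f" "Ck_on 1 d D g" "i < d" "x \<in> D"
  shows "partial_deriv i (\<lambda>x. f x + a * g x) x = partial_deriv i f x + a * partial_deriv i g x"
proof -
  have fg: "Ck_on (Suc 0) d D f" "Ck_on (Suc 0) d D g" using assms by simp_all
  show ?thesis
    unfolding partial_deriv_def[of i "\<lambda>x. f x + a * g x"]
    using Ck_on_SucE(2)[OF D fg(1) assms(4,5)] Ck_on_SucE(2)[OF D fg(2) assms(4,5)]
    by (intro DERIV_imp_deriv DERIV_add DERIV_cmult)
qed

lemma partial_deriv_mult:
  assumes D: "openin (Euclidean_space d) D" and "Ck_on 1 d D f" "Ck_on 1 d D g" "i < d" "x \<in> D"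
  shows "partial_deriv i (\<lambda>x. f x * g x) x = partial_deriv i f x * g x + f x * partial_deriv i g x"
proof -
  have fg: "Ck_on (Suc 0) d D f" "Ck_on (Suc 0) d D g" using assms by simp_all
  show ?thesis
    unfolding partial_deriv_def[of i "\<lambda>x. f x * g x"]
    by (rule DERIV_imp_deriv, rule DERIV_cong[OF DERIV_mult[OF
          Ck_on_SucE(2)[OF D fg(1) assms(4,5)] Ck_on_SucE(2)[OF D fg(2) assms(4,5)]]]) simp
qed

section \<open>Increments on cubes\<close>

lemma cube_line_increment:
  assumes D: "cube d c r \<subseteq> D"
    and der: "\<And>x. x \<in> D \<Longrightarrow> ((\<lambda>t. f (x(i := t))) has_real_derivative f' x) (at (x i))"
    and B: "\<And>x. x \<in> cube d c r \<Longrightarrow> \<bar>f' x\<bar> \<le> B"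
    and "i < d" "x \<in> cube d c r" "\<bar>s - c i\<bar> \<le> r"
  shows "\<bar>f (x(i := s)) - f x\<bar> \<le> B * \<bar>s - x i\<bar>"
proof -
  have in_cube: "x(i := t) \<in> cube d c r" if "t \<in> cball (c i) r" for t
    using that assms(4,5) by (auto simp: cube_def topspace_Euclidean_space dist_real_def abs_minus_commute)
  have "norm (f (x(i := s)) - f (x(i := x i))) \<le> B * norm (s - x i)"
  proof (rule field_differentiable_bound[OF convex_cball])
    fix t assume t: "t \<in> cball (c i) r"
    have "((\<lambda>u. f ((x(i := t))(i := u))) has_real_derivative f' (x(i := t))) (at t)"
      using der[OF subsetD[OF D in_cube[OF t]]] by (metis fun_upd_same)
    then show "((\<lambda>t. f (x(i := t))) has_real_derivative f' (x(i := t))) (at t within cball (c i) r)"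
      by (simp add: has_field_derivative_at_within)
    show "norm (f' (x(i := t))) \<le> B" using B[OF in_cube[OF t]] by simp
  qed (use assms(4-6) in \<open>auto simp: cube_def dist_real_def abs_minus_commute\<close>)
  then show ?thesis by simp
qed

text \<open>Coordinates are exchanged one at a time, and each exchange is a mean value estimate on a
  coordinate line. The mixed points \<open>z m\<close> stay inside a cube, which is why cubes are
  used instead of balls.\<close>

lemma cube_increment:
  assumes D: "cube d c r \<subseteq> D"
    and der: "\<And>i x. i < d \<Longrightarrow> x \<in> D \<Longrightarrow> ((\<lambda>t. f (x(i := t))) has_real_derivative f' i x) (at (x i))"
    and B: "\<And>i x. i < d \<Longrightarrow> x \<in> cube d c r \<Longrightarrow> \<bar>f' i x\<bar> \<le> B"
    and xy: "x \<in> cube d c r" "y \<in> cube d c r"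
  shows "\<bar>f x - f y\<bar> \<le> B * (\<Sum>i<d. \<bar>x i - y i\<bar>)"
proof -
  define z where "z m = (\<lambda>i. if i < m then x i else y i)" for m :: nat
  have z: "z m \<in> cube d c r" for m
    using xy by (auto simp: z_def cube_def topspace_Euclidean_space)
  have "\<bar>f (z m) - f y\<bar> \<le> B * (\<Sum>i<m. \<bar>x i - y i\<bar>)" if "m \<le> d" for m
    using that
  proof (induction m)
    case 0
    have "z 0 = y" by (auto simp: z_def)
    then show ?case by simp
  next
    case (Suc m)
    have eq: "z (Suc m) = (z m)(m := x m)" by (auto simp: z_def)
    have "\<bar>f ((z m)(m := x m)) - f (z m)\<bar> \<le> B * \<bar>x m - z m m\<bar>"
      by (rule cube_line_increment[OF D der B _ z]) (use Suc.prems xy in \<open>auto simp: cube_def\<close>)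
    then have "\<bar>f (z (Suc m)) - f (z m)\<bar> \<le> B * \<bar>x m - y m\<bar>"
      by (simp add: eq) (simp add: z_def)
    with Suc show ?case by (simp add: algebra_simps)
  qed
  moreover have "z d = x"
    using xy by (auto simp: z_def cube_def topspace_Euclidean_space fun_eq_iff)
  ultimately show ?thesis by (metis order_refl)
qed

lemma Ck_on_0_cube_bound:
  assumes D: "openin (Euclidean_space d) D" and f: "Ck_on 0 d D f" and c: "cube d c r \<subseteq> D"
  obtains B where "B \<ge> 0" "\<And>x. x \<in> cube d c r \<Longrightarrow> \<bar>f x\<bar> \<le> B"
proof -
  have "continuous_on (cube d c r) f"
    using f c openin_subset[OF D] by (metis Ck_on_0_iff continuous_on_subset)
  then have "bounded (f ` cube d c r)"
    by (intro compact_imp_bounded compact_continuous_image compact_cube)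
  then obtain B where "B > 0" "\<And>x. x \<in> cube d c r \<Longrightarrow> \<bar>f x\<bar> \<le> B"
    by (auto simp: bounded_pos)
  then show ?thesis using that[of B] by force
qed

lemma Ck_on_1_Lipschitz:
  assumes D: "openin (Euclidean_space d) D" and f: "Ck_on 1 d D f" and c: "cube d c r \<subseteq> D"
  obtains L where "L \<ge> 0"
    "\<And>x y. x \<in> cube d c r \<Longrightarrow> y \<in> cube d c r \<Longrightarrow> \<bar>f x - f y\<bar> \<le> L * (\<Sum>i<d. \<bar>x i - y i\<bar>)"
proof -
  have f1: "Ck_on (Suc 0) d D f" using f by simp
  note f' = Ck_on_SucE[OF D f1]
  have "\<exists>B\<ge>0. \<forall>x\<in>cube d c r. \<bar>partial_deriv i f x\<bar> \<le> B" if "i < d" for i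
    using Ck_on_0_cube_bound[OF D f'(3)[OF that] c] by metis
  then obtain B where B: "\<And>i. i < d \<Longrightarrow> B i \<ge> 0"
    "\<And>i x. i < d \<Longrightarrow> x \<in> cube d c r \<Longrightarrow> \<bar>partial_deriv i f x\<bar> \<le> B i" by metis
  have "\<bar>partial_deriv i f x\<bar> \<le> (\<Sum>i<d. B i)" if "i < d" "x \<in> cube d c r" for i x
    using B(2)[OF that] member_le_sum[of i "{..<d}" B] B(1) that by force
  then have "\<bar>f x - f y\<bar> \<le> (\<Sum>i<d. B i) * (\<Sum>i<d. \<bar>x i - y i\<bar>)"
    if "x \<in> cube d c r" "y \<in> cube d c r" for x y
    using cube_increment[OF c f'(2) _ that] by blast
  moreover have "(\<Sum>i<d. B i) \<ge> 0" using B(1) by (intro sum_nonneg) auto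
  ultimately show ?thesis using that by blast
qed

text \<open>Subtracting the linearization at \<open>x\<close> leaves a function with small partial derivatives near
  \<open>x\<close>, so the increment estimate gives differentiability.\<close>

lemma Ck_on_1_linearization:
  assumes D: "openin (Euclidean_space d) D" and f: "Ck_on 1 d D f" and "x \<in> D" "e > 0"
  obtains r where "r > 0" "cube d x r \<subseteq> D"
    "\<And>z. z \<in> cube d x r \<Longrightarrow>
      \<bar>f z - f x - (\<Sum>i<d. partial_deriv i f x * (z i - x i))\<bar> \<le> e * (\<Sum>i<d. \<bar>z i - x i\<bar>)"
proof -
  have f1: "Ck_on (Suc 0) d D f" using f by simp
  note f' = Ck_on_SucE[OF D f1]
  have DE: "D \<subseteq> Espace d" using openin_subset[OF D] .
  have cont: "continuous_on D (partial_deriv i f)" if "i < d" for i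
    using f'(3)[OF that] DE by (simp add: Ck_on_0_iff)
  have "\<exists>T. open T \<and> x \<in> T \<and> (\<forall>z\<in>T \<inter> D. \<bar>partial_deriv i f z - partial_deriv i f x\<bar> < e)" if "i < d" for i
  proof -
    have "open (ball (partial_deriv i f x) e)" "partial_deriv i f x \<in> ball (partial_deriv i f x) e"
      using assms(4) by auto
    with cont[OF that] assms(3) obtain T where "open T" "x \<in> T"
      "\<forall>z\<in>D. z \<in> T \<longrightarrow> partial_deriv i f z \<in> ball (partial_deriv i f x) e"
      unfolding continuous_on_topological by metis
    then show ?thesis by (intro exI[of _ T]) (auto simp: dist_real_def abs_minus_commute)
  qed
  then obtain T where T: "\<And>i. i < d \<Longrightarrow> open (T i)" "\<And>i. i < d \<Longrightarrow> x \<in> T i"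
    "\<And>i z. i < d \<Longrightarrow> z \<in> T i \<inter> D \<Longrightarrow> \<bar>partial_deriv i f z - partial_deriv i f x\<bar> < e" by metis
  obtain T0 where T0: "open T0" "D = T0 \<inter> Espace d" using D openin_Euclidean_space_iff by auto
  have "open ((\<Inter>i\<in>{..<d}. T i) \<inter> T0)" using T T0 by (intro open_Int open_INT) auto
  then have "openin (Euclidean_space d) ((\<Inter>i\<in>{..<d}. T i) \<inter> T0 \<inter> Espace d)"
    using openin_Euclidean_space_iff by blast
  moreover have "x \<in> (\<Inter>i\<in>{..<d}. T i) \<inter> T0 \<inter> Espace d" using T(2) T0 assms(3) by auto
  ultimately obtain r where r: "r > 0" "cube d x r \<subseteq> (\<Inter>i\<in>{..<d}. T i) \<inter> T0 \<inter> Espace d"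
    by (rule openin_contains_cube)
  then have rD: "cube d x r \<subseteq> D" using T0 by auto
  define g where "g z = f z - (\<Sum>i<d. partial_deriv i f x * z i)" for z
  have der: "((\<lambda>t. g (z(i := t))) has_real_derivative (partial_deriv i f z - partial_deriv i f x)) (at (z i))"
    if "i < d" "z \<in> D" for i z
  proof -
    have "(\<Sum>j<d. partial_deriv j f x * (z(i := t)) j) =
        partial_deriv i f x * t + (\<Sum>j\<in>{..<d} - {i}. partial_deriv j f x * z j)" for t
      using that(1) by (subst sum.remove[of _ i]) auto
    then show ?thesis unfolding g_def using f'(2)[OF that]
      by (auto intro!: derivative_eq_intros)
  qed
  have "\<bar>g z - g x\<bar> \<le> e * (\<Sum>i<d. \<bar>z i - x i\<bar>)" if z: "z \<in> cube d x r" for z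
  proof (rule cube_increment[OF rD der _ z])
    show "\<bar>partial_deriv i f u - partial_deriv i f x\<bar> \<le> e" if "i < d" "u \<in> cube d x r" for i u
      using T(3)[OF that(1), of u] r(2) rD that by force
    show "x \<in> cube d x r" using r(1) assms(3) DE by (auto simp: cube_def)
  qed auto
  moreover have "g z - g x = f z - f x - (\<Sum>i<d. partial_deriv i f x * (z i - x i))" for z
    by (simp add: g_def right_diff_distrib sum_subtractf)
  ultimately show ?thesis using that[OF r(1) rD] by simp
qed

text \<open>Chain rule along a curve that is differentiable at 0 only: the linearization of
  \<open>f\<close> at \<open>c 0\<close> is divided by \<open>t\<close>, and its error is small
  relative to the bounded quotients \<open>(c t i - c 0 i) / t\<close>.\<close>

lemma Ck_on_1_curve_derivative:
  fixes c :: "real \<Rightarrow> nat \<Rightarrow> real"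
  assumes D: "openin (Euclidean_space d) D" and f: "Ck_on 1 d D f" and "c 0 \<in> D"
    and cE: "\<And>t. c t \<in> Espace d"
    and c': "\<And>i. i < d \<Longrightarrow> ((\<lambda>t. c t i) has_real_derivative v i) (at 0)"
  shows "((\<lambda>t. f (c t)) has_real_derivative (\<Sum>i<d. v i * partial_deriv i f (c 0))) (at 0)"
proof -
  let ?l = "\<lambda>t. \<Sum>i<d. partial_deriv i f (c 0) * (c t i - c 0 i)"
  let ?R = "\<lambda>t. f (c t) - f (c 0) - ?l t"
  have quot: "((\<lambda>t. (c t i - c 0 i) / t) \<longlongrightarrow> v i) (at 0)" if "i < d" for i
    using c'[OF that] by (simp add: has_field_derivative_iff)
  have "((\<lambda>t. \<Sum>i<d. partial_deriv i f (c 0) * ((c t i - c 0 i) / t)) \<longlongrightarrow>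
      (\<Sum>i<d. partial_deriv i f (c 0) * v i)) (at 0)"
    by (intro tendsto_sum tendsto_mult tendsto_const quot) auto
  then have lin: "((\<lambda>t. ?l t / t) \<longlongrightarrow> (\<Sum>i<d. v i * partial_deriv i f (c 0))) (at 0)"
    by (simp add: sum_divide_distrib mult.commute)
  have sumq: "((\<lambda>t. \<Sum>i<d. \<bar>(c t i - c 0 i) / t\<bar>) \<longlongrightarrow> (\<Sum>i<d. \<bar>v i\<bar>)) (at 0)"
    by (intro tendsto_sum tendsto_rabs quot) auto
  \<comment> \<open>The added 1 makes \<open>V\<close> positive and strictly larger than the limit
    of the sum of quotients, so that the sum is eventually below \<open>V\<close>.\<close>
  define V where "V = (\<Sum>i<d. \<bar>v i\<bar>) + 1"
  have V: "V > 0" unfolding V_def by (intro add_nonneg_pos sum_nonneg) auto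
  have evV: "eventually (\<lambda>t. (\<Sum>i<d. \<bar>(c t i - c 0 i) / t\<bar>) < V) (at 0)"
    using order_tendstoD(2)[OF sumq, of V] by (simp add: V_def)
  have rest: "((\<lambda>t. ?R t / t) \<longlongrightarrow> 0) (at 0)"
  proof (rule tendstoI)
    fix e :: real assume "e > 0"
    then have "e / V > 0" using V by simp
    then obtain r where r: "r > 0"
      "\<And>z. z \<in> cube d (c 0) r \<Longrightarrow>
        \<bar>f z - f (c 0) - (\<Sum>i<d. partial_deriv i f (c 0) * (z i - c 0 i))\<bar> \<le> e / V * (\<Sum>i<d. \<bar>z i - c 0 i\<bar>)"
      by (rule Ck_on_1_linearization[OF D f assms(3)]) blast
    have "eventually (\<lambda>t. \<bar>c t i - c 0 i\<bar> \<le> r) (at 0)" if "i < d" for i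
    proof -
      have "((\<lambda>t. c t i) \<longlongrightarrow> c 0 i) (at 0)"
        using DERIV_isCont[OF c'[OF that]] by (simp add: isCont_def)
      from tendstoD[OF this r(1)] show ?thesis
        by eventually_elim (simp add: dist_real_def)
    qed
    then have "eventually (\<lambda>t. \<forall>i\<in>{..<d}. \<bar>c t i - c 0 i\<bar> \<le> r) (at 0)"
      by (subst eventually_ball_finite_distrib) auto
    moreover have "eventually (\<lambda>t::real. t \<noteq> 0) (at 0)" by (simp add: eventually_at_filter)
    ultimately show "eventually (\<lambda>t. dist (?R t / t) 0 < e) (at 0)"
      using evV
    proof eventually_elim
      case (elim t)
      then have "c t \<in> cube d (c 0) r" using cE by (auto simp: cube_def)
      from r(2)[OF this] have "\<bar>?R t\<bar> / \<bar>t\<bar> \<le> e / V * (\<Sum>i<d. \<bar>c t i - c 0 i\<bar>) / \<bar>t\<bar>"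
        by (intro divide_right_mono) auto
      also have "\<dots> = e / V * (\<Sum>i<d. \<bar>(c t i - c 0 i) / t\<bar>)"
        by (simp flip: sum_divide_distrib)
      also have "\<dots> < e / V * V" using elim(3) \<open>e > 0\<close> V by (intro mult_strict_left_mono) auto
      finally show ?case using V by simp
    qed
  qed
  have "((\<lambda>t. ?R t / t + ?l t / t) \<longlongrightarrow> 0 + (\<Sum>i<d. v i * partial_deriv i f (c 0))) (at 0)"
    by (intro tendsto_add rest lin)
  moreover have "?R t / t + ?l t / t = (f (c t) - f (c 0)) / t" for t
    by (simp flip: add_divide_distrib)
  ultimately show ?thesis by (simp add: has_field_derivative_iff)
qed

section \<open>A smooth function vanishing on a half-line\<close>

text \<open>The \<open>k\<close>-th derivative of \<open>exp (1 - 1 / t)\<close>, extended by zero, has the form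
  \<open>p (1 / t) * exp (1 - 1 / t)\<close>.\<close>

fun flat_poly :: "nat \<Rightarrow> real poly" where
  "flat_poly 0 = 1"
| "flat_poly (Suc k) = [:0, 0, 1:] * (flat_poly k - pderiv (flat_poly k))"

definition flat_deriv :: "nat \<Rightarrow> real \<Rightarrow> real" where
  "flat_deriv k t = (if t > 0 then poly (flat_poly k) (1 / t) * exp (1 - 1 / t) else 0)"

text \<open>The shift by 1 in the exponent normalises \<open>flat 1 = 1\<close>, so that bumps take
  the value 1 at their centre and stay in [0, 1].\<close>

definition flat :: "real \<Rightarrow> real" where
  "flat = flat_deriv 0"

lemma tendsto_poly_div_exp: "((\<lambda>x. poly p x / exp x) \<longlongrightarrow> (0::real)) at_top"
proof -
  have "((\<lambda>x. \<Sum>i\<le>degree p. coeff p i * (x ^ i / exp x)) \<longlongrightarrow> (\<Sum>i\<le>degree p. coeff p i * 0)) at_top"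
    by (intro tendsto_sum tendsto_mult tendsto_const tendsto_power_div_exp_0)
  then show ?thesis by (simp add: poly_altdef sum_divide_distrib)
qed

text \<open>With x = 1 / t, differentiating p(x) exp (1 - x) in t produces x^2 (p(x) - p'(x)) exp (1
  - x), which is the recursion of \<open>flat_poly\<close>. At 0 both one-sided difference quotients
  tend to 0.\<close>

lemma flat_deriv_has_derivative:
  "(flat_deriv k has_real_derivative flat_deriv (Suc k) t) (at t)"
proof -
  consider "t > 0" | "t < 0" | "t = 0" by linarith
  then show ?thesis
  proof cases
    case 1
    let ?g = "\<lambda>t. poly (flat_poly k) (1 / t) * exp (1 - 1 / t)"
    have "(?g has_real_derivative flat_deriv (Suc k) t) (at t)"
      using 1 by (auto intro!: derivative_eq_intros DERIV_chain2[OF poly_DERIV]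
          simp: flat_deriv_def field_simps power2_eq_square)
    moreover have ev: "eventually (\<lambda>s. ?g s = flat_deriv k s) (nhds t)"
      using eventually_nhds_in_open[of "{0<..}" t] 1
      by (auto simp: flat_deriv_def elim: eventually_mono)
    ultimately show ?thesis using DERIV_cong_ev[OF refl ev refl] by simp
  next
    case 2
    have "((\<lambda>_. 0) has_real_derivative 0) (at t)" by simp
    moreover have ev: "eventually (\<lambda>s. 0 = flat_deriv k s) (nhds t)"
      using eventually_nhds_in_open[of "{..<0}" t] 2
      by (auto simp: flat_deriv_def elim!: eventually_mono)
    ultimately have "(flat_deriv k has_real_derivative 0) (at t)"
      using DERIV_cong_ev[OF refl ev refl] by simp
    then show ?thesis using 2 by (simp add: flat_deriv_def)
  next
    case 3
    \<comment> \<open>In the variable \<open>inverse s\<close>, the quotient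
      \<open>flat_deriv k s / s\<close> is \<open>?q\<close> divided by the exponential:
      \<open>pCons 0\<close> accounts for the division by \<open>s\<close>, and \<open>exp 1\<close>
      for the shift in the exponent.\<close>
    let ?q = "pCons 0 (smult (exp 1) (flat_poly k))"
    have "((\<lambda>s. poly ?q (inverse s) / exp (inverse s)) \<longlongrightarrow> 0) (at_right 0)"
      by (rule filterlim_compose[OF tendsto_poly_div_exp filterlim_inverse_at_top_right])
    then have r: "((\<lambda>s. flat_deriv k s / s) \<longlongrightarrow> 0) (at_right 0)"
    proof (rule Lim_transform_eventually)
      have "eventually (\<lambda>s::real. s > 0) (at_right 0)" by (simp add: eventually_at_right_less)
      then show "eventually (\<lambda>s. poly ?q (inverse s) / exp (inverse s) = flat_deriv k s / s) (at_right 0)"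
        by eventually_elim (simp add: flat_deriv_def exp_diff inverse_eq_divide mult.commute)
    qed
    have "((\<lambda>_. 0) \<longlongrightarrow> (0::real)) (at_left (0::real))" by simp
    then have l: "((\<lambda>s. flat_deriv k s / s) \<longlongrightarrow> 0) (at_left 0)"
    proof (rule Lim_transform_eventually)
      have "eventually (\<lambda>s::real. s < 0) (at_left 0)" by (rule eventually_at_leftI[of "-1"]) auto
      then show "eventually (\<lambda>s. 0 = flat_deriv k s / s) (at_left 0)"
        by eventually_elim (simp add: flat_deriv_def)
    qed
    have "((\<lambda>s. flat_deriv k s / s) \<longlongrightarrow> 0) (at 0)" using l r filterlim_at_split by blast
    then show ?thesis using 3 by (simp add: has_field_derivative_iff flat_deriv_def)
  qed
qed

lemma flat_eq: "flat t = (if t > 0 then exp (1 - 1 / t) else 0)"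
  by (simp add: flat_def flat_deriv_def)

lemma flat_bounds: "0 \<le> flat t" "t \<le> 1 \<Longrightarrow> flat t \<le> 1"
  by (auto simp: flat_eq field_simps)

lemma flat_eq_0_iff: "flat t = 0 \<longleftrightarrow> t \<le> 0" and flat_1: "flat 1 = 1"
  by (auto simp: flat_eq)

lemma continuous_on_flat: "continuous_on A flat"
  unfolding flat_def
  by (rule DERIV_continuous_on, rule has_field_derivative_at_within, rule flat_deriv_has_derivative)

section \<open>Smooth functions of lower-dimensional parameters have null image\<close>

text \<open>The cell map \<open>c M\<close> stands for rounding the parameters in \<open>Z\<close> to precision \<open>1 / M\<close>. It
  allows parameter spaces of arbitrary type, whose dimension is then the growth rate of the number of
  cells.\<close>

definition cell_Lipschitz :: "'z set \<Rightarrow> (nat \<Rightarrow> 'z \<Rightarrow> 'c) \<Rightarrow> ('z \<Rightarrow> real) \<Rightarrow> bool" where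
  "cell_Lipschitz Z c h \<longleftrightarrow> (\<exists>B\<ge>0. \<forall>z\<in>Z. \<bar>h z\<bar> \<le> B) \<and>
     (\<exists>L\<ge>0. \<forall>M\<ge>1. \<forall>z\<in>Z. \<forall>w\<in>Z. c M z = c M w \<longrightarrow> \<bar>h z - h w\<bar> \<le> L / real M)"

definition cell_dim :: "'z set \<Rightarrow> (nat \<Rightarrow> 'z \<Rightarrow> 'c) \<Rightarrow> nat \<Rightarrow> bool" where
  "cell_dim Z c m \<longleftrightarrow>
     (\<exists>C\<ge>0. \<forall>M\<ge>1. finite (c M ` Z) \<and> real (card (c M ` Z)) \<le> C * real M ^ m)"

lemma cell_LipschitzI:
  assumes "\<And>z. z \<in> Z \<Longrightarrow> \<bar>h z\<bar> \<le> B" "B \<ge> 0" "L \<ge> 0"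
    "\<And>M z w. M \<ge> 1 \<Longrightarrow> z \<in> Z \<Longrightarrow> w \<in> Z \<Longrightarrow> c M z = c M w \<Longrightarrow> \<bar>h z - h w\<bar> \<le> L / real M"
  shows "cell_Lipschitz Z c h"
  using assms unfolding cell_Lipschitz_def by blast

lemma cell_LipschitzE:
  assumes "cell_Lipschitz Z c h"
  obtains B L where "B \<ge> 0" "L \<ge> 0" "\<And>z. z \<in> Z \<Longrightarrow> \<bar>h z\<bar> \<le> B"
    "\<And>M z w. M \<ge> 1 \<Longrightarrow> z \<in> Z \<Longrightarrow> w \<in> Z \<Longrightarrow> c M z = c M w \<Longrightarrow> \<bar>h z - h w\<bar> \<le> L / real M"
  using assms unfolding cell_Lipschitz_def by blast

section \<open>Algebra of cell-Lipschitz functions\<close>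

lemma cell_Lipschitz_const: "cell_Lipschitz Z c (\<lambda>_. a)"
  by (rule cell_LipschitzI[of _ _ "\<bar>a\<bar>" 0]) auto

lemma cell_Lipschitz_add:
  assumes "cell_Lipschitz Z c f" "cell_Lipschitz Z c g"
  shows "cell_Lipschitz Z c (\<lambda>z. f z + g z)"
proof -
  obtain B L where f: "B \<ge> 0" "L \<ge> 0" "\<And>z. z \<in> Z \<Longrightarrow> \<bar>f z\<bar> \<le> B"
    "\<And>M z w. M \<ge> 1 \<Longrightarrow> z \<in> Z \<Longrightarrow> w \<in> Z \<Longrightarrow> c M z = c M w \<Longrightarrow> \<bar>f z - f w\<bar> \<le> L / real M"
    using cell_LipschitzE[OF assms(1)] by metis
  obtain B' L' where g: "B' \<ge> 0" "L' \<ge> 0" "\<And>z. z \<in> Z \<Longrightarrow> \<bar>g z\<bar> \<le> B'"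
    "\<And>M z w. M \<ge> 1 \<Longrightarrow> z \<in> Z \<Longrightarrow> w \<in> Z \<Longrightarrow> c M z = c M w \<Longrightarrow> \<bar>g z - g w\<bar> \<le> L' / real M"
    using cell_LipschitzE[OF assms(2)] by metis
  show ?thesis
  proof (rule cell_LipschitzI)
    show "\<bar>f z + g z\<bar> \<le> B + B'" if "z \<in> Z" for z using f(3) g(3) that by force
    show "\<bar>f z + g z - (f w + g w)\<bar> \<le> (L + L') / real M"
      if "M \<ge> 1" "z \<in> Z" "w \<in> Z" "c M z = c M w" for M z w
      using f(4)[OF that] g(4)[OF that] by (simp add: add_divide_distrib)
  qed (use f g in auto)
qed

text \<open>In f g - f' g' = f (g - g') + (f - f') g' the undifferenced factors must be bounded;
  this is why boundedness is part of \<open>cell_Lipschitz\<close>.\<close>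

lemma cell_Lipschitz_mult:
  assumes "cell_Lipschitz Z c f" "cell_Lipschitz Z c g"
  shows "cell_Lipschitz Z c (\<lambda>z. f z * g z)"
proof -
  obtain B L where f: "B \<ge> 0" "L \<ge> 0" "\<And>z. z \<in> Z \<Longrightarrow> \<bar>f z\<bar> \<le> B"
    "\<And>M z w. M \<ge> 1 \<Longrightarrow> z \<in> Z \<Longrightarrow> w \<in> Z \<Longrightarrow> c M z = c M w \<Longrightarrow> \<bar>f z - f w\<bar> \<le> L / real M"
    using cell_LipschitzE[OF assms(1)] by metis
  obtain B' L' where g: "B' \<ge> 0" "L' \<ge> 0" "\<And>z. z \<in> Z \<Longrightarrow> \<bar>g z\<bar> \<le> B'"
    "\<And>M z w. M \<ge> 1 \<Longrightarrow> z \<in> Z \<Longrightarrow> w \<in> Z \<Longrightarrow> c M z = c M w \<Longrightarrow> \<bar>g z - g w\<bar> \<le> L' / real M"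
    using cell_LipschitzE[OF assms(2)] by metis
  show ?thesis
  proof (rule cell_LipschitzI)
    show "\<bar>f z * g z\<bar> \<le> B * B'" if "z \<in> Z" for z
      using f(1) f(3)[OF that] g(3)[OF that] by (simp add: abs_mult mult_mono)
    show "\<bar>f z * g z - f w * g w\<bar> \<le> (B * L' + L * B') / real M"
      if "M \<ge> 1" "z \<in> Z" "w \<in> Z" "c M z = c M w" for M z w
    proof -
      have "f z * g z - f w * g w = f z * (g z - g w) + (f z - f w) * g w" by (simp add: algebra_simps)
      then have "\<bar>f z * g z - f w * g w\<bar> \<le> \<bar>f z\<bar> * \<bar>g z - g w\<bar> + \<bar>f z - f w\<bar> * \<bar>g w\<bar>"
        by (metis abs_mult abs_triangle_ineq)
      also have "\<dots> \<le> B * (L' / real M) + (L / real M) * B'"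
        using f(1-3) g(1-3) that f(4)[OF that] g(4)[OF that] by (intro add_mono mult_mono) auto
      finally show ?thesis by (simp add: add_divide_distrib)
    qed
  qed (use f g in auto)
qed

lemma cell_Lipschitz_sum:
  assumes "\<And>i. i \<in> A \<Longrightarrow> cell_Lipschitz Z c (f i)"
  shows "cell_Lipschitz Z c (\<lambda>z. \<Sum>i\<in>A. f i z)"
  using assms
  by (induction A rule: infinite_finite_induct)
    (auto intro: cell_Lipschitz_const cell_Lipschitz_add)

lemma cell_Lipschitz_diff:
  assumes "cell_Lipschitz Z c f" "cell_Lipschitz Z c g"
  shows "cell_Lipschitz Z c (\<lambda>z. f z - g z)"
  using cell_Lipschitz_add[OF assms(1) cell_Lipschitz_mult[OF cell_Lipschitz_const[of Z c "-1"] assms(2)]]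
  by simp

text \<open>The lower bound \<open>e\<close> enters both the bound and the constant, so denominators
  will have to be sorted by how far they stay from 0.\<close>

lemma cell_Lipschitz_inverse:
  assumes "cell_Lipschitz Z c f" "e > 0" "\<And>z. z \<in> Z \<Longrightarrow> \<bar>f z\<bar> \<ge> e"
  shows "cell_Lipschitz Z c (\<lambda>z. inverse (f z))"
proof -
  obtain B L where f: "B \<ge> 0" "L \<ge> 0" "\<And>z. z \<in> Z \<Longrightarrow> \<bar>f z\<bar> \<le> B"
    "\<And>M z w. M \<ge> 1 \<Longrightarrow> z \<in> Z \<Longrightarrow> w \<in> Z \<Longrightarrow> c M z = c M w \<Longrightarrow> \<bar>f z - f w\<bar> \<le> L / real M"
    using cell_LipschitzE[OF assms(1)] by metis
  show ?thesis
  proof (rule cell_LipschitzI)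
    show "\<bar>inverse (f z)\<bar> \<le> inverse e" if "z \<in> Z" for z
      using assms(2) assms(3)[OF that] by (simp add: abs_inverse le_imp_inverse_le)
    show "\<bar>inverse (f z) - inverse (f w)\<bar> \<le> inverse e * L * inverse e / real M"
      if "M \<ge> 1" "z \<in> Z" "w \<in> Z" "c M z = c M w" for M z w
    proof -
      have nz: "f z \<noteq> 0" "f w \<noteq> 0" using assms(2) assms(3)[OF that(2)] assms(3)[OF that(3)] by auto
      have "\<bar>inverse (f z) - inverse (f w)\<bar> = inverse \<bar>f z\<bar> * \<bar>f z - f w\<bar> * inverse \<bar>f w\<bar>"
        by (simp add: inverse_diff_inverse[OF nz] abs_mult abs_inverse)
      also have "\<dots> \<le> inverse e * (L / real M) * inverse e"
        using assms(2) assms(3)[OF that(2)] assms(3)[OF that(3)] f(2) f(4)[OF that]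
        by (intro mult_mono le_imp_inverse_le) auto
      finally show ?thesis by simp
    qed
  qed (use assms(2) f in auto)
qed

lemma cell_Lipschitz_subset:
  assumes "cell_Lipschitz Z c f" "Z' \<subseteq> Z"
  shows "cell_Lipschitz Z' c f"
  using assms unfolding cell_Lipschitz_def by (meson subsetD)

lemma cell_dim_subset:
  assumes "cell_dim Z c m" "Z' \<subseteq> Z"
  shows "cell_dim Z' c m"
proof -
  obtain C where C: "C \<ge> 0" "\<And>M. M \<ge> 1 \<Longrightarrow> finite (c M ` Z)" "\<And>M. M \<ge> 1 \<Longrightarrow> real (card (c M ` Z)) \<le> C * real M ^ m"
    using assms(1) unfolding cell_dim_def by blast
  have "finite (c M ` Z') \<and> real (card (c M ` Z')) \<le> C * real M ^ m" if "M \<ge> 1" for M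
  proof -
    have "card (c M ` Z') \<le> card (c M ` Z)" using assms(2) C(2)[OF that] by (intro card_mono image_mono)
    then show ?thesis using C(2)[OF that] C(3)[OF that] assms(2)
      by (meson finite_subset image_mono of_nat_le_iff order_trans)
  qed
  then show ?thesis using C(1) unfolding cell_dim_def by blast
qed

section \<open>Products of parameter spaces\<close>

definition pair_cell :: "(nat \<Rightarrow> 'z \<Rightarrow> 'c) \<Rightarrow> (nat \<Rightarrow> 'w \<Rightarrow> 'd) \<Rightarrow> nat \<Rightarrow> 'z \<times> 'w \<Rightarrow> 'c \<times> 'd" where
  "pair_cell c c' M p = (c M (fst p), c' M (snd p))"

text \<open>Rounding the components separately multiplies the numbers of cells, so exponents add.
  This gives the count of parameters for pairs of points and for tangent vectors.\<close>

lemma cell_dim_pair: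
  assumes "cell_dim Z c m" "cell_dim Z' c' m'"
  shows "cell_dim (Z \<times> Z') (pair_cell c c') (m + m')"
proof -
  obtain C where C: "C \<ge> 0" "\<And>M. M \<ge> 1 \<Longrightarrow> finite (c M ` Z)" "\<And>M. M \<ge> 1 \<Longrightarrow> real (card (c M ` Z)) \<le> C * real M ^ m"
    using assms(1) unfolding cell_dim_def by blast
  obtain C' where C': "C' \<ge> 0" "\<And>M. M \<ge> 1 \<Longrightarrow> finite (c' M ` Z')"
    "\<And>M. M \<ge> 1 \<Longrightarrow> real (card (c' M ` Z')) \<le> C' * real M ^ m'"
    using assms(2) unfolding cell_dim_def by blast
  have "finite (pair_cell c c' M ` (Z \<times> Z')) \<and>
      real (card (pair_cell c c' M ` (Z \<times> Z'))) \<le> C * C' * real M ^ (m + m')" if M: "M \<ge> 1" for M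
  proof -
    have eq: "pair_cell c c' M ` (Z \<times> Z') = c M ` Z \<times> c' M ` Z'"
      by (auto simp: pair_cell_def image_iff)
    have "real (card (c M ` Z)) * real (card (c' M ` Z')) \<le> (C * real M ^ m) * (C' * real M ^ m')"
      using C(1) C(3)[OF M] C'(3)[OF M] by (intro mult_mono) auto
    then show ?thesis using C(2)[OF M] C'(2)[OF M]
      by (simp add: eq card_cartesian_product power_add algebra_simps)
  qed
  then show ?thesis using C(1) C'(1) unfolding cell_dim_def by (metis mult_nonneg_nonneg)
qed

lemma cell_Lipschitz_fst:
  assumes "cell_Lipschitz Z c f" shows "cell_Lipschitz (Z \<times> Z') (pair_cell c c') (\<lambda>p. f (fst p))"
proof -
  obtain B L where f: "B \<ge> 0" "L \<ge> 0" "\<And>z. z \<in> Z \<Longrightarrow> \<bar>f z\<bar> \<le> B"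
    "\<And>M z w. M \<ge> 1 \<Longrightarrow> z \<in> Z \<Longrightarrow> w \<in> Z \<Longrightarrow> c M z = c M w \<Longrightarrow> \<bar>f z - f w\<bar> \<le> L / real M"
    using cell_LipschitzE[OF assms] by metis
  show ?thesis by (rule cell_LipschitzI[of _ _ B L]) (use f in \<open>auto simp: pair_cell_def\<close>)
qed

lemma cell_Lipschitz_snd:
  assumes "cell_Lipschitz Z' c' f" shows "cell_Lipschitz (Z \<times> Z') (pair_cell c c') (\<lambda>p. f (snd p))"
proof -
  obtain B L where f: "B \<ge> 0" "L \<ge> 0" "\<And>z. z \<in> Z' \<Longrightarrow> \<bar>f z\<bar> \<le> B"
    "\<And>M z w. M \<ge> 1 \<Longrightarrow> z \<in> Z' \<Longrightarrow> w \<in> Z' \<Longrightarrow> c' M z = c' M w \<Longrightarrow> \<bar>f z - f w\<bar> \<le> L / real M"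
    using cell_LipschitzE[OF assms] by metis
  show ?thesis by (rule cell_LipschitzI[of _ _ B L]) (use f in \<open>auto simp: pair_cell_def\<close>)
qed

text \<open>Restriction to indices below \<open>d\<close> makes every cell an element of an
  extensional product of integer intervals, whose cardinality is a product.\<close>

definition grid_cell :: "nat \<Rightarrow> nat \<Rightarrow> (nat \<Rightarrow> real) \<Rightarrow> nat \<Rightarrow> int" where
  "grid_cell d M x = (\<lambda>i\<in>{..<d}. \<lfloor>real M * x i\<rfloor>)"

lemma grid_cell_close:
  assumes "grid_cell d M x = grid_cell d M y" "i < d" "M \<ge> 1"
  shows "\<bar>x i - y i\<bar> \<le> 1 / real M"
proof -
  have "\<lfloor>real M * x i\<rfloor> = \<lfloor>real M * y i\<rfloor>"
    using assms(2) fun_cong[OF assms(1), of i] by (simp add: grid_cell_def)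
  then have "\<bar>real M * x i - real M * y i\<bar> \<le> 1" by linarith
  then have "real M * \<bar>x i - y i\<bar> \<le> 1" by (simp flip: right_diff_distrib add: abs_mult)
  then show ?thesis using assms(3) by (simp add: field_simps)
qed

lemma cell_dim_cube: "cell_dim (cube d c r) (grid_cell d) d"
proof -
  \<comment> \<open>An interval of length 2r, scaled by M, meets at most 2rM + 2 integer floors, and
    2 is at most 2M. The absolute value keeps \<open>C\<close> nonnegative for every
    \<open>r\<close>.\<close>
  define C where "C = 2 * \<bar>r\<bar> + 2"
  have "finite (grid_cell d M ` cube d c r) \<and> real (card (grid_cell d M ` cube d c r)) \<le> C ^ d * real M ^ d"
    if M: "M \<ge> 1" for M
  proof -
    let ?J = "\<lambda>i. {\<lfloor>real M * (c i - r)\<rfloor>..\<lfloor>real M * (c i + r)\<rfloor>}"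
    have sub: "grid_cell d M ` cube d c r \<subseteq> Pi\<^sub>E {..<d} ?J"
    proof
      fix g assume "g \<in> grid_cell d M ` cube d c r"
      then obtain x where x: "x \<in> cube d c r" "g = grid_cell d M x" by auto
      have "\<lfloor>real M * x i\<rfloor> \<in> ?J i" if "i < d" for i
      proof -
        have "c i - r \<le> x i" "x i \<le> c i + r" using x that by (auto simp: cube_def abs_le_iff)
        then show ?thesis by (auto intro!: floor_mono mult_left_mono)
      qed
      then show "g \<in> Pi\<^sub>E {..<d} ?J" by (auto simp: x grid_cell_def)
    qed
    have J: "real (card (?J i)) \<le> C * real M" for i
    proof -
      have "real_of_int (\<lfloor>real M * (c i + r)\<rfloor> - \<lfloor>real M * (c i - r)\<rfloor> + 1) \<le>
          real M * (c i + r) - real M * (c i - r) + 2" by linarith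
      also have "\<dots> = 2 * r * real M + 2" by (simp add: algebra_simps)
      also have "\<dots> \<le> 2 * \<bar>r\<bar> * real M + 2 * real M"
        using M by (intro add_mono mult_right_mono mult_left_mono) auto
      finally have "real_of_int (\<lfloor>real M * (c i + r)\<rfloor> - \<lfloor>real M * (c i - r)\<rfloor> + 1) \<le> C * real M"
        by (simp add: C_def algebra_simps)
      moreover have "0 \<le> C * real M" by (simp add: C_def)
      ultimately show ?thesis by (simp add: of_nat_nat max_def nat_add_distrib split: if_splits)
    qed
    have fin: "finite (Pi\<^sub>E {..<d} ?J)" by (intro finite_PiE) auto
    have "card (grid_cell d M ` cube d c r) \<le> card (Pi\<^sub>E {..<d} ?J)" by (rule card_mono[OF fin sub])
    then have "real (card (grid_cell d M ` cube d c r)) \<le> (\<Prod>i<d. real (card (?J i)))"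
      by (simp add: card_PiE flip: of_nat_prod del: card_atLeastAtMost_int)
    also have "\<dots> \<le> (\<Prod>i<d. C * real M)" using J by (intro prod_mono) auto
    also have "\<dots> = C ^ d * real M ^ d" by (simp add: power_mult_distrib)
    finally show ?thesis using finite_subset[OF sub fin] by simp
  qed
  moreover have "C ^ d \<ge> 0" by (simp add: C_def)
  ultimately show ?thesis unfolding cell_dim_def by blast
qed

lemma cell_Lipschitz_coordinate:
  assumes "i < d" shows "cell_Lipschitz (cube d c r) (grid_cell d) (\<lambda>x. x i)"
proof (rule cell_LipschitzI)
  show "\<bar>x i\<bar> \<le> \<bar>c i\<bar> + \<bar>r\<bar>" if "x \<in> cube d c r" for x
    using that assms by (force simp: cube_def)
  show "\<bar>x i - y i\<bar> \<le> 1 / real M" if "M \<ge> 1" "grid_cell d M x = grid_cell d M y" for M x y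
    using grid_cell_close[OF that(2) assms that(1)] .
qed auto

text \<open>Compactness of the cube bounds \<open>f\<close> and its partial derivatives. Points in
  one grid cell differ by at most 1 / M in each of the \<open>d\<close> coordinates.\<close>

lemma cell_Lipschitz_Ck_on_1:
  assumes D: "openin (Euclidean_space d) D" and f: "Ck_on 1 d D f" and c: "cube d c r \<subseteq> D"
  shows "cell_Lipschitz (cube d c r) (grid_cell d) f"
proof -
  obtain B where B: "B \<ge> 0" "\<And>x. x \<in> cube d c r \<Longrightarrow> \<bar>f x\<bar> \<le> B"
    using Ck_on_0_cube_bound[OF D _ c] Ck_on_SucD[OF D, of 0 f] f by (metis One_nat_def)
  obtain L where L: "L \<ge> 0"
    "\<And>x y. x \<in> cube d c r \<Longrightarrow> y \<in> cube d c r \<Longrightarrow> \<bar>f x - f y\<bar> \<le> L * (\<Sum>i<d. \<bar>x i - y i\<bar>)"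
    using Ck_on_1_Lipschitz[OF D f c] by blast
  show ?thesis
  proof (rule cell_LipschitzI)
    show "\<bar>f x - f y\<bar> \<le> L * d / real M"
      if "M \<ge> 1" "x \<in> cube d c r" "y \<in> cube d c r" "grid_cell d M x = grid_cell d M y" for M x y
    proof -
      have "(\<Sum>i<d. \<bar>x i - y i\<bar>) \<le> (\<Sum>i<d. 1 / real M)"
        using grid_cell_close[OF that(4) _ that(1)] by (intro sum_mono) auto
      then have "L * (\<Sum>i<d. \<bar>x i - y i\<bar>) \<le> L * (\<Sum>i<d. 1 / real M)"
        using L(1) by (rule mult_left_mono)
      then show ?thesis using L(2)[OF that(2,3)] by simp
    qed
  qed (use B L in auto)
qed

text \<open>Points of this product measure space are \<open>undefined\<close> outside
  \<open>{..<D}\<close>; hence the restricted lambdas in all statements about null sets.\<close>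

abbreviation leb :: "nat \<Rightarrow> (nat \<Rightarrow> real) measure" where
  "leb D \<equiv> Pi\<^sub>M {..<D} (\<lambda>_. lborel)"

lemma emeasure_leb_box:
  assumes "\<And>i. i < D \<Longrightarrow> l i \<le> u i"
  shows "emeasure (leb D) (Pi\<^sub>E {..<D} (\<lambda>i. {l i..u i})) = ennreal (\<Prod>i<D. u i - l i)"
proof -
  interpret product_sigma_finite "\<lambda>_ :: nat. lborel :: real measure" by standard
  have "emeasure (leb D) (Pi\<^sub>E {..<D} (\<lambda>i. {l i..u i})) = (\<Prod>i<D. emeasure lborel {l i..u i})"
    by (rule emeasure_PiM) auto
  also have "\<dots> = (\<Prod>i<D. ennreal (u i - l i))"
    using assms by (intro prod.cong) auto
  also have "\<dots> = ennreal (\<Prod>i<D. u i - l i)" using assms by (intro prod_ennreal) auto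
  finally show ?thesis .
qed

text \<open>One box of side 2 L / M per cell covers the image. There are at most C M^m cells, so the
  total volume is at most C M^m (2 L / M)^D, which is O(1 / M) because m < D.\<close>

lemma cell_Lipschitz_image_null:
  assumes dim: "cell_dim Z c m" "m < D" and h: "\<And>k. k < D \<Longrightarrow> cell_Lipschitz Z c (h k)"
  obtains N where "N \<in> null_sets (leb D)" "\<And>z. z \<in> Z \<Longrightarrow> (\<lambda>k\<in>{..<D}. h k z) \<in> N"
proof -
  obtain C where C: "C \<ge> 0" "\<And>M. M \<ge> 1 \<Longrightarrow> finite (c M ` Z)" "\<And>M. M \<ge> 1 \<Longrightarrow> real (card (c M ` Z)) \<le> C * real M ^ m"
    using dim(1) unfolding cell_dim_def by blast
  have "\<exists>L\<ge>0. \<forall>M\<ge>1. \<forall>z\<in>Z. \<forall>w\<in>Z. c M z = c M w \<longrightarrow> \<bar>h k z - h k w\<bar> \<le> L / real M" if "k < D" for k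
    using h[OF that] unfolding cell_Lipschitz_def by blast
  then obtain L' where L': "\<And>k. k < D \<Longrightarrow> L' k \<ge> 0"
    "\<And>k M z w. k < D \<Longrightarrow> M \<ge> 1 \<Longrightarrow> z \<in> Z \<Longrightarrow> w \<in> Z \<Longrightarrow> c M z = c M w \<Longrightarrow> \<bar>h k z - h k w\<bar> \<le> L' k / real M"
    by metis
  \<comment> \<open>One constant for all coordinates, so that all covering boxes are cubes of the
    same volume.\<close>
  define L where "L = (\<Sum>k<D. L' k)"
  have L0: "L \<ge> 0" unfolding L_def using L'(1) by (intro sum_nonneg) auto
  have L: "\<bar>h k z - h k w\<bar> \<le> L / real M"
    if "k < D" "M \<ge> 1" "z \<in> Z" "w \<in> Z" "c M z = c M w" for k M z w
  proof -
    have "L' k \<le> L" unfolding L_def using that(1) L'(1) by (intro member_le_sum) auto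
    then have "L' k / real M \<le> L / real M" by (intro divide_right_mono) auto
    then show ?thesis using L'(2)[OF that] by linarith
  qed
  \<comment> \<open>A chosen point of each cell; its image is the centre of the box that covers the
    image of the cell.\<close>
  define rep where "rep M s = (SOME z. z \<in> Z \<and> c M z = s)" for M s
  have rep: "rep M (c M z) \<in> Z" "c M (rep M (c M z)) = c M z" if "z \<in> Z" for M z
    using someI[of "\<lambda>w. w \<in> Z \<and> c M w = c M z" z] that unfolding rep_def by auto
  define box where "box M s = Pi\<^sub>E {..<D} (\<lambda>k. {h k (rep M s) - L / real M..h k (rep M s) + L / real M})" for M s
  \<comment> \<open>Intersecting the covers over all M gives a measurable set, whereas measurability
    of the image itself is not known.\<close>
  define N where "N = (\<Inter>M\<in>{1..}. \<Union>s\<in>c M ` Z. box M s)"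
  have box_meas: "box M s \<in> sets (leb D)" for M s
    unfolding box_def by (intro sets_PiM_I_finite) auto
  have U_meas: "(\<Union>s\<in>c M ` Z. box M s) \<in> sets (leb D)" if "M \<ge> 1" for M
    using C(2)[OF that] box_meas by (intro sets.finite_UN) auto
  have N_meas: "N \<in> sets (leb D)"
    unfolding N_def using U_meas by (intro sets.countable_INT) auto
  have bound: "emeasure (leb D) N \<le> ennreal (C * (2 * L) ^ D * (1 / real M))" if M: "M \<ge> 1" for M
  proof -
    have box_e: "emeasure (leb D) (box M s) = ennreal ((2 * L / real M) ^ D)" for s
      unfolding box_def using L0 by (subst emeasure_leb_box) auto
    have "emeasure (leb D) N \<le> emeasure (leb D) (\<Union>s\<in>c M ` Z. box M s)"
      using M U_meas by (intro emeasure_mono) (auto simp: N_def)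
    also have "\<dots> \<le> (\<Sum>s\<in>c M ` Z. emeasure (leb D) (box M s))"
      using C(2)[OF M] box_meas by (intro emeasure_subadditive_finite) auto
    also have "\<dots> = ennreal (real (card (c M ` Z)) * (2 * L / real M) ^ D)"
      using L0 by (simp add: box_e ennreal_mult' flip: ennreal_of_nat_eq_real_of_nat)
    also have "\<dots> \<le> ennreal (C * (2 * L) ^ D * (1 / real M))"
    proof (rule ennreal_leI)
      \<comment> \<open>\<open>m < D\<close> leaves one spare power of M, and this is the factor
        that tends to 0.\<close>
      have Mm: "real M ^ m * real M \<le> real M ^ D"
        using M dim(2) power_increasing[of "Suc m" D "real M"] by (simp add: mult.commute)
      have "real (card (c M ` Z)) * (2 * L / real M) ^ D \<le> C * real M ^ m * (2 * L / real M) ^ D"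
        using C(3)[OF M] L0 by (intro mult_right_mono) auto
      also have "\<dots> = C * (2 * L) ^ D * (real M ^ m / real M ^ D)" by (simp add: power_divide)
      also have "\<dots> \<le> C * (2 * L) ^ D * (1 / real M)"
        using Mm M C(1) L0 by (intro mult_left_mono) (auto simp: field_simps)
      finally show "real (card (c M ` Z)) * (2 * L / real M) ^ D \<le> C * (2 * L) ^ D * (1 / real M)" .
    qed
    finally show ?thesis .
  qed
  have "eventually (\<lambda>M. emeasure (leb D) N \<le> ennreal (C * (2 * L) ^ D * (1 / real M))) sequentially"
    by (rule eventually_mono[OF eventually_ge_at_top[of 1] bound])
  moreover have "(\<lambda>M. ennreal (C * (2 * L) ^ D * (1 / real M))) \<longlonglongrightarrow> ennreal (C * (2 * L) ^ D * 0)"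
    by (intro tendsto_ennrealI tendsto_mult tendsto_const lim_1_over_n)
  ultimately have "emeasure (leb D) N \<le> ennreal (C * (2 * L) ^ D * 0)"
    by (intro tendsto_lowerbound) auto
  then have "N \<in> null_sets (leb D)" using N_meas by (auto simp: null_sets_def)
  moreover have "(\<lambda>k\<in>{..<D}. h k z) \<in> N" if z: "z \<in> Z" for z
  proof -
    have "(\<lambda>k\<in>{..<D}. h k z) \<in> box M (c M z)" if "M \<ge> 1" for M
      using L[OF _ that z rep(1)[OF z, of M]] rep(2)[OF z, of M]
      unfolding box_def by (force simp: abs_le_iff)
    then show ?thesis using z unfolding N_def by blast
  qed
  ultimately show ?thesis using that by blast
qed

text \<open>A box of side 2 e has positive volume, so countably many null sets cannot cover
  it.\<close>

lemma box_avoids_null_sets: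
  assumes "countable \<N>" "\<And>N. N \<in> \<N> \<Longrightarrow> N \<in> null_sets (leb D)" "e > 0"
  obtains a where "\<And>k. \<bar>a k\<bar> \<le> e" "\<And>N. N \<in> \<N> \<Longrightarrow> (\<lambda>k\<in>{..<D}. a k) \<notin> N"
proof -
  let ?B = "Pi\<^sub>E {..<D} (\<lambda>k. {-e..e})"
  have "\<Union>\<N> \<in> null_sets (leb D)"
    using null_sets_UN'[OF assms(1), of "\<lambda>x. x"] assms(2) by simp
  moreover have "emeasure (leb D) ?B = ennreal ((2 * e) ^ D)"
    using assms(3) by (subst emeasure_leb_box) auto
  moreover have "ennreal ((2 * e) ^ D) \<noteq> 0" using zero_less_power[of "2 * e" D] assms(3)
    by (simp add: ennreal_eq_0_iff not_le)
  moreover have "?B \<in> sets (leb D)" by (intro sets_PiM_I_finite) auto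
  ultimately have "\<not> ?B \<subseteq> \<Union>\<N>"
    by (metis null_setsD1 null_sets_subset)
  then obtain a where a: "a \<in> ?B" "a \<notin> \<Union>\<N>" by blast
  \<comment> \<open>Elements of the box are \<open>undefined\<close> beyond \<open>D\<close>.
    Replacing these values by 0 makes the bound hold for every index and leaves the restriction
    unchanged.\<close>
  have "(\<lambda>k\<in>{..<D}. if k < D then a k else 0) = a" using a(1) by (auto simp: PiE_iff extensional_def)
  moreover have "\<bar>if k < D then a k else 0\<bar> \<le> e" for k
    using a(1) assms(3) by (force simp: abs_le_iff PiE_iff)
  ultimately show ?thesis using that[of "\<lambda>k. if k < D then a k else 0"] a(2) by auto
qed

section \<open>Smooth functions on s-manifolds\<close>

lemma embedding_map_from_subtopology:
  assumes "embedding_map X Y f"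
  shows "embedding_map (subtopology X S) Y f"
proof -
  have "homeomorphic_map (subtopology X S)
      (subtopology (subtopology Y (f ` topspace X)) (f ` (topspace X \<inter> S))) f"
    using assms homeomorphic_imp_surjective_map[of X "subtopology Y (f ` topspace X)" f]
    unfolding embedding_map_def by (intro homeomorphic_map_subtopologies) auto
  moreover have "f ` topspace X \<inter> f ` (topspace X \<inter> S) = f ` (topspace X \<inter> S)" by auto
  ultimately show ?thesis by (simp add: embedding_map_def subtopology_subtopology)
qed

text \<open>A locally compact Hausdorff target is compactly generated, so compact preimages of
  compact sets make the continuous map closed, and an injective closed continuous map is an
  embedding.\<close>

lemma preimage_proper_imp_embedding_map:
  assumes cont: "continuous_map X (Euclidean_space N) f" and inj: "inj_on f (topspace X)"
    and proper: "preimage_proper X N f"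
  shows "embedding_map X (Euclidean_space N) f"
proof -
  have "proper_map X (Euclidean_space N) f"
  proof (rule compact_imp_proper_map)
    show "k_space (Euclidean_space N)"
      by (rule locally_compact_imp_k_space[OF locally_compact_Euclidean_space])
    show "kc_space (Euclidean_space N)"
      by (intro Hausdorff_imp_kc_space metrizable_imp_Hausdorff_space metrizable_Euclidean_space)
    show "f \<in> topspace X \<rightarrow> topspace (Euclidean_space N)"
      using cont by (rule continuous_map_funspace)
    show "continuous_map X (Euclidean_space N) f \<or> kc_space X" using cont by simp
    show "compactin X {x \<in> topspace X. f x \<in> K}" if "compactin (Euclidean_space N) K" for K
      using proper that unfolding preimage_proper_def by blast
  qed
  then have "closed_map X (Euclidean_space N) f" by (rule proper_imp_closed_map)
  then show ?thesis using cont inj by (intro injective_closed_imp_embedding_map)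
qed

locale smooth_stratification =
  fixes n :: nat
    and X :: "'a topology"
    and I :: "'i set"
    and S :: "'i \<Rightarrow> 'a set"
    and dm :: "'i \<Rightarrow> nat"
    and A :: "'i \<Rightarrow> 'a chart set"
  assumes s_manifold: "s_manifold n X I S dm A"
begin

lemma locally_compact: "locally_compact_space X"
  and Hausdorff: "Hausdorff_space X"
  and second_countable: "second_countable X"
  and countable_strata: "countable I"
  and topspace_eq: "topspace X = (\<Union>i\<in>I. S i)"
  and dm_le: "i \<in> I \<Longrightarrow> dm i \<le> n"
  and smooth_manifold: "i \<in> I \<Longrightarrow> smooth_manifold (subtopology X (S i)) (dm i) (A i)"
  using s_manifold unfolding s_manifold_def by auto

lemma local_embedding:
  assumes "x \<in> topspace X"
  obtains U N f where "openin X U" "x \<in> U" "embedding_map (subtopology X U) (Euclidean_space N) f"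
    "\<And>i. i \<in> I \<Longrightarrow> manifold_embedding (subtopology X (U \<inter> S i)) (dm i) (restrict_atlas U (A i)) N f"
proof -
  have "\<exists>U N f. openin X U \<and> x \<in> U \<and> embedding_map (subtopology X U) (Euclidean_space N) f \<and>
     (\<forall>i\<in>I. manifold_embedding (subtopology X (U \<inter> S i)) (dm i) (restrict_atlas U (A i)) N f)"
    using s_manifold assms unfolding s_manifold_def by blast
  then show ?thesis using that by blast
qed

lemma strata_subset: "i \<in> I \<Longrightarrow> S i \<subseteq> topspace X"
  by (auto simp: topspace_eq)

section \<open>Charts of the strata as homeomorphisms onto open sets\<close>

lemma chart_exists:
  assumes "i \<in> I" "z \<in> S i"
  obtains W \<phi> where "(W, \<phi>) \<in> A i" "z \<in> W"
proof -
  have "z \<in> topspace (subtopology X (S i))" using assms strata_subset by auto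
  also have "topspace (subtopology X (S i)) = (\<Union>c\<in>A i. fst c)"
    using smooth_manifold[OF assms(1)] unfolding smooth_manifold_def by blast
  finally show ?thesis using that by auto
qed

lemma chart_open:
  assumes "i \<in> I" "(W, \<phi>) \<in> A i"
  shows "openin (subtopology X (S i)) W"
    and "embedding_map (subtopology (subtopology X (S i)) W) (Euclidean_space (dm i)) \<phi>"
    and "openin (Euclidean_space (dm i)) (\<phi> ` W)"
proof -
  have "is_chart (subtopology X (S i)) (dm i) (W, \<phi>)"
    using smooth_manifold[OF assms(1)] assms(2) unfolding smooth_manifold_def by blast
  then show "openin (subtopology X (S i)) W"
    "embedding_map (subtopology (subtopology X (S i)) W) (Euclidean_space (dm i)) \<phi>"
    "openin (Euclidean_space (dm i)) (\<phi> ` W)"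
    unfolding is_chart_def by auto
qed

lemma chart_subset:
  assumes "i \<in> I" "(W, \<phi>) \<in> A i"
  shows "W \<subseteq> S i" "W \<subseteq> topspace X"
  using openin_subset[OF chart_open(1)[OF assms]] by auto

lemma chart_topspace:
  assumes "i \<in> I" "(W, \<phi>) \<in> A i"
  shows "topspace (subtopology (subtopology X (S i)) W) = W"
  using chart_subset[OF assms] by auto

lemma chart_homeomorphic:
  assumes "i \<in> I" "(W, \<phi>) \<in> A i"
  shows "homeomorphic_map (subtopology X W) (subtopology (Euclidean_space (dm i)) (\<phi> ` W)) \<phi>"
proof -
  have "subtopology (subtopology X (S i)) W = subtopology X W"
    using chart_subset[OF assms] by (simp add: subtopology_subtopology Int_absorb1)
  then show ?thesis
    using chart_open(2)[OF assms] chart_topspace[OF assms] by (simp add: embedding_map_def)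
qed

lemma chart_inj:
  assumes "i \<in> I" "(W, \<phi>) \<in> A i"
  shows "inj_on \<phi> W"
  using homeomorphic_imp_injective_map[OF chart_homeomorphic[OF assms]] chart_subset[OF assms]
  by (simp add: Int_absorb1)

lemma chart_image_open:
  assumes "i \<in> I" "(W, \<phi>) \<in> A i" "openin X U"
  shows "openin (Euclidean_space (dm i)) (\<phi> ` (W \<inter> U))"
proof -
  have "openin (subtopology X W) (W \<inter> U)" using assms(3) by (auto simp: openin_subtopology)
  then have "openin (subtopology (Euclidean_space (dm i)) (\<phi> ` W)) (\<phi> ` (W \<inter> U))"
    using homeomorphic_imp_open_map[OF chart_homeomorphic[OF assms(1,2)]] by (simp add: open_map_def)
  then show ?thesis using chart_open(3)[OF assms(1,2)] openin_trans_full by blast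
qed

lemma chart_intersection_open:
  assumes "i \<in> I" "(W, \<phi>) \<in> A i" "(W', \<psi>) \<in> A i"
  shows "openin (Euclidean_space (dm i)) (\<phi> ` (W \<inter> W'))"
proof -
  obtain U where U: "openin X U" "W' = U \<inter> S i"
    using chart_open(1)[OF assms(1,3)] by (auto simp: openin_subtopology)
  have "W \<inter> W' = W \<inter> U" using U chart_subset[OF assms(1,2)] by auto
  then show ?thesis using chart_image_open[OF assms(1,2) U(1)] by simp
qed

lemma chart_Espace:
  assumes "i \<in> I" "(W, \<phi>) \<in> A i" "z \<in> W"
  shows "\<phi> z \<in> Espace (dm i)"
  using openin_subset[OF chart_open(3)[OF assms(1,2)]] assms(3) by auto

text \<open>Charts are not shrunk to \<open>U\<close>; only their images are. Thus the same
  \<open>inv_into W \<phi>\<close> serves every \<open>U\<close>, and passing to smaller sets is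
  mere restriction.\<close>

definition smooth_function_on :: "'a set \<Rightarrow> ('a \<Rightarrow> real) \<Rightarrow> bool" where
  "smooth_function_on U g \<longleftrightarrow> continuous_map (subtopology X U) euclideanreal g \<and>
     (\<forall>i\<in>I. \<forall>(W, \<phi>)\<in>A i. smooth_on (dm i) (\<phi> ` (W \<inter> U)) (\<lambda>y. g (inv_into W \<phi> y)))"

abbreviation smooth_function :: "('a \<Rightarrow> real) \<Rightarrow> bool" where
  "smooth_function \<equiv> smooth_function_on (topspace X)"

lemma smooth_function_onI:
  assumes "continuous_map (subtopology X U) euclideanreal g"
    "\<And>i W \<phi> k. i \<in> I \<Longrightarrow> (W, \<phi>) \<in> A i \<Longrightarrow> Ck_on k (dm i) (\<phi> ` (W \<inter> U)) (\<lambda>y. g (inv_into W \<phi> y))"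
  shows "smooth_function_on U g"
  using assms unfolding smooth_function_on_def smooth_on_def by auto

lemma smooth_function_onD:
  assumes "smooth_function_on U g"
  shows "continuous_map (subtopology X U) euclideanreal g"
    "\<And>i W \<phi> k. i \<in> I \<Longrightarrow> (W, \<phi>) \<in> A i \<Longrightarrow> Ck_on k (dm i) (\<phi> ` (W \<inter> U)) (\<lambda>y. g (inv_into W \<phi> y))"
proof -
  show "continuous_map (subtopology X U) euclideanreal g"
    using assms unfolding smooth_function_on_def by blast
  show "Ck_on k (dm i) (\<phi> ` (W \<inter> U)) (\<lambda>y. g (inv_into W \<phi> y))" if "i \<in> I" "(W, \<phi>) \<in> A i" for i W \<phi> k
    using bspec[OF bspec[OF conjunct2[OF assms[unfolded smooth_function_on_def]] that(1)] that(2)]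
    by (simp add: smooth_on_def)
qed

lemma smooth_functionD:
  assumes "smooth_function g"
  shows "continuous_map X euclideanreal g"
    "\<And>i W \<phi> k. i \<in> I \<Longrightarrow> (W, \<phi>) \<in> A i \<Longrightarrow> Ck_on k (dm i) (\<phi> ` W) (\<lambda>y. g (inv_into W \<phi> y))"
proof -
  show "continuous_map X euclideanreal g" using smooth_function_onD(1)[OF assms] by simp
  show "Ck_on k (dm i) (\<phi> ` W) (\<lambda>y. g (inv_into W \<phi> y))" if "i \<in> I" "(W, \<phi>) \<in> A i" for i W \<phi> k
    using smooth_function_onD(2)[OF assms that] chart_subset(2)[OF that] by (simp add: Int_absorb2)
qed

section \<open>Closure properties of stratumwise smooth functions\<close>

lemma smooth_function_on_const: "openin X U \<Longrightarrow> smooth_function_on U (\<lambda>_. c)"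
  by (auto intro!: smooth_function_onI Ck_on_const chart_image_open)

lemma smooth_function_on_add:
  assumes "openin X U" "smooth_function_on U f" "smooth_function_on U g"
  shows "smooth_function_on U (\<lambda>z. f z + g z)"
proof (rule smooth_function_onI)
  show "continuous_map (subtopology X U) euclideanreal (\<lambda>z. f z + g z)"
    by (intro continuous_map_add smooth_function_onD(1) assms)
  show "Ck_on k (dm i) (\<phi> ` (W \<inter> U)) (\<lambda>y. f (inv_into W \<phi> y) + g (inv_into W \<phi> y))"
    if c: "i \<in> I" "(W, \<phi>) \<in> A i" for i W \<phi> k
    by (rule Ck_on_add[OF chart_image_open[OF c assms(1)]
          smooth_function_onD(2)[OF assms(2) c] smooth_function_onD(2)[OF assms(3) c]])
qed

lemma smooth_function_on_mult:
  assumes "openin X U" "smooth_function_on U f" "smooth_function_on U g"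
  shows "smooth_function_on U (\<lambda>z. f z * g z)"
proof (rule smooth_function_onI)
  show "continuous_map (subtopology X U) euclideanreal (\<lambda>z. f z * g z)"
    by (intro continuous_map_real_mult smooth_function_onD(1) assms)
  show "Ck_on k (dm i) (\<phi> ` (W \<inter> U)) (\<lambda>y. f (inv_into W \<phi> y) * g (inv_into W \<phi> y))"
    if c: "i \<in> I" "(W, \<phi>) \<in> A i" for i W \<phi> k
    by (rule Ck_on_mult[OF chart_image_open[OF c assms(1)]
          smooth_function_onD(2)[OF assms(2) c] smooth_function_onD(2)[OF assms(3) c]])
qed

lemma smooth_function_on_sum:
  assumes "openin X U" "\<And>j. j \<in> J \<Longrightarrow> smooth_function_on U (f j)"
  shows "smooth_function_on U (\<lambda>z. \<Sum>j\<in>J. f j z)"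
  using assms(2)
proof (induction J rule: infinite_finite_induct)
  case (insert j J)
  then have "smooth_function_on U (\<lambda>z. f j z + (\<Sum>j\<in>J. f j z))"
    by (intro smooth_function_on_add assms(1)) auto
  then show ?case using insert.hyps by simp
qed (simp_all add: smooth_function_on_const assms(1))

lemma smooth_function_on_prod:
  assumes "openin X U" "\<And>j. j \<in> J \<Longrightarrow> smooth_function_on U (f j)"
  shows "smooth_function_on U (\<lambda>z. \<Prod>j\<in>J. f j z)"
  using assms(2)
proof (induction J rule: infinite_finite_induct)
  case (insert j J)
  then have "smooth_function_on U (\<lambda>z. f j z * (\<Prod>j\<in>J. f j z))"
    by (intro smooth_function_on_mult assms(1)) auto
  then show ?case using insert.hyps by simp
qed (simp_all add: smooth_function_on_const assms(1))

lemma smooth_function_on_diff: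
  assumes "openin X U" "smooth_function_on U f" "smooth_function_on U g"
  shows "smooth_function_on U (\<lambda>z. f z - g z)"
  using smooth_function_on_add[OF assms(1,2)
      smooth_function_on_mult[OF assms(1) smooth_function_on_const[OF assms(1), of "-1"] assms(3)]]
  by simp

lemma smooth_function_on_flat:
  assumes "openin X U" "smooth_function_on U f"
  shows "smooth_function_on U (\<lambda>z. flat (f z))"
proof (rule smooth_function_onI)
  have "continuous_map euclideanreal euclideanreal flat"
    using continuous_on_flat[of UNIV] by simp
  from continuous_map_compose[OF smooth_function_onD(1)[OF assms(2)] this]
  show "continuous_map (subtopology X U) euclideanreal (\<lambda>z. flat (f z))"
    by (simp add: o_def)
  show "Ck_on k (dm i) (\<phi> ` (W \<inter> U)) (\<lambda>y. flat (f (inv_into W \<phi> y)))"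
    if "i \<in> I" "(W, \<phi>) \<in> A i" for i W \<phi> k
    unfolding flat_def
    by (rule Ck_on_compose[where h = flat_deriv, OF chart_image_open[OF that assms(1)]
          smooth_function_onD(2)[OF assms(2) that] flat_deriv_has_derivative])
qed

lemma smooth_function_on_subset:
  assumes "smooth_function_on U g" "V \<subseteq> U"
  shows "smooth_function_on V g"
proof (rule smooth_function_onI)
  show "continuous_map (subtopology X V) euclideanreal g"
    using smooth_function_onD(1)[OF assms(1)] assms(2) continuous_map_from_subtopology_mono by blast
  show "Ck_on k (dm i) (\<phi> ` (W \<inter> V)) (\<lambda>y. g (inv_into W \<phi> y))" if "i \<in> I" "(W, \<phi>) \<in> A i" for i W \<phi> k
    by (rule Ck_on_subset[OF smooth_function_onD(2)[OF assms(1) that]]) (use assms(2) in auto)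
qed

lemma smooth_function_on_cong:
  assumes "openin X U" "\<And>z. z \<in> U \<Longrightarrow> f z = g z" "smooth_function_on U f"
  shows "smooth_function_on U g"
proof (rule smooth_function_onI)
  show "continuous_map (subtopology X U) euclideanreal g"
    using smooth_function_onD(1)[OF assms(3)] by (rule continuous_map_eq) (use assms(2) in auto)
  show "Ck_on k (dm i) (\<phi> ` (W \<inter> U)) (\<lambda>y. g (inv_into W \<phi> y))"
    if c: "i \<in> I" "(W, \<phi>) \<in> A i" for i W \<phi> k
  proof (rule Ck_on_cong[OF chart_image_open[OF c assms(1)] _ smooth_function_onD(2)[OF assms(3) c]])
    fix y assume "y \<in> \<phi> ` (W \<inter> U)"
    then show "f (inv_into W \<phi> y) = g (inv_into W \<phi> y)"
      using chart_inj[OF c] assms(2) by auto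
  qed
qed

lemma smooth_function_on_local:
  assumes "openin X U" "\<And>z. z \<in> U \<Longrightarrow> \<exists>V. openin X V \<and> z \<in> V \<and> smooth_function_on V g"
  shows "smooth_function_on U g"
proof (rule smooth_function_onI)
  obtain V where V: "\<And>z. z \<in> U \<Longrightarrow> openin X (V z)" "\<And>z. z \<in> U \<Longrightarrow> z \<in> V z"
    "\<And>z. z \<in> U \<Longrightarrow> smooth_function_on (V z) g"
    using assms(2) by metis
  show "continuous_map (subtopology X U) euclideanreal g"
  proof (rule pasting_lemma[of U "subtopology X U" "\<lambda>z. V z \<inter> U" euclideanreal "\<lambda>_. g"])
    fix z assume z: "z \<in> U"
    show "openin (subtopology X U) (V z \<inter> U)" using V(1)[OF z] by (auto simp: openin_subtopology)
    have "continuous_map (subtopology X (V z \<inter> U)) euclideanreal g"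
      using smooth_function_onD(1)[OF V(3)[OF z]] continuous_map_from_subtopology_mono by blast
    then show "continuous_map (subtopology (subtopology X U) (V z \<inter> U)) euclideanreal g"
      by (simp add: subtopology_subtopology Int_absorb1)
  qed (use V in auto)
  show "Ck_on k (dm i) (\<phi> ` (W \<inter> U)) (\<lambda>y. g (inv_into W \<phi> y))"
    if c: "i \<in> I" "(W, \<phi>) \<in> A i" for i W \<phi> k
  proof (rule Ck_on_local)
    show "\<phi> ` (W \<inter> U) \<subseteq> Espace (dm i)" using chart_Espace[OF c] by auto
    fix y assume "y \<in> \<phi> ` (W \<inter> U)"
    then obtain z where z: "z \<in> W" "z \<in> U" "y = \<phi> z" by auto
    show "\<exists>D'. openin (Euclidean_space (dm i)) D' \<and> y \<in> D' \<and> Ck_on k (dm i) D' (\<lambda>y. g (inv_into W \<phi> y))"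
      using z V[OF z(2)] chart_image_open[OF c] smooth_function_onD(2)[OF V(3)[OF z(2)] c]
      by (intro exI[of _ "\<phi> ` (W \<inter> V z)"]) auto
  qed
qed

text \<open>\<open>U\<close> and the complement of \<open>K\<close> are open and cover
  \<open>X\<close>; on the first the extension is \<open>g\<close>, on the second it is 0, and
  smoothness is local.\<close>

lemma smooth_function_extend_zero:
  assumes "openin X U" "closedin X K" "K \<subseteq> U" "smooth_function_on U g"
    "\<And>z. z \<in> U - K \<Longrightarrow> g z = 0"
  shows "smooth_function (\<lambda>z. if z \<in> U then g z else 0)"
proof (rule smooth_function_on_local)
  fix z assume z: "z \<in> topspace X"
  show "\<exists>V. openin X V \<and> z \<in> V \<and> smooth_function_on V (\<lambda>z. if z \<in> U then g z else 0)"
  proof (cases "z \<in> U")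
    case True
    have "smooth_function_on U (\<lambda>z. if z \<in> U then g z else 0)"
      by (rule smooth_function_on_cong[OF assms(1) _ assms(4)]) simp
    then show ?thesis using True assms(1) by blast
  next
    case False
    have o: "openin X (topspace X - K)" using assms(2) by (simp add: closedin_def)
    have "smooth_function_on (topspace X - K) (\<lambda>z. if z \<in> U then g z else 0)"
      by (rule smooth_function_on_cong[OF o _ smooth_function_on_const[OF o, of 0]]) (use assms(5) in auto)
    then show ?thesis using False z o assms(3) by blast
  qed
qed simp

section \<open>Differentials of functions in charts\<close>

definition dir_deriv :: "'i \<Rightarrow> 'a set \<Rightarrow> ('a \<Rightarrow> nat \<Rightarrow> real) \<Rightarrow> ('a \<Rightarrow> real) \<Rightarrow> 'a \<Rightarrow> (nat \<Rightarrow> real) \<Rightarrow> real" where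
  "dir_deriv i W \<phi> g z v = (\<Sum>j<dm i. v j * partial_deriv j (\<lambda>y. g (inv_into W \<phi> y)) (\<phi> z))"

text \<open>Only the germ at \<open>z\<close> enters. This transfers derivatives between the limit
  map and the finite stages that coincide with it on an open set.\<close>

lemma dir_deriv_cong:
  assumes c: "i \<in> I" "(W, \<phi>) \<in> A i" and "openin X U" "z \<in> W" "z \<in> U" "\<And>w. w \<in> U \<Longrightarrow> f w = g w"
  shows "dir_deriv i W \<phi> f z v = dir_deriv i W \<phi> g z v"
  unfolding dir_deriv_def
proof (rule sum.cong)
  fix j assume j: "j \<in> {..<dm i}"
  have "partial_deriv j (\<lambda>y. f (inv_into W \<phi> y)) (\<phi> z) = partial_deriv j (\<lambda>y. g (inv_into W \<phi> y)) (\<phi> z)"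
    by (rule partial_deriv_cong(1)[OF chart_image_open[OF c assms(3)]])
      (use assms j chart_inj[OF c] in auto)
  then show "v j * partial_deriv j (\<lambda>y. f (inv_into W \<phi> y)) (\<phi> z) =
      v j * partial_deriv j (\<lambda>y. g (inv_into W \<phi> y)) (\<phi> z)" by simp
qed simp

lemma dir_deriv_add_scaled:
  assumes c: "i \<in> I" "(W, \<phi>) \<in> A i" and "smooth_function f" "smooth_function g" "z \<in> W"
  shows "dir_deriv i W \<phi> (\<lambda>w. f w + a * g w) z v = dir_deriv i W \<phi> f z v + a * dir_deriv i W \<phi> g z v"
proof -
  have "partial_deriv j (\<lambda>y. f (inv_into W \<phi> y) + a * g (inv_into W \<phi> y)) (\<phi> z) =
      partial_deriv j (\<lambda>y. f (inv_into W \<phi> y)) (\<phi> z) + a * partial_deriv j (\<lambda>y. g (inv_into W \<phi> y)) (\<phi> z)"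
    if "j < dm i" for j
    using smooth_functionD(2)[OF assms(3) c] smooth_functionD(2)[OF assms(4) c] that assms(5)
    by (intro partial_deriv_add_scaled[OF chart_open(3)[OF c]]) auto
  then show ?thesis
    by (simp add: dir_deriv_def algebra_simps sum.distrib sum_distrib_left)
qed

lemma dir_deriv_mult:
  assumes c: "i \<in> I" "(W, \<phi>) \<in> A i" and "openin X U" "smooth_function_on U f" "smooth_function_on U g"
    and z: "z \<in> W" "z \<in> U"
  shows "dir_deriv i W \<phi> (\<lambda>w. f w * g w) z v = dir_deriv i W \<phi> f z v * g z + f z * dir_deriv i W \<phi> g z v"
proof -
  have "partial_deriv j (\<lambda>y. f (inv_into W \<phi> y) * g (inv_into W \<phi> y)) (\<phi> z) =
      partial_deriv j (\<lambda>y. f (inv_into W \<phi> y)) (\<phi> z) * g z + f z * partial_deriv j (\<lambda>y. g (inv_into W \<phi> y)) (\<phi> z)"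
    if "j < dm i" for j
    using smooth_function_onD(2)[OF assms(4) c] smooth_function_onD(2)[OF assms(5) c] that z
      partial_deriv_mult[OF chart_image_open[OF c assms(3)], of "\<lambda>y. f (inv_into W \<phi> y)" "\<lambda>y. g (inv_into W \<phi> y)" j "\<phi> z"]
      chart_inj[OF c]
    by auto
  then show ?thesis
    by (simp add: dir_deriv_def algebra_simps sum.distrib sum_distrib_left)
qed

text \<open>The vector \<open>w\<close> is the image of \<open>v\<close> under the differential of
  the transition map, so one \<open>w\<close> serves all \<open>g\<close>. An atlas may be
  uncountable; this reduces statements about all of its charts to countably many.\<close>

lemma dir_deriv_change_chart:
  assumes i: "i \<in> I" and c: "(W, \<phi>) \<in> A i" and c': "(W', \<psi>) \<in> A i" and z: "z \<in> W" "z \<in> W'"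
    and v: "v \<in> Espace (dm i)"
  obtains w where "w \<in> Espace (dm i)"
    "\<And>g. smooth_function g \<Longrightarrow> dir_deriv i W' \<psi> g z v = dir_deriv i W \<phi> g z w"
proof -
  let ?d = "dm i" and ?D = "\<psi> ` (W' \<inter> W)"
  define T where "T y = \<phi> (inv_into W' \<psi> y)" for y
  define w where "w k = (if k < ?d then \<Sum>j<?d. v j * partial_deriv j (\<lambda>y. T y k) (\<psi> z) else 0)" for k
  have D: "openin (Euclidean_space ?d) ?D" by (rule chart_intersection_open[OF i c' c])
  have zD: "\<psi> z \<in> ?D" using z by auto
  have inv: "inv_into W' \<psi> (\<psi> u) = u" if "u \<in> W'" for u using chart_inj[OF i c'] that by simp
  have "smooth_transition ?d (W', \<psi>) (W, \<phi>)"
    using smooth_manifold[OF i] c c' unfolding smooth_manifold_def by blast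
  then have T: "Ck_on 1 ?d ?D (\<lambda>y. T y k)" if "k < ?d" for k
    using that unfolding smooth_transition_def smooth_on_def T_def by auto
  define \<gamma> where "\<gamma> t = (\<lambda>j. \<psi> z j + t * v j)" for t :: real
  have \<gamma>E: "\<gamma> t \<in> Espace ?d" for t
    using v chart_Espace[OF i c' z(2)] by (auto simp: \<gamma>_def topspace_Euclidean_space)
  have \<gamma>0: "\<gamma> 0 = \<psi> z" by (simp add: \<gamma>_def)
  have \<gamma>': "((\<lambda>t. \<gamma> t j) has_real_derivative v j) (at 0)" for j
    unfolding \<gamma>_def by (auto intro!: derivative_eq_intros)
  obtain T0 where T0: "open T0" "?D = T0 \<inter> Espace ?d" using D openin_Euclidean_space_iff by auto
  have "continuous_on UNIV \<gamma>" unfolding \<gamma>_def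
    by (intro continuous_on_coordinatewise_then_product continuous_intros)
  then have "open (\<gamma> -` T0)" using T0(1) by (simp add: open_vimage)
  moreover have "0 \<in> \<gamma> -` T0" using zD T0(2) \<gamma>0 by auto
  ultimately have "eventually (\<lambda>t. t \<in> \<gamma> -` T0) (nhds 0)" by (rule eventually_nhds_in_open)
  then have ev: "eventually (\<lambda>t. \<gamma> t \<in> ?D) (nhds 0)"
    by eventually_elim (use T0(2) \<gamma>E in auto)
  \<comment> \<open>The line \<open>\<gamma>\<close> read in the other chart. The default
    \<open>\<phi> z\<close> keeps the curve in \<open>Espace\<close> for every \<open>t\<close>, as
    the curve rule demands; near 0 the default is never taken.\<close>
  define \<xi> where "\<xi> t = (if \<gamma> t \<in> ?D then T (\<gamma> t) else \<phi> z)" for t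
  have \<xi>0: "\<xi> 0 = \<phi> z" using zD inv[OF z(2)] by (simp add: \<xi>_def \<gamma>0 T_def)
  have \<xi>E: "\<xi> t \<in> Espace ?d" for t
  proof (cases "\<gamma> t \<in> ?D")
    case True
    then obtain u where "u \<in> W'" "u \<in> W" "\<gamma> t = \<psi> u" by auto
    then show ?thesis using chart_Espace[OF i c] inv by (simp add: \<xi>_def T_def)
  next
    case False
    then show ?thesis using chart_Espace[OF i c z(1)] unfolding \<xi>_def by auto
  qed
  have \<xi>': "((\<lambda>t. \<xi> t k) has_real_derivative w k) (at 0)" if k: "k < ?d" for k
  proof -
    have "((\<lambda>t. T (\<gamma> t) k) has_real_derivative (\<Sum>j<?d. v j * partial_deriv j (\<lambda>y. T y k) (\<gamma> 0))) (at 0)"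
      by (rule Ck_on_1_curve_derivative[OF D T[OF k] _ \<gamma>E \<gamma>']) (use zD \<gamma>0 in simp)
    moreover have eq: "eventually (\<lambda>t. T (\<gamma> t) k = \<xi> t k) (nhds 0)"
      using ev by eventually_elim (simp add: \<xi>_def)
    ultimately show ?thesis using DERIV_cong_ev[OF refl eq refl] k by (simp add: w_def \<gamma>0)
  qed
  \<comment> \<open>Both sides are the derivative at 0 of one and the same real function near 0,
    computed along \<open>\<gamma>\<close> and along \<open>\<xi>\<close>.\<close>
  have "dir_deriv i W' \<psi> g z v = dir_deriv i W \<phi> g z w" if g: "smooth_function g" for g
  proof -
    have 1: "((\<lambda>t. g (inv_into W' \<psi> (\<gamma> t))) has_real_derivative dir_deriv i W' \<psi> g z v) (at 0)"
      using Ck_on_1_curve_derivative[OF chart_open(3)[OF i c'] smooth_functionD(2)[OF g i c'] _ \<gamma>E \<gamma>'] z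
      by (simp add: dir_deriv_def \<gamma>0)
    have 2: "((\<lambda>t. g (inv_into W \<phi> (\<xi> t))) has_real_derivative dir_deriv i W \<phi> g z w) (at 0)"
      using Ck_on_1_curve_derivative[OF chart_open(3)[OF i c] smooth_functionD(2)[OF g i c] _ \<xi>E \<xi>'] z
      by (simp add: dir_deriv_def \<xi>0)
    have eq: "eventually (\<lambda>t. g (inv_into W' \<psi> (\<gamma> t)) = g (inv_into W \<phi> (\<xi> t))) (nhds 0)"
      using ev
    proof eventually_elim
      case (elim t)
      then obtain u where "u \<in> W'" "u \<in> W" "\<gamma> t = \<psi> u" by auto
      then show ?case using elim inv chart_inj[OF i c] by (simp add: \<xi>_def T_def)
    qed
    show ?thesis using 1 2 DERIV_cong_ev[OF refl eq refl] DERIV_unique by blast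
  qed
  moreover have "w \<in> Espace ?d" by (simp add: w_def topspace_Euclidean_space)
  ultimately show ?thesis using that by blast
qed

section \<open>Bump functions and a proper function\<close>

lemma local_embedding_smooth:
  assumes U: "openin X U"
    and e: "\<And>i. i \<in> I \<Longrightarrow> manifold_embedding (subtopology X (U \<inter> S i)) (dm i) (restrict_atlas U (A i)) N e"
    and cont: "continuous_map (subtopology X U) (Euclidean_space N) e"
    and k: "k < N"
  shows "smooth_function_on U (\<lambda>z. e z k)"
proof (rule smooth_function_onI)
  show "continuous_map (subtopology X U) euclideanreal (\<lambda>z. e z k)"
    using cont unfolding Euclidean_space_def continuous_map_in_subtopology
      continuous_map_componentwise_UNIV by blast
  fix i W \<phi> m assume c: "i \<in> I" "(W, \<phi>) \<in> A i"
  have "(W \<inter> U, \<phi>) \<in> restrict_atlas U (A i)" using c(2) by (force simp: restrict_atlas_def)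
  moreover have "manifold_smooth_map (dm i) (restrict_atlas U (A i)) N e"
    using e[OF c(1)] by (simp add: manifold_embedding_def manifold_immersion_def)
  ultimately have sm: "Ck_on m (dm i) (\<phi> ` (W \<inter> U)) (\<lambda>y. e (inv_into (W \<inter> U) \<phi> y) k)"
    using k unfolding manifold_smooth_map_def smooth_on_def by fast
  show "Ck_on m (dm i) (\<phi> ` (W \<inter> U)) (\<lambda>y. e (inv_into W \<phi> y) k)"
  proof (rule Ck_on_cong[OF chart_image_open[OF c U] _ sm])
    fix y assume "y \<in> \<phi> ` (W \<inter> U)"
    then show "e (inv_into (W \<inter> U) \<phi> y) k = e (inv_into W \<phi> y) k"
      using chart_inj[OF c] inj_on_subset[OF chart_inj[OF c], of "W \<inter> U"] by auto
  qed
qed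

text \<open>A vector killed by all coordinate differentials has the same image as the zero vector
  under \<open>chart_differential\<close>, which is injective.\<close>

lemma local_embedding_immersion:
  assumes U: "openin X U"
    and e: "\<And>i. i \<in> I \<Longrightarrow> manifold_embedding (subtopology X (U \<inter> S i)) (dm i) (restrict_atlas U (A i)) N e"
    and c: "i \<in> I" "(W, \<phi>) \<in> A i" and z: "z \<in> W" "z \<in> U" and v: "v \<in> Espace (dm i)"
    and zero: "\<And>k. k < N \<Longrightarrow> dir_deriv i W \<phi> (\<lambda>w. e w k) z v = 0"
  shows "v = (\<lambda>_. 0)"
proof -
  have "(W \<inter> U, \<phi>) \<in> restrict_atlas U (A i)" using c(2) by (force simp: restrict_atlas_def)
  moreover have "manifold_immersion (dm i) (restrict_atlas U (A i)) N e"
    using e[OF c(1)] by (simp add: manifold_embedding_def)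
  ultimately have inj: "inj_on (chart_differential (dm i) N (W \<inter> U, \<phi>) e (\<phi> z)) (Espace (dm i))"
    using z unfolding manifold_immersion_def by fast
  have "partial_deriv j (\<lambda>y. e (inv_into (W \<inter> U) \<phi> y) k) (\<phi> z) = partial_deriv j (\<lambda>y. e (inv_into W \<phi> y) k) (\<phi> z)"
    if "j < dm i" for j k
    by (rule partial_deriv_cong(1)[OF chart_image_open[OF c U]])
      (use that z chart_inj[OF c] inj_on_subset[OF chart_inj[OF c], of "W \<inter> U"] in auto)
  then have "chart_differential (dm i) N (W \<inter> U, \<phi>) e (\<phi> z) v = chart_differential (dm i) N (W \<inter> U, \<phi>) e (\<phi> z) (\<lambda>_. 0)"
    using zero by (auto simp: chart_differential_def dir_deriv_def)
  then show ?thesis using inj_onD[OF inj] v by (simp add: topspace_Euclidean_space)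
qed

text \<open>Here \<open>e\<close> is a local embedding into $\mathbb{R}^N$, of which only the values where \<open>\<beta>\<close> is
  nonzero matter.\<close>

definition bump :: "('a \<Rightarrow> real) \<Rightarrow> nat \<Rightarrow> ('a \<Rightarrow> nat \<Rightarrow> real) \<Rightarrow> 'a set \<Rightarrow> bool" where
  "bump \<beta> N e K \<longleftrightarrow> smooth_function \<beta> \<and> compactin X K \<and>
     (\<forall>z\<in>topspace X. 0 \<le> \<beta> z \<and> \<beta> z \<le> 1 \<and> (\<beta> z \<noteq> 0 \<longrightarrow> z \<in> K)) \<and>
     (\<forall>k<N. smooth_function (\<lambda>z. \<beta> z * e z k)) \<and>
     (\<forall>k<N. smooth_function_on {z \<in> topspace X. \<beta> z \<noteq> 0} (\<lambda>z. e z k)) \<and>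
     (\<exists>B. \<forall>k<N. \<forall>z\<in>topspace X. \<bar>\<beta> z * e z k\<bar> \<le> B) \<and>
     (\<forall>z\<in>topspace X. \<forall>w\<in>topspace X. \<beta> z \<noteq> 0 \<longrightarrow> \<beta> w \<noteq> 0 \<longrightarrow>
        (\<forall>k<N. e z k = e w k) \<longrightarrow> z = w) \<and>
     (\<forall>i\<in>I. \<forall>(W, \<phi>)\<in>A i. \<forall>z\<in>W. \<forall>v\<in>Espace (dm i). \<beta> z \<noteq> 0 \<longrightarrow>
        (\<forall>k<N. dir_deriv i W \<phi> (\<lambda>w. e w k) z v = 0) \<longrightarrow> v = (\<lambda>_. 0))"

lemma bumpD:
  assumes "bump \<beta> N e K"
  shows "smooth_function \<beta>" "compactin X K"
    "\<And>z. z \<in> topspace X \<Longrightarrow> 0 \<le> \<beta> z" "\<And>z. z \<in> topspace X \<Longrightarrow> \<beta> z \<le> 1"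
    "\<And>z. z \<in> topspace X \<Longrightarrow> \<beta> z \<noteq> 0 \<Longrightarrow> z \<in> K"
    "\<And>k. k < N \<Longrightarrow> smooth_function (\<lambda>z. \<beta> z * e z k)"
    "\<And>k. k < N \<Longrightarrow> smooth_function_on {z \<in> topspace X. \<beta> z \<noteq> 0} (\<lambda>z. e z k)"
    "\<exists>B. \<forall>k<N. \<forall>z\<in>topspace X. \<bar>\<beta> z * e z k\<bar> \<le> B"
    "\<And>z w. z \<in> topspace X \<Longrightarrow> w \<in> topspace X \<Longrightarrow> \<beta> z \<noteq> 0 \<Longrightarrow> \<beta> w \<noteq> 0 \<Longrightarrow>
        (\<And>k. k < N \<Longrightarrow> e z k = e w k) \<Longrightarrow> z = w"
    "\<And>i W \<phi> z v. i \<in> I \<Longrightarrow> (W, \<phi>) \<in> A i \<Longrightarrow> z \<in> W \<Longrightarrow> v \<in> Espace (dm i) \<Longrightarrow> \<beta> z \<noteq> 0 \<Longrightarrow>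
        (\<And>k. k < N \<Longrightarrow> dir_deriv i W \<phi> (\<lambda>w. e w k) z v = 0) \<Longrightarrow> v = (\<lambda>_. 0)"
proof -
  note d = assms[unfolded bump_def]
  show "smooth_function \<beta>" "compactin X K" using d by simp_all
  show "0 \<le> \<beta> z" "\<beta> z \<le> 1" "\<beta> z \<noteq> 0 \<Longrightarrow> z \<in> K" if "z \<in> topspace X" for z using d that by simp_all
  show "smooth_function (\<lambda>z. \<beta> z * e z k)" if "k < N" for k using d that by simp
  show "smooth_function_on {z \<in> topspace X. \<beta> z \<noteq> 0} (\<lambda>z. e z k)" if "k < N" for k using d that by simp
  show "\<exists>B. \<forall>k<N. \<forall>z\<in>topspace X. \<bar>\<beta> z * e z k\<bar> \<le> B"
    using d by simp
  show "z = w" if "z \<in> topspace X" "w \<in> topspace X" "\<beta> z \<noteq> 0" "\<beta> w \<noteq> 0"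
    "\<And>k. k < N \<Longrightarrow> e z k = e w k" for z w
    using d that by simp
  show "v = (\<lambda>_. 0)"
    if "i \<in> I" "(W, \<phi>) \<in> A i" "z \<in> W" "v \<in> Espace (dm i)" "\<beta> z \<noteq> 0"
      "\<And>k. k < N \<Longrightarrow> dir_deriv i W \<phi> (\<lambda>w. e w k) z v = 0" for i W \<phi> z v
  proof -
    have "\<forall>(W, \<phi>)\<in>A i. \<forall>z\<in>W. \<forall>v\<in>Espace (dm i). \<beta> z \<noteq> 0 \<longrightarrow>
        (\<forall>k<N. dir_deriv i W \<phi> (\<lambda>w. e w k) z v = 0) \<longrightarrow> v = (\<lambda>_. 0)"
      using d that(1) by simp
    from bspec[OF this that(2)] show ?thesis using that(3-) by simp
  qed
qed

text \<open>Serves the empty space, where there are no centres of bumps to enumerate.\<close>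

lemma bump_zero: "bump (\<lambda>_. 0) 0 e {}"
  by (simp add: bump_def smooth_function_on_const)

text \<open>A radial bump around \<open>e x\<close> is pulled back along a local embedding
  \<open>e\<close>. Its nonzero set lies in a neighbourhood of \<open>x\<close> contained in a
  compact \<open>K\<close> inside \<open>U\<close>, so extension by zero is smooth.\<close>

lemma bump_exists:
  assumes "x \<in> topspace X"
  obtains \<beta> N e K where "bump \<beta> N e K" "\<beta> x = 1"
proof -
  obtain U N e where U: "openin X U" "x \<in> U" and emb: "embedding_map (subtopology X U) (Euclidean_space N) e"
    and e: "\<And>i. i \<in> I \<Longrightarrow> manifold_embedding (subtopology X (U \<inter> S i)) (dm i) (restrict_atlas U (A i)) N e"
    by (rule local_embedding[OF assms]) blast
  have Ut: "U \<subseteq> topspace X" using U(1) by (rule openin_subset)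
  have hom: "homeomorphic_map (subtopology X U) (subtopology (Euclidean_space N) (e ` U)) e"
    using emb Ut by (simp add: embedding_map_def Int_absorb1)
  have cont: "continuous_map (subtopology X U) (Euclidean_space N) e"
    using homeomorphic_imp_continuous_map[OF hom] continuous_map_into_fulltopology by blast
  have sm: "smooth_function_on U (\<lambda>z. e z k)" if "k < N" for k
    by (rule local_embedding_smooth[OF U(1) _ cont that]) (rule e)
  have inj: "inj_on e U" using homeomorphic_imp_injective_map[OF hom] Ut by (simp add: Int_absorb1)
  have eE: "e z \<in> Espace N" if "z \<in> U" for z
    using continuous_map_image_subset_topspace[OF cont] that Ut by auto
  have "neighbourhood_base_of (compactin X) X"
    using locally_compact Hausdorff locally_compact_space_neighbourhood_base by blast
  then obtain V K where V: "openin X V" "compactin X K" "x \<in> V" "V \<subseteq> K" "K \<subseteq> U"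
    using U unfolding neighbourhood_base_of by meson
  have Kcl: "closedin X K" using V(2) Hausdorff compactin_imp_closedin by blast
  \<comment> \<open>Here \<open>e\<close> must be a homeomorphism onto its image: the image of
    \<open>V\<close> is relatively open, so a point of \<open>U\<close> whose image is close to
    \<open>e x\<close> already lies in \<open>V\<close>.\<close>
  have "openin (subtopology X U) V" using V by (auto simp: openin_open_subtopology[OF U(1)])
  then have "openin (subtopology (Euclidean_space N) (e ` U)) (e ` V)"
    using homeomorphic_imp_open_map[OF hom] by (simp add: open_map_def)
  then obtain O' where O': "openin (Euclidean_space N) O'" "e ` V = O' \<inter> e ` U"
    by (auto simp: openin_subtopology)
  then obtain r where r: "r > 0" "cube N (e x) r \<subseteq> O'"
    using openin_contains_cube[OF O'(1), of "e x"] V U by blast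
  \<comment> \<open>Squared distance to \<open>e x\<close> in units of \<open>r\<close>, written
    with products so that the closure rules for sums and products apply. The bump is nonzero exactly
    where \<open>q < 1\<close>, which confines each coordinate to within \<open>r\<close> of that of
    \<open>e x\<close>.\<close>
  define q where "q z = (\<Sum>j<N. (e z j - e x j) * (e z j - e x j)) * (1 / (r * r))" for z
  define \<beta> where "\<beta> z = (if z \<in> U then flat (1 - q z) else 0)" for z
  have close: "\<bar>e z k - e x k\<bar> \<le> r" if "z \<in> U" "\<beta> z \<noteq> 0" "k < N" for z k
  proof -
    have "q z < 1" using that flat_eq_0_iff[of "1 - q z"] by (simp add: \<beta>_def)
    then have "(\<Sum>j<N. (e z j - e x j) * (e z j - e x j)) < r * r"
      using r(1) by (simp add: q_def field_simps)
    moreover have "(e z k - e x k) * (e z k - e x k) \<le> (\<Sum>j<N. (e z j - e x j) * (e z j - e x j))"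
      using that(3) by (intro member_le_sum) auto
    ultimately have "(e z k - e x k)\<^sup>2 \<le> r\<^sup>2" by (simp add: power2_eq_square)
    then show ?thesis using r(1) abs_le_square_iff[of "e z k - e x k" r] by simp
  qed
  have supp: "z \<in> V" if "z \<in> U" "\<beta> z \<noteq> 0" for z
  proof -
    have "e z \<in> cube N (e x) r" using close[OF that] eE[OF that(1)] by (simp add: cube_def)
    then have "e z \<in> e ` V" using r(2) O'(2) that(1) by auto
    then show ?thesis using inj V(4,5) that(1) by (auto dest: inj_onD)
  qed
  have q_sm: "smooth_function_on U (\<lambda>z. flat (1 - q z))"
    unfolding q_def
    by (intro smooth_function_on_flat smooth_function_on_diff smooth_function_on_mult
        smooth_function_on_sum smooth_function_on_const sm U(1)) auto
  have K0: "flat (1 - q z) = 0" if "z \<in> U - K" for z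
    using supp[of z] that V(4) by (auto simp: \<beta>_def)
  have \<beta>_sm: "smooth_function \<beta>"
    unfolding \<beta>_def by (rule smooth_function_extend_zero[OF U(1) Kcl V(5) q_sm K0])
  have \<beta>e_sm: "smooth_function (\<lambda>z. \<beta> z * e z k)" if "k < N" for k
  proof -
    have "smooth_function (\<lambda>z. if z \<in> U then flat (1 - q z) * e z k else 0)"
      by (rule smooth_function_extend_zero[OF U(1) Kcl V(5)])
        (use smooth_function_on_mult[OF U(1) q_sm sm[OF that]] K0 in auto)
    moreover have "(\<lambda>z. if z \<in> U then flat (1 - q z) * e z k else 0) = (\<lambda>z. \<beta> z * e z k)"
      by (auto simp: \<beta>_def)
    ultimately show ?thesis by simp
  qed
  have nzU: "z \<in> U" if "\<beta> z \<noteq> 0" for z using that by (auto simp: \<beta>_def split: if_splits)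
  have q0: "q z \<ge> 0" for z
  proof -
    have "0 \<le> (\<Sum>j<N. (e z j - e x j) * (e z j - e x j))" by (intro sum_nonneg) simp
    then show ?thesis unfolding q_def using r(1) by (intro mult_nonneg_nonneg) auto
  qed
  have \<beta>b: "0 \<le> \<beta> z" "\<beta> z \<le> 1" for z
    using flat_bounds(1)[of "1 - q z"] flat_bounds(2)[of "1 - q z"] q0[of z] by (auto simp: \<beta>_def)
  have "bump \<beta> N e K"
    unfolding bump_def
  proof (intro conjI allI impI ballI)
    show "smooth_function \<beta>" by (rule \<beta>_sm)
    show "compactin X K" by (rule V(2))
    show "0 \<le> \<beta> z" "\<beta> z \<le> 1" for z by (rule \<beta>b)+
    show "z \<in> K" if "\<beta> z \<noteq> 0" for z using supp[OF nzU[OF that] that] V(4) by auto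
    show "smooth_function (\<lambda>z. \<beta> z * e z k)" if "k < N" for k by (rule \<beta>e_sm[OF that])
    show "smooth_function_on {z \<in> topspace X. \<beta> z \<noteq> 0} (\<lambda>z. e z k)" if "k < N" for k
      by (rule smooth_function_on_subset[OF sm[OF that]]) (use nzU in auto)
    define B where "B = (\<Sum>k<N. \<bar>e x k\<bar> + r)"
    have "\<bar>\<beta> z * e z k\<bar> \<le> B" if "k < N" for k z
    proof (cases "\<beta> z = 0")
      case True
      have "B \<ge> 0" unfolding B_def using r(1) by (intro sum_nonneg) auto
      then show ?thesis using True by simp
    next
      case False
      have "\<bar>e z k\<bar> \<le> \<bar>e x k\<bar> + r" using close[OF nzU[OF False] False that] by linarith
      also have "\<dots> \<le> B" unfolding B_def using that r(1) by (intro member_le_sum) auto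
      finally have "\<bar>e z k\<bar> \<le> B" .
      moreover have "\<bar>\<beta> z * e z k\<bar> \<le> 1 * \<bar>e z k\<bar>"
        unfolding abs_mult using \<beta>b[of z] by (intro mult_right_mono) auto
      ultimately show ?thesis by simp
    qed
    then show "\<exists>B. \<forall>k<N. \<forall>z\<in>topspace X. \<bar>\<beta> z * e z k\<bar> \<le> B" by blast
    show "z = w" if "\<beta> z \<noteq> 0" "\<beta> w \<noteq> 0" "\<forall>k<N. e z k = e w k" for z w
    proof -
      have "e z = e w"
        using eE[OF nzU[OF that(1)]] eE[OF nzU[OF that(2)]] that(3)
        by (auto simp: topspace_Euclidean_space fun_eq_iff) (metis not_le)
      then show ?thesis using inj_onD[OF inj] nzU that(1,2) by blast
    qed
    fix i c assume i: "i \<in> I" and cA: "c \<in> A i"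
    obtain W \<phi> where c: "c = (W, \<phi>)" by (cases c)
    have "v = (\<lambda>_. 0)" if "z \<in> W" "v \<in> Espace (dm i)" "\<beta> z \<noteq> 0"
      "\<forall>k<N. dir_deriv i W \<phi> (\<lambda>w. e w k) z v = 0" for z v
      by (rule local_embedding_immersion[OF U(1) e _ _ that(1) nzU[OF that(3)] that(2)])
        (use that(4) i cA c in auto)
    then show "case c of (W, \<phi>) \<Rightarrow> \<forall>z\<in>W. \<forall>v\<in>Espace (dm i). \<beta> z \<noteq> 0 \<longrightarrow>
        (\<forall>k<N. dir_deriv i W \<phi> (\<lambda>w. e w k) z v = 0) \<longrightarrow> v = (\<lambda>_. 0)"
      unfolding c by simp
  qed
  moreover have "\<beta> x = 1" using U(2) by (simp add: \<beta>_def q_def flat_1)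
  ultimately show ?thesis using that by blast
qed

lemma smooth_function_open_greater:
  assumes "smooth_function g" shows "openin X {z \<in> topspace X. g z > a}"
  using openin_continuous_map_preimage[OF smooth_functionD(1)[OF assms], of "{a<..}"] by simp

text \<open>Second countability gives the Lindelof property. The sets where a bump exceeds 1/2,
  instead of being merely nonzero, leave room for cut-offs that are 1 where it vanishes and 0 where
  it exceeds 1/2.\<close>

lemma countable_bumps:
  obtains \<beta> :: "nat \<Rightarrow> 'a \<Rightarrow> real" and N e K where
    "\<And>k. bump (\<beta> k) (N k) (e k) (K k)"
    "\<And>z. z \<in> topspace X \<Longrightarrow> \<exists>k. \<beta> k z > 1 / 2"
proof (cases "topspace X = {}")
  case True
  show ?thesis by (rule that[of "\<lambda>_ _. 0" "\<lambda>_. 0" "\<lambda>_ _ _. 0" "\<lambda>_. {}"]) (use bump_zero True in auto)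
next
  case False
  have "\<forall>x\<in>topspace X. \<exists>\<beta> N e K. bump \<beta> N e K \<and> \<beta> x = 1" using bump_exists by metis
  then obtain \<beta> N e K where b: "\<And>x. x \<in> topspace X \<Longrightarrow> bump (\<beta> x) (N x) (e x) (K x)"
    "\<And>x. x \<in> topspace X \<Longrightarrow> \<beta> x x = 1" by metis
  let ?V = "\<lambda>x. {z \<in> topspace X. \<beta> x z > 1 / 2}"
  have "Lindelof_space X" using second_countable by (rule second_countable_imp_Lindelof_space)
  moreover have "openin X V" if "V \<in> ?V ` topspace X" for V
  proof -
    obtain x where "x \<in> topspace X" "V = ?V x" using \<open>V \<in> ?V ` topspace X\<close> by blast
    then show ?thesis using smooth_function_open_greater[OF bumpD(1)[OF b(1)]] by blast
  qed
  moreover have "\<Union> (?V ` topspace X) = topspace X" using b(2) by force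
  ultimately have "\<exists>\<V>. countable \<V> \<and> \<V> \<subseteq> ?V ` topspace X \<and> \<Union>\<V> = topspace X"
    by (rule Lindelof_spaceD)
  then obtain \<V> where \<V>: "countable \<V>" "\<V> \<subseteq> ?V ` topspace X" "\<Union>\<V> = topspace X"
    by (elim exE conjE) (rule that)
  obtain C where "countable C" "C \<subseteq> topspace X" "\<V> = ?V ` C"
    using iffD1[OF countable_subset_image conjI[OF \<V>(1,2)]] by (elim exE conjE) (rule that)
  with \<V>(3) have C: "countable C" "C \<subseteq> topspace X" "\<Union> (?V ` C) = topspace X" by simp_all
  have "C \<noteq> {}"
  proof
    assume "C = {}"
    with C(3) have "topspace X = {}" by (simp only: image_empty Union_empty)
    with \<open>topspace X \<noteq> {}\<close> show False by contradiction
  qed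
  \<comment> \<open>For finite \<open>C\<close> this sequence repeats points, which is harmless
    since only covering is required.\<close>
  define x where "x = from_nat_into C"
  have x: "x k \<in> topspace X" for k using from_nat_into[OF \<open>C \<noteq> {}\<close>] C(2) by (auto simp: x_def)
  show ?thesis
  proof (rule that[of "\<lambda>k. \<beta> (x k)" "\<lambda>k. N (x k)" "\<lambda>k. e (x k)" "\<lambda>k. K (x k)"])
    show "bump (\<beta> (x k)) (N (x k)) (e (x k)) (K (x k))" for k by (rule b(1)[OF x])
    fix z assume "z \<in> topspace X"
    then have "z \<in> \<Union> (?V ` C)" by (simp only: C(3))
    then obtain c where "c \<in> C" "\<beta> c z > 1 / 2" by auto
    then show "\<exists>k. \<beta> (x k) z > 1 / 2"
      using from_nat_into_surj[OF C(1), of c] by (auto simp: x_def)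
  qed
qed

text \<open>The products \<open>\<theta> k\<close> vanish where an earlier \<open>\<beta> j\<close> exceeds \<open>1 / 2\<close>, so they form a locally
  finite family, and they equal 1 outside the supports of the earlier \<open>\<beta> j\<close>, so their sum is proper.\<close>

lemma separating_functions:
  obtains \<rho> :: "'a \<Rightarrow> real" and G :: "nat \<Rightarrow> 'a \<Rightarrow> real" and B :: "nat \<Rightarrow> real" and V :: "nat \<Rightarrow> 'a set"
  where "smooth_function \<rho>" "\<And>c. \<exists>K. compactin X K \<and> (\<forall>z\<in>topspace X. \<rho> z \<le> c \<longrightarrow> z \<in> K)"
    and "\<And>m. smooth_function (G m)" "\<And>m. B m > 0" "\<And>m z. z \<in> topspace X \<Longrightarrow> \<bar>G m z\<bar> \<le> B m"
    and "\<And>l. openin X (V l)" "\<And>z. z \<in> topspace X \<Longrightarrow> \<exists>l. z \<in> V l"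
    "\<And>l. \<exists>M. \<forall>m\<ge>M. \<forall>z\<in>V l. G m z = 0"
    and "\<And>z w. z \<in> topspace X \<Longrightarrow> w \<in> topspace X \<Longrightarrow> (\<And>m. G m z = G m w) \<Longrightarrow> z = w"
    and "\<And>i W \<phi> z v. i \<in> I \<Longrightarrow> (W, \<phi>) \<in> A i \<Longrightarrow> z \<in> W \<Longrightarrow> v \<in> Espace (dm i) \<Longrightarrow>
      (\<And>m. dir_deriv i W \<phi> (G m) z v = 0) \<Longrightarrow> v = (\<lambda>_. 0)"
proof -
  obtain \<beta> :: "nat \<Rightarrow> 'a \<Rightarrow> real" and N e K where
    b: "\<And>k. bump (\<beta> k) (N k) (e k) (K k)" and cover: "\<And>z. z \<in> topspace X \<Longrightarrow> \<exists>k. \<beta> k z > 1 / 2"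
    by (rule countable_bumps) blast
  note b' = bumpD[OF b]
  have fh: "flat (1 / 2) > 0" by (simp add: flat_eq)
  define \<theta> where "\<theta> k z = (\<Prod>j<k. flat (1 / 2 - \<beta> j z) * (1 / flat (1 / 2)))" for k z
  define V where "V l = {z \<in> topspace X. \<beta> l z > 1 / 2}" for l
  have V: "openin X (V l)" for l unfolding V_def by (rule smooth_function_open_greater[OF b'(1)])
  have \<theta>_sm: "smooth_function (\<theta> k)" for k
    unfolding \<theta>_def
    by (intro smooth_function_on_prod smooth_function_on_mult smooth_function_on_flat
        smooth_function_on_diff smooth_function_on_const b'(1) openin_topspace)
  have \<theta>0: "\<theta> k z \<ge> 0" for k z
    unfolding \<theta>_def using flat_bounds(1) fh by (intro prod_nonneg) auto
  have flat_mono: "flat s \<le> flat t" if "s \<le> t" for s t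
    using that by (auto simp: flat_eq field_simps)
  have \<theta>1: "\<theta> k z \<le> 1" if "z \<in> topspace X" for k z
    unfolding \<theta>_def using flat_bounds(1) fh flat_mono[of "1 / 2 - \<beta> _ z" "1 / 2"] b'(3)[OF that]
    by (intro prod_le_1) auto
  have \<theta>V: "\<theta> k z = 0" if "z \<in> V l" "l < k" for k l z
  proof -
    have "flat (1 / 2 - \<beta> l z) = 0" using that(1) by (simp add: V_def flat_eq_0_iff)
    then show ?thesis unfolding \<theta>_def using that(2) by (intro prod_zero) auto
  qed
  have \<theta>out: "\<theta> k z = 1" if "\<And>j. j < k \<Longrightarrow> \<beta> j z = 0" for k z
    unfolding \<theta>_def using fh that by (intro prod.neutral) auto

  define \<rho> where "\<rho> z = (\<Sum>m. \<theta> m z)" for z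
  have \<rho>V: "\<rho> z = (\<Sum>m\<le>l. \<theta> m z)" if "z \<in> V l" for l z
    unfolding \<rho>_def by (rule suminf_finite) (use \<theta>V[OF that] in auto)
  have \<rho>_sm: "smooth_function \<rho>"
  proof (rule smooth_function_on_local)
    fix z assume "z \<in> topspace X"
    then obtain l where l: "z \<in> V l" using cover by (auto simp: V_def)
    have "smooth_function (\<lambda>z. \<Sum>m\<le>l. \<theta> m z)"
      by (intro smooth_function_on_sum \<theta>_sm openin_topspace)
    then have "smooth_function_on (V l) (\<lambda>z. \<Sum>m\<le>l. \<theta> m z)"
      by (rule smooth_function_on_subset) (auto simp: V_def)
    then have "smooth_function_on (V l) \<rho>"
      by (rule smooth_function_on_cong[OF V, rotated]) (simp add: \<rho>V)
    then show "\<exists>V. openin X V \<and> z \<in> V \<and> smooth_function_on V \<rho>" using V l by blast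
  qed simp
  have \<rho>_proper: "\<exists>K. compactin X K \<and> (\<forall>z\<in>topspace X. \<rho> z \<le> c \<longrightarrow> z \<in> K)" for c
  proof -
    obtain m :: nat where m: "c < real m" using reals_Archimedean2 by blast
    have "compactin X (\<Union>j<m. K j)" using b'(2) by (intro compactin_Union) auto
    moreover have "z \<in> (\<Union>j<m. K j)" if z: "z \<in> topspace X" "\<rho> z \<le> c" for z
    proof (rule ccontr)
      assume "z \<notin> (\<Union>j<m. K j)"
      then have "\<beta> j z = 0" if "j < m" for j using b'(5)[OF z(1), of j] that by auto
      then have one: "\<theta> k z = 1" if "k \<le> m" for k using \<theta>out[of k z] that by auto
      obtain l where l: "z \<in> V l" using cover z(1) by (auto simp: V_def)
      \<comment> \<open>Were \<open>l < m\<close>, then \<open>\<theta> m z\<close> would be 0 as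
        well as 1. Hence the finite sum for \<open>\<rho> z\<close> contains the \<open>m\<close>
        terms \<open>\<theta> 0 z\<close> to \<open>\<theta> (m - 1) z\<close>, all equal to
        1.\<close>
      have "\<not> l < m" using \<theta>V[OF l, of m] one[of m] by auto
      then have "(\<Sum>k<m. \<theta> k z) \<le> (\<Sum>k\<le>l. \<theta> k z)" using \<theta>0 by (intro sum_mono2) auto
      then have "real m \<le> \<rho> z" using one by (simp add: \<rho>V[OF l])
      then show False using m z(2) by simp
    qed
    ultimately show ?thesis by blast
  qed

  \<comment> \<open>For each bump: index 0 is the weight \<open>\<theta> k * \<beta> k\<close>,
    indices 1 to \<open>N k\<close> are the coordinates of the local embedding times that weight,
    and the remaining codes are padded with 0.\<close>
  define G where "G m = (case prod_decode m of (k, j) \<Rightarrow>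
      if j = 0 then \<lambda>z. \<theta> k z * \<beta> k z
      else if j \<le> N k then \<lambda>z. \<theta> k z * (\<beta> k z * e k z (j - 1)) else (\<lambda>_. 0))" for m
  have G0: "G (prod_encode (k, 0)) = (\<lambda>z. \<theta> k z * \<beta> k z)" for k by (simp add: G_def)
  have GS: "G (prod_encode (k, Suc j)) = (\<lambda>z. \<theta> k z * (\<beta> k z * e k z j))" if "j < N k" for k j
    using that by (simp add: G_def)
  have G_sm: "smooth_function (G m)" for m
  proof -
    obtain k j where kj: "prod_decode m = (k, j)" by fastforce
    show ?thesis
      using smooth_function_on_mult[OF openin_topspace \<theta>_sm b'(6)[of "j - 1" k], of k]
        smooth_function_on_mult[OF openin_topspace \<theta>_sm b'(1)]
      unfolding G_def kj by (auto simp: smooth_function_on_const)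
  qed
  have "\<exists>B>0. \<forall>z\<in>topspace X. \<bar>G m z\<bar> \<le> B" for m
  proof -
    obtain k j where kj: "prod_decode m = (k, j)" by fastforce
    obtain B where B: "\<And>i z. i < N k \<Longrightarrow> z \<in> topspace X \<Longrightarrow> \<bar>\<beta> k z * e k z i\<bar> \<le> B"
      using b'(8)[of k] by blast
    have "\<bar>\<theta> k z * t\<bar> \<le> \<bar>t\<bar>" if "z \<in> topspace X" for z t
      unfolding abs_mult using \<theta>0[of k z] \<theta>1[OF that, of k] by (intro mult_left_le_one_le) auto
    then have le: "\<bar>\<theta> k z * t\<bar> \<le> b" if "z \<in> topspace X" "\<bar>t\<bar> \<le> b" for z t b
      using that order_trans by blast
    \<comment> \<open>The 1 bounds the weight itself and keeps the bound positive, whatever the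
      value of \<open>B\<close>.\<close>
    have "\<bar>G m z\<bar> \<le> max 1 B" if z: "z \<in> topspace X" for z
    proof -
      have "\<bar>\<theta> k z * \<beta> k z\<bar> \<le> max 1 B" using b'(3,4)[OF z, of k] by (intro le[OF z]) auto
      moreover have "\<bar>\<theta> k z * (\<beta> k z * e k z (j - 1))\<bar> \<le> max 1 B" if "j \<noteq> 0" "j \<le> N k"
        using B[of "j - 1" z] that z by (intro le[OF z]) (simp add: le_max_iff_disj)
      ultimately show ?thesis unfolding G_def kj by auto
    qed
    then show ?thesis by (intro exI[of _ "max 1 B"]) auto
  qed
  then obtain B where B: "\<And>m. B m > 0" "\<And>m z. z \<in> topspace X \<Longrightarrow> \<bar>G m z\<bar> \<le> B m" by metis
  have G_fin: "\<exists>M. \<forall>m\<ge>M. \<forall>z\<in>V l. G m z = 0" for l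
  proof -
    define F where "F = prod_encode ` (SIGMA k:{..l}. {..N k})"
    have "finite F" unfolding F_def by auto
    then have "\<exists>M. \<forall>m\<in>F. m < M" by (simp add: finite_nat_set_iff_bounded)
    then obtain M where M: "\<And>m. m \<in> F \<Longrightarrow> m < M" by metis
    have "G m z = 0" if m: "m \<ge> M" and z: "z \<in> V l" for m z
    proof -
      obtain k j where kj: "prod_decode m = (k, j)" by fastforce
      then have "m = prod_encode (k, j)" by (metis prod_decode_inverse)
      moreover have "m \<notin> F" using M[of m] m by auto
      ultimately have "l < k \<or> N k < j" unfolding F_def by force
      then show ?thesis using \<theta>V[OF z, of k] unfolding G_def kj by auto
    qed
    then show ?thesis by blast
  qed

  \<comment> \<open>Taking the least \<open>k\<close> with \<open>\<beta> k z \<noteq> 0\<close>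
    ensures that no earlier cut-off acts at \<open>z\<close>, so the weight of bump \<open>k\<close>
    is nonzero there.\<close>
  have first: "\<exists>k. \<beta> k z \<noteq> 0 \<and> \<theta> k z = 1" if z: "z \<in> topspace X" for z
  proof -
    define k where "k = (LEAST k. \<beta> k z \<noteq> 0)"
    obtain k0 where "\<beta> k0 z > 1 / 2" using cover[OF z] by blast
    then have "\<beta> k0 z \<noteq> 0" by auto
    then have "\<beta> k z \<noteq> 0" unfolding k_def by (rule LeastI)
    moreover have "\<beta> j z = 0" if "j < k" for j using that not_less_Least[of j] unfolding k_def by blast
    ultimately show ?thesis using \<theta>out by blast
  qed

  \<comment> \<open>Index 0 shows that the weights at \<open>z\<close> and \<open>w\<close> agree
    and are nonzero; dividing by them yields equal coordinates of the local embedding.\<close>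
  have G_sep: "z = w" if zw: "z \<in> topspace X" "w \<in> topspace X" and eq: "\<And>m. G m z = G m w" for z w
  proof -
    obtain k where k: "\<beta> k z \<noteq> 0" "\<theta> k z = 1" using first[OF zw(1)] by blast
    have 1: "\<theta> k z * \<beta> k z = \<theta> k w * \<beta> k w" using eq[of "prod_encode (k, 0)"] by (simp add: G0)
    have "\<beta> k w \<noteq> 0" using 1 k by auto
    have "e k z j = e k w j" if "j < N k" for j
    proof -
      have "\<theta> k z * \<beta> k z * e k z j = \<theta> k w * \<beta> k w * e k w j"
        using eq[of "prod_encode (k, Suc j)"] by (simp add: GS[OF that] mult.assoc)
      then show ?thesis using 1 k by auto
    qed
    then show ?thesis using b'(9)[OF zw k(1) \<open>\<beta> k w \<noteq> 0\<close>] by blast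
  qed

  \<comment> \<open>The differential of the weight vanishes on \<open>v\<close> by index 0, so the
    product rule leaves the nonzero weight times the differential of each coordinate.\<close>
  have G_imm: "v = (\<lambda>_. 0)"
    if c: "i \<in> I" "(W, \<phi>) \<in> A i" and z: "z \<in> W" and v: "v \<in> Espace (dm i)"
      and d: "\<And>m. dir_deriv i W \<phi> (G m) z v = 0" for i W \<phi> z v
  proof -
    have zt: "z \<in> topspace X" using chart_subset[OF c] z by blast
    obtain k where k: "\<beta> k z \<noteq> 0" "\<theta> k z = 1" using first[OF zt] by blast
    define U where "U = {z \<in> topspace X. \<beta> k z > 0}"
    have U: "openin X U" unfolding U_def by (rule smooth_function_open_greater[OF b'(1)])
    have zU: "z \<in> U" using zt k(1) b'(3)[OF zt, of k] by (simp add: U_def)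
    let ?g = "\<lambda>z. \<theta> k z * \<beta> k z"
    have g: "smooth_function_on U ?g"
      by (rule smooth_function_on_subset[OF smooth_function_on_mult[OF openin_topspace \<theta>_sm b'(1)]])
        (auto simp: U_def)
    have dg: "dir_deriv i W \<phi> ?g z v = 0" using d[of "prod_encode (k, 0)"] by (simp add: G0)
    have "dir_deriv i W \<phi> (\<lambda>w. e k w j) z v = 0" if j: "j < N k" for j
    proof -
      have ej: "smooth_function_on U (\<lambda>w. e k w j)"
        by (rule smooth_function_on_subset[OF b'(7)[OF j]]) (auto simp: U_def)
      have "dir_deriv i W \<phi> (\<lambda>w. ?g w * e k w j) z v = 0"
        using d[of "prod_encode (k, Suc j)"] by (simp add: GS[OF j] mult.assoc)
      then have "?g z * dir_deriv i W \<phi> (\<lambda>w. e k w j) z v = 0"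
        using dir_deriv_mult[OF c U g ej z zU, of v] dg by simp
      then show ?thesis using k by simp
    qed
    then show ?thesis using b'(10)[OF c z v k(1)] by blast
  qed

  have cover': "\<exists>l. z \<in> V l" if "z \<in> topspace X" for z using cover[OF that] that by (auto simp: V_def)
  show ?thesis
    by (rule that[of \<rho> G B V, OF \<rho>_sm \<rho>_proper G_sm B V cover' G_fin G_sep G_imm])
qed

section \<open>Generic choice of a coefficient vector\<close>

text \<open>Open cubes are needed to extract a countable subcover of the stratum; the closed cubes
  with the same data are kept because the Lipschitz estimates need compactness.\<close>

lemma countable_cubes:
  assumes i: "i \<in> I"
  shows "\<exists>P. countable P \<and> (\<forall>(W, \<phi>, c, r)\<in>P. (W, \<phi>) \<in> A i \<and> cube (dm i) c r \<subseteq> \<phi> ` W) \<and>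
      (\<forall>z\<in>S i. \<exists>(W, \<phi>, c, r)\<in>P. z \<in> W \<and> \<phi> z \<in> cube (dm i) c r)"
proof -
  let ?Y = "subtopology X (S i)"
  define Q where "Q = {(W, \<phi>, c, r). (W, \<phi>) \<in> A i \<and> cube (dm i) c r \<subseteq> \<phi> ` W}"
  define V where "V = (\<lambda>(W :: 'a set, \<phi>, c, r). {z \<in> W. \<phi> z \<in> open_cube (dm i) c r})"
  have top: "topspace ?Y = S i" using strata_subset[OF i] by auto
  have op: "openin ?Y U" if U: "U \<in> V ` Q" for U
  proof -
    obtain W \<phi> c r where q: "(W, \<phi>, c, r) \<in> Q" "U = V (W, \<phi>, c, r)" using U by auto
    have ch: "(W, \<phi>) \<in> A i" using q(1) by (simp add: Q_def)
    have "continuous_map (subtopology ?Y W) (Euclidean_space (dm i)) \<phi>"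
      using chart_open(2)[OF i ch] homeomorphic_imp_continuous_map continuous_map_into_fulltopology
      unfolding embedding_map_def by blast
    from openin_continuous_map_preimage[OF this openin_open_cube, of c r]
    have "openin (subtopology ?Y W) U"
      unfolding chart_topspace[OF i ch] q(2) V_def by simp
    then show ?thesis using chart_open(1)[OF i ch] openin_trans_full by blast
  qed
  have cov: "\<exists>q\<in>Q. z \<in> V q" if z: "z \<in> S i" for z
  proof -
    obtain W \<phi> where ch: "(W, \<phi>) \<in> A i" "z \<in> W" using chart_exists[OF i z] by metis
    obtain r where r: "r > 0" "cube (dm i) (\<phi> z) r \<subseteq> \<phi> ` W"
      using openin_contains_cube[OF chart_open(3)[OF i ch(1)], of "\<phi> z"] ch(2) by blast
    have "(W, \<phi>, \<phi> z, r) \<in> Q" using ch r by (simp add: Q_def)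
    moreover have "z \<in> V (W, \<phi>, \<phi> z, r)"
      using ch(2) r(1) chart_Espace[OF i ch] by (simp add: V_def open_cube_def)
    ultimately show ?thesis by blast
  qed
  have "Lindelof_space ?Y"
    using second_countable second_countable_subtopology second_countable_imp_Lindelof_space by blast
  moreover have "\<Union> (V ` Q) = topspace ?Y"
  proof
    show "\<Union> (V ` Q) \<subseteq> topspace ?Y" using op openin_subset by blast
    show "topspace ?Y \<subseteq> \<Union> (V ` Q)" using cov unfolding top by blast
  qed
  ultimately have "\<exists>\<V>. countable \<V> \<and> \<V> \<subseteq> V ` Q \<and> \<Union>\<V> = topspace ?Y"
    using op by (intro Lindelof_spaceD)
  then obtain \<V> where \<V>: "countable \<V>" "\<V> \<subseteq> V ` Q" "\<Union>\<V> = topspace ?Y"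
    by (elim exE conjE) (rule that)
  obtain P where P: "countable P" "P \<subseteq> Q" "\<V> = V ` P"
    using iffD1[OF countable_subset_image conjI[OF \<V>(1,2)]] by (elim exE conjE) (rule that)
  show ?thesis
  proof (intro exI[of _ P] conjI ballI)
    show "countable P" by (rule P(1))
    show "case q of (W, \<phi>, c, r) \<Rightarrow> (W, \<phi>) \<in> A i \<and> cube (dm i) c r \<subseteq> \<phi> ` W" if "q \<in> P" for q
      using subsetD[OF P(2) that] by (cases q) (simp add: Q_def)
    fix z assume "z \<in> S i"
    then have "z \<in> \<Union> (V ` P)" using \<V>(3) unfolding top P(3) by simp
    then obtain q where q: "q \<in> P" "z \<in> V q" by blast
    obtain W \<phi> c r where qe: "q = (W, \<phi>, c, r)" by (metis prod_cases4)
    have "z \<in> W" "\<phi> z \<in> cube (dm i) c r" using q(2) by (auto simp: qe V_def cube_def open_cube_def)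
    then show "\<exists>(W, \<phi>, c, r)\<in>P. z \<in> W \<and> \<phi> z \<in> cube (dm i) c r" using q(1) qe by blast
  qed
qed

text \<open>The second part spends one more derivative of \<open>g\<close>; tangent quotients
  involve partial derivatives at a moving base point.\<close>

lemma cell_Lipschitz_chart:
  assumes c: "i \<in> I" "(W, \<phi>) \<in> A i" and q: "cube (dm i) c r \<subseteq> \<phi> ` W" and g: "smooth_function g"
  shows "cell_Lipschitz (cube (dm i) c r) (grid_cell (dm i)) (\<lambda>y. g (inv_into W \<phi> y))"
    and "j < dm i \<Longrightarrow>
      cell_Lipschitz (cube (dm i) c r) (grid_cell (dm i)) (partial_deriv j (\<lambda>y. g (inv_into W \<phi> y)))"
proof -
  note D = chart_open(3)[OF c]
  show "cell_Lipschitz (cube (dm i) c r) (grid_cell (dm i)) (\<lambda>y. g (inv_into W \<phi> y))"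
    by (rule cell_Lipschitz_Ck_on_1[OF D smooth_functionD(2)[OF g c] q])
  assume "j < dm i"
  then have "Ck_on 1 (dm i) (\<phi> ` W) (partial_deriv j (\<lambda>y. g (inv_into W \<phi> y)))"
    using Ck_on_SucE(3)[OF D smooth_functionD(2)[OF g c]] by blast
  then show "cell_Lipschitz (cube (dm i) c r) (grid_cell (dm i)) (partial_deriv j (\<lambda>y. g (inv_into W \<phi> y)))"
    by (rule cell_Lipschitz_Ck_on_1[OF D _ q])
qed

lemma cell_Lipschitz_quotients_null:
  assumes dim: "cell_dim Z c m" "m < D"
    and num: "\<And>k. k < D \<Longrightarrow> cell_Lipschitz Z c (p k)" and den: "cell_Lipschitz Z c q" and "e > 0"
  obtains N where "N \<in> null_sets (leb D)"
    "\<And>z. z \<in> Z \<Longrightarrow> \<bar>q z\<bar> \<ge> e \<Longrightarrow> (\<lambda>k\<in>{..<D}. - p k z / q z) \<in> N"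
proof -
  let ?Z = "{z \<in> Z. \<bar>q z\<bar> \<ge> e}"
  have sub: "?Z \<subseteq> Z" by auto
  have "cell_Lipschitz ?Z c (\<lambda>z. (-1) * (p k z * inverse (q z)))" if "k < D" for k
    using \<open>e > 0\<close>
    by (intro cell_Lipschitz_mult cell_Lipschitz_const cell_Lipschitz_inverse[of _ _ _ e]
        cell_Lipschitz_subset[OF num[OF that] sub] cell_Lipschitz_subset[OF den sub]) auto
  then obtain N where "N \<in> null_sets (leb D)"
    "\<And>z. z \<in> ?Z \<Longrightarrow> (\<lambda>k\<in>{..<D}. (-1) * (p k z * inverse (q z))) \<in> N"
    using cell_Lipschitz_image_null[OF cell_dim_subset[OF dim(1) sub] dim(2), where h = "\<lambda>k z. (-1) * (p k z * inverse (q z))"]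
    by blast
  then show ?thesis using that[of N] by (simp add: divide_inverse)
qed

text \<open>Pairs of points need \<open>dm i + dm i'\<close> parameters. A base point with a tangent
  vector needs \<open>2 * dm i\<close>, without normalising the vector. Both are at most
  \<open>2 * n\<close>, one less than the number of coordinates. What remains is to write all
  exceptional cases as a countable union.\<close>

lemma generic_coefficients:
  assumes f: "\<And>k. k < 2 * n + 1 \<Longrightarrow> smooth_function (\<lambda>z. f z k)" and g: "smooth_function g" and "e > 0"
  obtains a :: "nat \<Rightarrow> real" where "\<And>k. \<bar>a k\<bar> \<le> e"
    "\<And>z w. z \<in> topspace X \<Longrightarrow> w \<in> topspace X \<Longrightarrow>
      (\<And>k. k < 2 * n + 1 \<Longrightarrow> f z k + a k * g z = f w k + a k * g w) \<Longrightarrow> g z = g w"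
    "\<And>i W \<phi> z v. i \<in> I \<Longrightarrow> (W, \<phi>) \<in> A i \<Longrightarrow> z \<in> W \<Longrightarrow> v \<in> Espace (dm i) \<Longrightarrow>
      (\<And>k. k < 2 * n + 1 \<Longrightarrow> dir_deriv i W \<phi> (\<lambda>w. f w k + a k * g w) z v = 0) \<Longrightarrow>
      dir_deriv i W \<phi> g z v = 0"
proof -
  let ?D = "2 * n + 1"
  define cubes where "cubes i P \<longleftrightarrow> countable P \<and>
      (\<forall>(W, \<phi>, c, r)\<in>P. (W, \<phi>) \<in> A i \<and> cube (dm i) c r \<subseteq> \<phi> ` W) \<and>
      (\<forall>z\<in>S i. \<exists>(W, \<phi>, c, r)\<in>P. z \<in> W \<and> \<phi> z \<in> cube (dm i) c r)" for i P
  have "\<exists>P. cubes i P" if "i \<in> I" for i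
    unfolding cubes_def by (rule countable_cubes[OF that])
  then obtain P where cubes: "\<And>i. i \<in> I \<Longrightarrow> cubes i (P i)" by metis
  have P: "countable (P i)"
    "\<forall>(W, \<phi>, c, r)\<in>P i. (W, \<phi>) \<in> A i \<and> cube (dm i) c r \<subseteq> \<phi> ` W"
    "\<forall>z\<in>S i. \<exists>(W, \<phi>, c, r)\<in>P i. z \<in> W \<and> \<phi> z \<in> cube (dm i) c r" if "i \<in> I" for i
    using cubes[OF that] unfolding cubes_def by blast+
  \<comment> \<open>Countably many cubes with their strata; together they cover
    \<open>X\<close>.\<close>
  define R where "R = Sigma I P"
  have R: "countable R" unfolding R_def using countable_strata P(1) by (rule countable_SIGMA)
  have RD: "i \<in> I" "(W, \<phi>) \<in> A i" "cube (dm i) c r \<subseteq> \<phi> ` W" if "(i, W, \<phi>, c, r) \<in> R" for i W \<phi> c r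
  proof -
    show i: "i \<in> I" using that by (simp add: R_def)
    have "(W, \<phi>, c, r) \<in> P i" using that by (simp add: R_def)
    from bspec[OF P(2)[OF i] this] show "(W, \<phi>) \<in> A i" "cube (dm i) c r \<subseteq> \<phi> ` W" by simp_all
  qed
  have Rcov: "\<exists>i W \<phi> c r. (i, W, \<phi>, c, r) \<in> R \<and> z \<in> W \<and> \<phi> z \<in> cube (dm i) c r" if "z \<in> topspace X" for z
  proof -
    obtain i where "i \<in> I" "z \<in> S i" using \<open>z \<in> topspace X\<close> unfolding topspace_eq by blast
    from bspec[OF P(3)[OF this(1)] this(2)] obtain q where
      "q \<in> P i" "case q of (W, \<phi>, c, r) \<Rightarrow> z \<in> W \<and> \<phi> z \<in> cube (dm i) c r" ..
    moreover obtain W \<phi> c r where "q = (W, \<phi>, c, r)" by (metis prod_cases4)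
    ultimately have "(i, W, \<phi>, c, r) \<in> R \<and> z \<in> W \<and> \<phi> z \<in> cube (dm i) c r"
      using \<open>i \<in> I\<close> by (simp add: R_def)
    then show ?thesis by blast
  qed
  \<comment> \<open>\<open>N\<close> contains every coefficient vector that could identify a point
    of the first cube with one of the second when their \<open>g\<close>-values differ by at least 1
    / (m + 1).\<close>
  define bad1 where "bad1 = (\<lambda>((i, W, \<phi>, c, r), (i', W', \<phi>', c', r'), m) N. N \<in> null_sets (leb ?D) \<and>
      (\<forall>y\<in>cube (dm i) c r. \<forall>y'\<in>cube (dm i') c' r'.
        \<bar>g (inv_into W \<phi> y) - g (inv_into W' \<phi>' y')\<bar> \<ge> 1 / real (Suc m) \<longrightarrow>
        (\<lambda>k\<in>{..<?D}. - (f (inv_into W \<phi> y) k - f (inv_into W' \<phi>' y') k) /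
            (g (inv_into W \<phi> y) - g (inv_into W' \<phi>' y'))) \<in> N))"
  \<comment> \<open>Here \<open>m\<close> has two roles: it bounds the tangent vectors, so that the
    parameters form a compact cube, and it bounds the denominator away from 0.\<close>
  define bad2 where "bad2 = (\<lambda>((i, W, \<phi>, c, r), m) N. N \<in> null_sets (leb ?D) \<and>
      (\<forall>y\<in>cube (dm i) c r. \<forall>v\<in>cube (dm i) (\<lambda>_. 0) (real m).
        \<bar>\<Sum>j<dm i. v j * partial_deriv j (\<lambda>y. g (inv_into W \<phi> y)) y\<bar> \<ge> 1 / real (Suc m) \<longrightarrow>
        (\<lambda>k\<in>{..<?D}. - (\<Sum>j<dm i. v j * partial_deriv j (\<lambda>y. f (inv_into W \<phi> y) k) y) /
            (\<Sum>j<dm i. v j * partial_deriv j (\<lambda>y. g (inv_into W \<phi> y)) y)) \<in> N))"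
  have ex1: "\<exists>N. bad1 x N" if x: "x \<in> R \<times> R \<times> (UNIV :: nat set)" for x
  proof -
    obtain i W \<phi> c r i' W' \<phi>' c' r' m where xe: "x = ((i, W, \<phi>, c, r), (i', W', \<phi>', c', r'), m)"
      by (metis prod.exhaust)
    have r: "(i, W, \<phi>, c, r) \<in> R" "(i', W', \<phi>', c', r') \<in> R" using x xe by auto
    note c1 = RD[OF r(1)] and c2 = RD[OF r(2)]
    let ?Z = "cube (dm i) c r \<times> cube (dm i') c' r'"
    let ?c = "pair_cell (grid_cell (dm i)) (grid_cell (dm i'))"
    have pair: "cell_Lipschitz ?Z ?c (\<lambda>p. h (inv_into W \<phi> (fst p)) - h (inv_into W' \<phi>' (snd p)))"
      if h: "smooth_function h" for h
      by (intro cell_Lipschitz_diff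
          cell_Lipschitz_fst[OF cell_Lipschitz_chart(1)[OF c1 h]]
          cell_Lipschitz_snd[OF cell_Lipschitz_chart(1)[OF c2 h]])
    have "dm i + dm i' < ?D" using dm_le[OF c1(1)] dm_le[OF c2(1)] by linarith
    note dim = cell_dim_pair[OF cell_dim_cube cell_dim_cube] this
    have pos: "1 / real (Suc m) > 0" by simp
    obtain N where N: "N \<in> null_sets (leb ?D)"
      "\<And>p. p \<in> ?Z \<Longrightarrow> \<bar>g (inv_into W \<phi> (fst p)) - g (inv_into W' \<phi>' (snd p))\<bar> \<ge> 1 / real (Suc m) \<Longrightarrow>
        (\<lambda>k\<in>{..<?D}. - (f (inv_into W \<phi> (fst p)) k - f (inv_into W' \<phi>' (snd p)) k) /
            (g (inv_into W \<phi> (fst p)) - g (inv_into W' \<phi>' (snd p)))) \<in> N"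
      by (rule cell_Lipschitz_quotients_null[OF dim pair[OF f] pair[OF g] pos]) blast+
    have "bad1 x N" unfolding bad1_def xe using N(1) N(2)[of "(_, _)"] by simp
    then show ?thesis ..
  qed
  have ex2: "\<exists>N. bad2 x N" if x: "x \<in> R \<times> (UNIV :: nat set)" for x
  proof -
    obtain i W \<phi> c r m where xe: "x = ((i, W, \<phi>, c, r), m)" by (metis prod.exhaust)
    have r: "(i, W, \<phi>, c, r) \<in> R" using x xe by auto
    note c1 = RD[OF r]
    let ?Z = "cube (dm i) c r \<times> cube (dm i) (\<lambda>_. 0) (real m)"
    let ?c = "pair_cell (grid_cell (dm i)) (grid_cell (dm i))"
    have pair: "cell_Lipschitz ?Z ?c (\<lambda>p. \<Sum>j<dm i. snd p j * partial_deriv j (\<lambda>y. h (inv_into W \<phi> y)) (fst p))"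
      if h: "smooth_function h" for h
      by (intro cell_Lipschitz_sum cell_Lipschitz_mult
          cell_Lipschitz_fst[OF cell_Lipschitz_chart(2)[OF c1 h]]
          cell_Lipschitz_snd[OF cell_Lipschitz_coordinate]) auto
    have "dm i + dm i < ?D" using dm_le[OF c1(1)] by linarith
    note dim = cell_dim_pair[OF cell_dim_cube cell_dim_cube] this
    have pos: "1 / real (Suc m) > 0" by simp
    obtain N where N: "N \<in> null_sets (leb ?D)"
      "\<And>p. p \<in> ?Z \<Longrightarrow>
        \<bar>\<Sum>j<dm i. snd p j * partial_deriv j (\<lambda>y. g (inv_into W \<phi> y)) (fst p)\<bar> \<ge> 1 / real (Suc m) \<Longrightarrow>
        (\<lambda>k\<in>{..<?D}. - (\<Sum>j<dm i. snd p j * partial_deriv j (\<lambda>y. f (inv_into W \<phi> y) k) (fst p)) /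
            (\<Sum>j<dm i. snd p j * partial_deriv j (\<lambda>y. g (inv_into W \<phi> y)) (fst p))) \<in> N"
      by (rule cell_Lipschitz_quotients_null[OF dim pair[OF f] pair[OF g] pos]) blast+
    have "bad2 x N" unfolding bad2_def xe using N(1) N(2)[of "(_, _)"] by simp
    then show ?thesis ..
  qed
  obtain N1 where N1: "\<And>x. x \<in> R \<times> R \<times> (UNIV :: nat set) \<Longrightarrow> bad1 x (N1 x)" using ex1 by metis
  obtain N2 where N2: "\<And>x. x \<in> R \<times> (UNIV :: nat set) \<Longrightarrow> bad2 x (N2 x)" using ex2 by metis
  let ?\<N> = "N1 ` (R \<times> R \<times> UNIV) \<union> N2 ` (R \<times> UNIV)"
  have "countable ?\<N>" using R by (intro countable_Un countable_image countable_SIGMA) auto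
  moreover have "N \<in> null_sets (leb ?D)" if "N \<in> ?\<N>" for N
    using that N1 N2 unfolding bad1_def bad2_def by fastforce
  ultimately obtain a where a: "\<And>k. \<bar>a k\<bar> \<le> e" "\<And>N. N \<in> ?\<N> \<Longrightarrow> (\<lambda>k\<in>{..<?D}. a k) \<notin> N"
    using box_avoids_null_sets[of ?\<N> ?D e] \<open>e > 0\<close> by metis
  have inv: "inv_into W \<phi> (\<phi> z) = z" if "(i, W, \<phi>, c, r) \<in> R" "z \<in> W" for i W \<phi> c r z
    using chart_inj[OF RD(1,2)[OF that(1)]] that(2) by simp
  show ?thesis
  proof (rule that[of a])
    show "\<bar>a k\<bar> \<le> e" for k by (rule a(1))
  next
    fix z w assume zw: "z \<in> topspace X" "w \<in> topspace X"
      and eq: "\<And>k. k < ?D \<Longrightarrow> f z k + a k * g z = f w k + a k * g w"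
    show "g z = g w"
    proof (rule ccontr)
      assume ne: "g z \<noteq> g w"
      obtain i W \<phi> c r where z: "(i, W, \<phi>, c, r) \<in> R" "z \<in> W" "\<phi> z \<in> cube (dm i) c r"
        using Rcov[OF zw(1)] by blast
      obtain i' W' \<phi>' c' r' where w: "(i', W', \<phi>', c', r') \<in> R" "w \<in> W'" "\<phi>' w \<in> cube (dm i') c' r'"
        using Rcov[OF zw(2)] by blast
      obtain m where m: "1 / real (Suc m) < \<bar>g z - g w\<bar>"
        using nat_approx_posE[of "\<bar>g z - g w\<bar>"] ne by auto
      let ?x = "((i, W, \<phi>, c, r), (i', W', \<phi>', c', r'), m)"
      have x: "?x \<in> R \<times> R \<times> UNIV" using z(1) w(1) by simp
      have "\<forall>y\<in>cube (dm i) c r. \<forall>y'\<in>cube (dm i') c' r'.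
        \<bar>g (inv_into W \<phi> y) - g (inv_into W' \<phi>' y')\<bar> \<ge> 1 / real (Suc m) \<longrightarrow>
        (\<lambda>k\<in>{..<?D}. - (f (inv_into W \<phi> y) k - f (inv_into W' \<phi>' y') k) /
            (g (inv_into W \<phi> y) - g (inv_into W' \<phi>' y'))) \<in> N1 ?x"
        using N1[OF x] unfolding bad1_def by simp
      from bspec[OF bspec[OF this z(3)] w(3)]
      have "(\<lambda>k\<in>{..<?D}. - (f z k - f w k) / (g z - g w)) \<in> N1 ?x"
        using m by (simp add: inv[OF z(1,2)] inv[OF w(1,2)])
      moreover have "(\<lambda>k\<in>{..<?D}. a k) = (\<lambda>k\<in>{..<?D}. - (f z k - f w k) / (g z - g w))"
      proof (rule restrict_ext)
        fix k assume "k \<in> {..<?D}"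
        then have "a k * (g z - g w) = - (f z k - f w k)" using eq[of k] by (simp add: algebra_simps)
        then show "a k = - (f z k - f w k) / (g z - g w)" using ne by (simp add: eq_divide_eq)
      qed
      ultimately have "(\<lambda>k\<in>{..<?D}. a k) \<in> N1 ?x" by (simp only:)
      moreover have "N1 ?x \<in> ?\<N>" using x by blast
      ultimately show False using a(2) by blast
    qed
  next
    fix i W' \<phi>' z v' assume c': "i \<in> I" "(W', \<phi>') \<in> A i" "z \<in> W'" "v' \<in> Espace (dm i)"
      and eq: "\<And>k. k < ?D \<Longrightarrow> dir_deriv i W' \<phi>' (\<lambda>w. f w k + a k * g w) z v' = 0"
    have "z \<in> S i" using chart_subset(1)[OF c'(1,2)] c'(3) by blast
    from bspec[OF P(3)[OF c'(1)] this] obtain q where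
      q: "q \<in> P i" "case q of (W, \<phi>, c, r) \<Rightarrow> z \<in> W \<and> \<phi> z \<in> cube (dm i) c r" ..
    obtain W \<phi> c r where qe: "q = (W, \<phi>, c, r)" by (metis prod_cases4)
    have zW: "z \<in> W" "\<phi> z \<in> cube (dm i) c r" using q(2) by (simp_all add: qe)
    have r: "(i, W, \<phi>, c, r) \<in> R" using q(1) c'(1) by (simp add: R_def qe)
    note c = RD(1,2)[OF r]
    \<comment> \<open>The given chart is arbitrary, so its tangent vector is moved to a chart from
      the countable family.\<close>
    obtain v where v: "v \<in> Espace (dm i)"
      "\<And>h. smooth_function h \<Longrightarrow> dir_deriv i W' \<phi>' h z v' = dir_deriv i W \<phi> h z v"
      by (rule dir_deriv_change_chart[OF c c'(2) zW(1) c'(3,4)]) blast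
    show "dir_deriv i W' \<phi>' g z v' = 0"
    proof (rule ccontr)
      assume "dir_deriv i W' \<phi>' g z v' \<noteq> 0"
      then have ne: "dir_deriv i W \<phi> g z v \<noteq> 0" using v(2)[OF g] by simp
      obtain m1 where m1: "1 / real (Suc m1) < \<bar>dir_deriv i W \<phi> g z v\<bar>"
        using nat_approx_posE[of "\<bar>dir_deriv i W \<phi> g z v\<bar>"] ne by auto
      obtain m2 :: nat where m2: "(\<Sum>j<dm i. \<bar>v j\<bar>) \<le> real m2" using real_arch_simple by blast
      \<comment> \<open>Large enough for both roles of the index: \<open>m1\<close> controls the
        denominator and \<open>m2\<close> the size of \<open>v\<close>.\<close>
      define m where "m = max m1 m2"
      have "1 / real (Suc m) \<le> 1 / real (Suc m1)" by (simp add: m_def field_simps)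
      then have m: "1 / real (Suc m) \<le> \<bar>dir_deriv i W \<phi> g z v\<bar>" using m1 by linarith
      have "\<bar>v j\<bar> \<le> real m" if "j < dm i" for j
      proof -
        have "\<bar>v j\<bar> \<le> (\<Sum>j<dm i. \<bar>v j\<bar>)" using that by (intro member_le_sum) auto
        also have "\<dots> \<le> real m" using m2 by (simp add: m_def)
        finally show ?thesis .
      qed
      then have vm: "v \<in> cube (dm i) (\<lambda>_. 0) (real m)" using v(1) by (simp add: cube_def)
      let ?x = "((i, W, \<phi>, c, r), m)"
      have x: "?x \<in> R \<times> UNIV" using r by simp
      have "\<forall>y\<in>cube (dm i) c r. \<forall>v\<in>cube (dm i) (\<lambda>_. 0) (real m).
        \<bar>\<Sum>j<dm i. v j * partial_deriv j (\<lambda>y. g (inv_into W \<phi> y)) y\<bar> \<ge> 1 / real (Suc m) \<longrightarrow>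
        (\<lambda>k\<in>{..<?D}. - (\<Sum>j<dm i. v j * partial_deriv j (\<lambda>y. f (inv_into W \<phi> y) k) y) /
            (\<Sum>j<dm i. v j * partial_deriv j (\<lambda>y. g (inv_into W \<phi> y)) y)) \<in> N2 ?x"
        using N2[OF x] unfolding bad2_def by simp
      from bspec[OF bspec[OF this zW(2)] vm]
      have "(\<lambda>k\<in>{..<?D}. - dir_deriv i W \<phi> (\<lambda>w. f w k) z v / dir_deriv i W \<phi> g z v) \<in> N2 ?x"
        using m unfolding dir_deriv_def by blast
      moreover have "(\<lambda>k\<in>{..<?D}. a k) = (\<lambda>k\<in>{..<?D}. - dir_deriv i W \<phi> (\<lambda>w. f w k) z v / dir_deriv i W \<phi> g z v)"
      proof (rule restrict_ext)
        fix k assume "k \<in> {..<?D}"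
        then have k: "k < ?D" by simp
        have "smooth_function (\<lambda>w. f w k + a k * g w)"
          by (intro smooth_function_on_add smooth_function_on_mult smooth_function_on_const
              openin_topspace f[OF k] g)
        from v(2)[OF this] have "dir_deriv i W \<phi> (\<lambda>w. f w k + a k * g w) z v = 0" using eq[OF k] by simp
        then have "dir_deriv i W \<phi> (\<lambda>w. f w k) z v + a k * dir_deriv i W \<phi> g z v = 0"
          unfolding dir_deriv_add_scaled[OF c f[OF k] g zW(1)] .
        then have "a k * dir_deriv i W \<phi> g z v = - dir_deriv i W \<phi> (\<lambda>w. f w k) z v" by simp
        then show "a k = - dir_deriv i W \<phi> (\<lambda>w. f w k) z v / dir_deriv i W \<phi> g z v"
          by (simp only: nonzero_eq_divide_eq[OF ne])
      qed
      ultimately have "(\<lambda>k\<in>{..<?D}. a k) \<in> N2 ?x" by (simp only:)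
      moreover have "N2 ?x \<in> ?\<N>" using x by blast
      ultimately show False using a(2) by blast
    qed
  qed
qed

section \<open>The embedding\<close>

text \<open>Each step is generic only for its own \<open>G m\<close>: equality after the step forces
  equality of \<open>G m\<close>, hence equality before the step. Since the sequence is stationary
  near each point, equality for the limit holds at all late stages and descends through every
  \<open>m\<close>; then the family \<open>G\<close> separates. Tangent vectors are treated the same
  way.\<close>

lemma smooth_injective_immersion_exists:
  obtains f :: "'a \<Rightarrow> nat \<Rightarrow> real" and \<rho> :: "'a \<Rightarrow> real"
  where "\<And>k. k < 2 * n + 1 \<Longrightarrow> smooth_function (\<lambda>z. f z k)" "\<And>z k. k \<ge> 2 * n + 1 \<Longrightarrow> f z k = 0"
    "\<And>z w. z \<in> topspace X \<Longrightarrow> w \<in> topspace X \<Longrightarrow> f z = f w \<Longrightarrow> z = w"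
    "\<And>i W \<phi> z v. i \<in> I \<Longrightarrow> (W, \<phi>) \<in> A i \<Longrightarrow> z \<in> W \<Longrightarrow> v \<in> Espace (dm i) \<Longrightarrow>
      (\<And>k. k < 2 * n + 1 \<Longrightarrow> dir_deriv i W \<phi> (\<lambda>w. f w k) z v = 0) \<Longrightarrow> v = (\<lambda>_. 0)"
    "\<And>c. \<exists>K. compactin X K \<and> (\<forall>z\<in>topspace X. \<rho> z \<le> c \<longrightarrow> z \<in> K)"
    "\<And>z. z \<in> topspace X \<Longrightarrow> \<bar>f z 0 - \<rho> z\<bar> \<le> 1"
proof -
  let ?D = "2 * n + 1"
  obtain \<rho> :: "'a \<Rightarrow> real" and G :: "nat \<Rightarrow> 'a \<Rightarrow> real" and B :: "nat \<Rightarrow> real" and V :: "nat \<Rightarrow> 'a set"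
    where \<rho>: "smooth_function \<rho>" "\<And>c. \<exists>K. compactin X K \<and> (\<forall>z\<in>topspace X. \<rho> z \<le> c \<longrightarrow> z \<in> K)"
    and G: "\<And>m. smooth_function (G m)" and B: "\<And>m. B m > 0" "\<And>m z. z \<in> topspace X \<Longrightarrow> \<bar>G m z\<bar> \<le> B m"
    and V: "\<And>l. openin X (V l)" "\<And>z. z \<in> topspace X \<Longrightarrow> \<exists>l. z \<in> V l"
    and fin: "\<And>l. \<exists>M. \<forall>m\<ge>M. \<forall>z\<in>V l. G m z = 0"
    and sep: "\<And>z w. z \<in> topspace X \<Longrightarrow> w \<in> topspace X \<Longrightarrow> (\<And>m. G m z = G m w) \<Longrightarrow> z = w"
    and imm: "\<And>i W \<phi> z v. i \<in> I \<Longrightarrow> (W, \<phi>) \<in> A i \<Longrightarrow> z \<in> W \<Longrightarrow> v \<in> Espace (dm i) \<Longrightarrow>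
      (\<And>m. dir_deriv i W \<phi> (G m) z v = 0) \<Longrightarrow> v = (\<lambda>_. 0)"
    by (rule separating_functions) blast
  define good where "good F \<longleftrightarrow> (\<forall>k<?D. smooth_function (\<lambda>z. F z k))" for F :: "'a \<Rightarrow> nat \<Rightarrow> real"
  \<comment> \<open>The bound on the coefficients makes step m change each coordinate by at most
    (1/2)^(m + 1) on \<open>X\<close>, so the total change is at most 1.\<close>
  define step where "step m F F' \<longleftrightarrow> (\<exists>a :: nat \<Rightarrow> real. (\<forall>k. \<bar>a k\<bar> \<le> (1 / 2) ^ Suc m / B m) \<and>
      F' = (\<lambda>z k. F z k + a k * G m z) \<and>
      (\<forall>z\<in>topspace X. \<forall>w\<in>topspace X. (\<forall>k<?D. F' z k = F' w k) \<longrightarrow> G m z = G m w) \<and>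
      (\<forall>i\<in>I. \<forall>W \<phi>. (W, \<phi>) \<in> A i \<longrightarrow> (\<forall>z\<in>W. \<forall>v\<in>Espace (dm i).
        (\<forall>k<?D. dir_deriv i W \<phi> (\<lambda>w. F' w k) z v = 0) \<longrightarrow> dir_deriv i W \<phi> (G m) z v = 0)))"
    for m and F F' :: "'a \<Rightarrow> nat \<Rightarrow> real"
  \<comment> \<open>The clause for \<open>m = 0\<close> carries the initial map through the
    dependent choice; \<open>good\<close> is the invariant that allows the next step.\<close>
  have "\<exists>F. \<forall>m. (good (F m) \<and> (m = 0 \<longrightarrow> F m = (\<lambda>z k. if k = 0 then \<rho> z else 0))) \<and> step m (F m) (F (Suc m))"
  proof (rule dependent_nat_choice)
    have "good (\<lambda>z k. if k = 0 then \<rho> z else 0)"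
      unfolding good_def
    proof (intro allI impI)
      show "smooth_function (\<lambda>z. if k = 0 then \<rho> z else 0)" for k :: nat
        using \<rho>(1) smooth_function_on_const[OF openin_topspace, of 0] by (cases "k = 0") simp_all
    qed
    then show "\<exists>F. good F \<and> (0 = (0 :: nat) \<longrightarrow> F = (\<lambda>z k. if k = 0 then \<rho> z else 0))" by blast
  next
    fix F and m :: nat assume "good F \<and> (m = 0 \<longrightarrow> F = (\<lambda>z k. if k = 0 then \<rho> z else 0))"
    then have F: "\<And>k. k < ?D \<Longrightarrow> smooth_function (\<lambda>z. F z k)" by (simp add: good_def)
    have pos: "(1 / 2) ^ Suc m / B m > 0" using B(1)[of m] by simp
    obtain a :: "nat \<Rightarrow> real" where a: "\<And>k. \<bar>a k\<bar> \<le> (1 / 2) ^ Suc m / B m"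
      "\<And>z w. z \<in> topspace X \<Longrightarrow> w \<in> topspace X \<Longrightarrow>
        (\<And>k. k < ?D \<Longrightarrow> F z k + a k * G m z = F w k + a k * G m w) \<Longrightarrow> G m z = G m w"
      "\<And>i W \<phi> z v. i \<in> I \<Longrightarrow> (W, \<phi>) \<in> A i \<Longrightarrow> z \<in> W \<Longrightarrow> v \<in> Espace (dm i) \<Longrightarrow>
        (\<And>k. k < ?D \<Longrightarrow> dir_deriv i W \<phi> (\<lambda>w. F w k + a k * G m w) z v = 0) \<Longrightarrow>
        dir_deriv i W \<phi> (G m) z v = 0"
      by (rule generic_coefficients[OF F G pos]) blast+
    let ?F' = "\<lambda>z k. F z k + a k * G m z"
    have "good ?F'"
      unfolding good_def
      by (intro allI impI smooth_function_on_add smooth_function_on_mult smooth_function_on_const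
          openin_topspace F G)
    moreover have "step m F ?F'"
      unfolding step_def
    proof (intro exI[of _ a] conjI allI ballI impI)
      show "\<bar>a k\<bar> \<le> (1 / 2) ^ Suc m / B m" for k by (rule a(1))
      show "?F' = ?F'" by (rule refl)
      show "G m z = G m w"
        if "z \<in> topspace X" "w \<in> topspace X" "\<forall>k<?D. ?F' z k = ?F' w k" for z w
        by (rule a(2)[OF that(1,2)]) (rule that(3)[rule_format])
      show "dir_deriv i W \<phi> (G m) z v = 0"
        if "i \<in> I" "(W, \<phi>) \<in> A i" "z \<in> W" "v \<in> Espace (dm i)"
          "\<forall>k<?D. dir_deriv i W \<phi> (\<lambda>w. ?F' w k) z v = 0" for i W \<phi> z v
        by (rule a(3)[OF that(1-4)]) (rule that(5)[rule_format])
    qed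
    ultimately show "\<exists>F'. (good F' \<and> (Suc m = 0 \<longrightarrow> F' = (\<lambda>z k. if k = 0 then \<rho> z else 0))) \<and> step m F F'"
      by (intro exI[of _ ?F']) simp
  qed
  then obtain F where good: "\<And>m. good (F m)" and F0: "F 0 = (\<lambda>z k. if k = 0 then \<rho> z else 0)"
    and step: "\<And>m. step m (F m) (F (Suc m))" by blast
  have F_smooth: "smooth_function (\<lambda>z. F m z k)" if "k < ?D" for m k
    using good[of m] that by (simp add: good_def)
  have "\<exists>a. \<forall>m. (\<forall>k. \<bar>a m k\<bar> \<le> (1 / 2) ^ Suc m / B m) \<and> F (Suc m) = (\<lambda>z k. F m z k + a m k * G m z)"
  proof (rule choice, rule allI)
    show "\<exists>a. (\<forall>k. \<bar>a k\<bar> \<le> (1 / 2) ^ Suc m / B m) \<and> F (Suc m) = (\<lambda>z k. F m z k + a k * G m z)" for m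
      using step[of m] unfolding step_def by blast
  qed
  then obtain a where a: "\<And>m k. \<bar>a m k\<bar> \<le> (1 / 2) ^ Suc m / B m"
    and F_Suc: "\<And>m. F (Suc m) = (\<lambda>z k. F m z k + a m k * G m z)" by blast
  have F_inj: "G m z = G m w"
    if "z \<in> topspace X" "w \<in> topspace X" "\<And>k. k < ?D \<Longrightarrow> F (Suc m) z k = F (Suc m) w k" for m z w
    using step[of m] that unfolding step_def by blast
  have F_imm: "dir_deriv i W \<phi> (G m) z v = 0"
    if "i \<in> I" "(W, \<phi>) \<in> A i" "z \<in> W" "v \<in> Espace (dm i)"
      "\<And>k. k < ?D \<Longrightarrow> dir_deriv i W \<phi> (\<lambda>w. F (Suc m) w k) z v = 0" for m i W \<phi> z v
    using step[of m] that unfolding step_def by blast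

  obtain M where M: "\<And>l m z. m \<ge> M l \<Longrightarrow> z \<in> V l \<Longrightarrow> G m z = 0" using fin by metis
  have F_stable: "F m z = F (M l) z" if "m \<ge> M l" "z \<in> V l" for m l z
    using that(1)
  proof (induction rule: dec_induct)
    case (step m)
    then show ?case using M[of l m z] that(2) by (simp add: F_Suc)
  qed simp
  \<comment> \<open>On \<open>X\<close> the sequence is eventually constant, so \<open>lim\<close>
    is its final value. Coordinates from \<open>2 * n + 1\<close> on are set to 0 so that values lie
    in the Euclidean space.\<close>
  define f where "f z k = (if k < ?D then lim (\<lambda>m. F m z k) else 0)" for z k
  have f_eq: "f z k = F m z k" if "z \<in> V l" "m \<ge> M l" "k < ?D" for z k l m
  proof -
    have "eventually (\<lambda>m'. F m' z k = F m z k) sequentially"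
      using eventually_ge_at_top[of "M l"]
    proof eventually_elim
      case (elim m')
      then show ?case using F_stable[OF elim that(1)] F_stable[OF that(2,1)] by simp
    qed
    then have "(\<lambda>m'. F m' z k) \<longlonglongrightarrow> F m z k" by (rule tendsto_eventually)
    then show ?thesis using that(3) by (simp add: f_def limI)
  qed
  have f_smooth: "smooth_function (\<lambda>z. f z k)" if k: "k < ?D" for k
  proof (rule smooth_function_on_local)
    fix z assume "z \<in> topspace X"
    then obtain l where l: "z \<in> V l" using V(2) by blast
    have "smooth_function_on (V l) (\<lambda>z. F (M l) z k)"
      by (rule smooth_function_on_subset[OF F_smooth[OF k] openin_subset[OF V(1)]])
    then have "smooth_function_on (V l) (\<lambda>z. f z k)"
      by (rule smooth_function_on_cong[OF V(1), rotated]) (simp add: f_eq[OF _ order_refl k])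
    then show "\<exists>U. openin X U \<and> z \<in> U \<and> smooth_function_on U (\<lambda>z. f z k)" using V(1) l by blast
  qed simp
  have f_inj: "z = w" if zw: "z \<in> topspace X" "w \<in> topspace X" "f z = f w" for z w
  proof (rule sep[OF zw(1,2)])
    obtain l l' where l: "z \<in> V l" "w \<in> V l'" using V(2) zw by metis
    \<comment> \<open>Downward induction from a stage \<open>m'\<close> at which both points have
      reached their limit value; removing the term with \<open>G m\<close> is possible because its
      values at \<open>z\<close> and \<open>w\<close> agree.\<close>
    have eq: "\<forall>k<?D. F m z k = F m w k" if "m \<le> m'" "m' \<ge> max (M l) (M l')" for m m'
      using that(1)
    proof (induction rule: inc_induct)
      case base
      show ?case using f_eq[OF l(1), of m'] f_eq[OF l(2), of m'] that(2) zw(3) by simp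
    next
      case (step m)
      then have "G m z = G m w" by (intro F_inj[OF zw(1,2)]) simp
      then show ?case using step.IH by (simp add: F_Suc)
    qed
    show "G m z = G m w" for m
      \<comment> \<open>The starting stage is taken beyond \<open>Suc m\<close>, so the descent also
        reaches those \<open>m\<close> at which the maps are already stationary.\<close>
      by (rule F_inj[OF zw(1,2)]) (use eq[of "Suc m" "max (Suc m) (max (M l) (M l'))"] in simp)
  qed
  have f_imm: "v = (\<lambda>_. 0)"
    if c: "i \<in> I" "(W, \<phi>) \<in> A i" and z: "z \<in> W" and v: "v \<in> Espace (dm i)"
      and d: "\<And>k. k < ?D \<Longrightarrow> dir_deriv i W \<phi> (\<lambda>w. f w k) z v = 0" for i W \<phi> z v
  proof (rule imm[OF c z v])
    obtain l where l: "z \<in> V l" using V(2) chart_subset(2)[OF c] z by blast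
    have eq: "\<forall>k<?D. dir_deriv i W \<phi> (\<lambda>w. F m w k) z v = 0" if "m \<le> m'" "m' \<ge> M l" for m m'
      using that(1)
    proof (induction rule: inc_induct)
      case base
      have "dir_deriv i W \<phi> (\<lambda>w. F m' w k) z v = dir_deriv i W \<phi> (\<lambda>w. f w k) z v" if "k < ?D" for k
        by (rule dir_deriv_cong[OF c V(1) z l]) (rule f_eq[OF _ \<open>m' \<ge> M l\<close> that, symmetric])
      then show ?case using d by simp
    next
      case (step m)
      then have Gm: "dir_deriv i W \<phi> (G m) z v = 0" by (intro F_imm[OF c z v]) simp
      have "dir_deriv i W \<phi> (\<lambda>w. F m w k) z v = 0" if "k < ?D" for k
        using step.IH dir_deriv_add_scaled[OF c F_smooth[OF that] G z, of m "a m k" m v] Gm that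
        by (simp add: F_Suc)
      then show ?case by blast
    qed
    show "dir_deriv i W \<phi> (G m) z v = 0" for m
      by (rule F_imm[OF c z v]) (use eq[of "Suc m" "max (Suc m) (M l)"] in simp)
  qed
  have f_near: "\<bar>f z 0 - \<rho> z\<bar> \<le> 1" if z: "z \<in> topspace X" for z
  proof -
    \<comment> \<open>The bound is the partial sum of the geometric series 1/2 + 1/4 + ...\<close>
    have F_near: "\<bar>F m z 0 - \<rho> z\<bar> \<le> 1 - (1 / 2) ^ m" for m
    proof (induction m)
      case 0
      then show ?case by (simp add: F0)
    next
      case (Suc m)
      have "\<bar>a m 0\<bar> * \<bar>G m z\<bar> \<le> (1 / 2) ^ Suc m / B m * B m"
        using a[of m 0] B(1)[of m] B(2)[OF z, of m] by (intro mult_mono) auto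
      then have "\<bar>a m 0 * G m z\<bar> \<le> (1 / 2) ^ Suc m" using B(1)[of m] by (simp add: abs_mult)
      then show ?case using Suc by (simp add: F_Suc)
    qed
    obtain l where "z \<in> V l" using V(2)[OF z] by blast
    then have "f z 0 = F (M l) z 0" using f_eq[of z l "M l" 0] by simp
    moreover have "(1 / 2 :: real) ^ M l \<ge> 0" by simp
    ultimately show ?thesis using F_near[of "M l"] by linarith
  qed
  show ?thesis
    by (rule that[of f \<rho>, OF f_smooth _ f_inj f_imm \<rho>(2) f_near]) (simp_all add: f_def)
qed

text \<open>A compact set has bounded zeroth coordinate, so its preimage is a closed subset of a
  compact set on which \<open>\<rho>\<close> is controlled. Restricting the resulting global
  embedding gives the embeddings of the strata.\<close>

lemma proper_embedding_exists:
  "\<exists>f. s_embedding X I S dm A (2 * n + 1) f \<and> preimage_proper X (2 * n + 1) f"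
proof -
  let ?D = "2 * n + 1"
  obtain f :: "'a \<Rightarrow> nat \<Rightarrow> real" and \<rho> :: "'a \<Rightarrow> real"
    where sm: "\<And>k. k < ?D \<Longrightarrow> smooth_function (\<lambda>z. f z k)" and f0: "\<And>z k. k \<ge> ?D \<Longrightarrow> f z k = 0"
    and inj: "\<And>z w. z \<in> topspace X \<Longrightarrow> w \<in> topspace X \<Longrightarrow> f z = f w \<Longrightarrow> z = w"
    and imm: "\<And>i W \<phi> z v. i \<in> I \<Longrightarrow> (W, \<phi>) \<in> A i \<Longrightarrow> z \<in> W \<Longrightarrow> v \<in> Espace (dm i) \<Longrightarrow>
      (\<And>k. k < ?D \<Longrightarrow> dir_deriv i W \<phi> (\<lambda>w. f w k) z v = 0) \<Longrightarrow> v = (\<lambda>_. 0)"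
    and \<rho>: "\<And>c. \<exists>K. compactin X K \<and> (\<forall>z\<in>topspace X. \<rho> z \<le> c \<longrightarrow> z \<in> K)"
    and near: "\<And>z. z \<in> topspace X \<Longrightarrow> \<bar>f z 0 - \<rho> z\<bar> \<le> 1"
    by (rule smooth_injective_immersion_exists) blast
  have "continuous_map X (Euclidean_space ?D) (\<lambda>z k. if k < ?D then f z k else 0)"
    unfolding continuous_map_componentwise_Euclidean_space using smooth_functionD(1)[OF sm] by blast
  moreover have "(\<lambda>z k. if k < ?D then f z k else 0) = f" using f0 by (auto simp: fun_eq_iff)
  ultimately have cont: "continuous_map X (Euclidean_space ?D) f" by simp
  have proper: "preimage_proper X ?D f"
    unfolding preimage_proper_def
  proof (intro allI impI)
    fix K assume K: "compactin (Euclidean_space ?D) K"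
    have "continuous_map (Euclidean_space ?D) euclideanreal (\<lambda>x. x 0)"
      unfolding Euclidean_space_def
      by (intro continuous_map_from_subtopology continuous_map_product_projection) simp
    then have "compactin euclideanreal ((\<lambda>x. x 0) ` K)" using K image_compactin by blast
    then have "bounded ((\<lambda>x. x 0) ` K)" by (simp add: compact_imp_bounded)
    then obtain c where c: "\<And>x. x \<in> K \<Longrightarrow> \<bar>x 0\<bar> \<le> c" by (auto simp: bounded_iff)
    \<comment> \<open>The 1 in \<open>c + 1\<close> absorbs the distance between
      \<open>\<rho>\<close> and the zeroth coordinate of \<open>f\<close>.\<close>
    obtain L where L: "compactin X L" "\<And>z. z \<in> topspace X \<Longrightarrow> \<rho> z \<le> c + 1 \<Longrightarrow> z \<in> L" using \<rho> by blast
    have "closedin (Euclidean_space ?D) K"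
      by (rule compactin_imp_closedin[OF metrizable_imp_Hausdorff_space[OF metrizable_Euclidean_space] K])
    then have "closedin X {z \<in> topspace X. f z \<in> K}" by (rule closedin_continuous_map_preimage[OF cont])
    moreover have "{z \<in> topspace X. f z \<in> K} \<subseteq> L"
    proof
      fix z assume "z \<in> {z \<in> topspace X. f z \<in> K}"
      then have z: "z \<in> topspace X" "f z \<in> K" by auto
      show "z \<in> L" using c[OF z(2)] near[OF z(1)] by (intro L(2)[OF z(1)]) linarith
    qed
    ultimately show "compactin X {z \<in> topspace X. f z \<in> K}" using L(1) closed_compactin by blast
  qed
  have emb: "embedding_map X (Euclidean_space ?D) f"
    by (rule preimage_proper_imp_embedding_map[OF cont _ proper]) (use inj in \<open>auto intro: inj_onI\<close>)
  have smooth_map: "manifold_smooth_map (dm i) (A i) ?D f" if "i \<in> I" for i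
    unfolding manifold_smooth_map_def
  proof (intro ballI)
    fix c assume c: "c \<in> A i"
    obtain W \<phi> where "c = (W, \<phi>)" by (cases c)
    then show "case c of (W, \<phi>) \<Rightarrow> \<forall>k<?D. smooth_on (dm i) (\<phi> ` W) (\<lambda>y. f (inv_into W \<phi> y) k)"
      using smooth_functionD(2)[OF sm that, of _ W \<phi>] c by (simp add: smooth_on_def)
  qed
  have "manifold_immersion (dm i) (A i) ?D f" if i: "i \<in> I" for i
    unfolding manifold_immersion_def
  proof (intro conjI ballI)
    show "manifold_smooth_map (dm i) (A i) ?D f" by (rule smooth_map[OF i])
    fix c assume cA: "c \<in> A i"
    obtain W \<phi> where c: "c = (W, \<phi>)" by (cases c)
    have ch: "(W, \<phi>) \<in> A i" using cA c by simp
    have "inj_on (chart_differential (dm i) ?D (W, \<phi>) f (\<phi> z)) (Espace (dm i))" if z: "z \<in> W" for z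
    proof (rule inj_onI)
      fix u v assume uv: "u \<in> Espace (dm i)" "v \<in> Espace (dm i)"
        and eq: "chart_differential (dm i) ?D (W, \<phi>) f (\<phi> z) u = chart_differential (dm i) ?D (W, \<phi>) f (\<phi> z) v"
      \<comment> \<open>The differential is linear in the vector, so injectivity reduces to
        triviality of the kernel.\<close>
      have "dir_deriv i W \<phi> (\<lambda>w. f w k) z (\<lambda>j. u j - v j) = 0" if "k < ?D" for k
        using fun_cong[OF eq, of k] that
        by (simp add: chart_differential_def dir_deriv_def left_diff_distrib sum_subtractf)
      moreover have "(\<lambda>j. u j - v j) \<in> Espace (dm i)" using uv by (simp add: topspace_Euclidean_space)
      ultimately have "(\<lambda>j. u j - v j) = (\<lambda>_. 0)" by (intro imm[OF i ch z]) auto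
      then show "u = v" by (auto simp: fun_eq_iff)
    qed
    then show "case c of (W, \<phi>) \<Rightarrow> \<forall>y\<in>\<phi> ` W.
        inj_on (chart_differential (dm i) ?D (W, \<phi>) f y) (Espace (dm i))"
      unfolding c by simp
  qed
  then have "s_embedding X I S dm A ?D f"
    using cont smooth_map emb embedding_map_from_subtopology[OF emb]
    by (simp add: s_embedding_def s_smooth_map_def manifold_embedding_def)
  with proper show ?thesis by blast
qed

end

theorem theorem3p19:
  fixes n :: nat
    and X :: "'a topology"
    and I :: "'i set"
    and S :: "'i \<Rightarrow> 'a set"
    and dm :: "'i \<Rightarrow> nat"
    and A :: "'i \<Rightarrow> 'a chart set"
  assumes "s_manifold n X I S dm A"
  shows "\<exists>f :: 'a \<Rightarrow> nat \<Rightarrow> real.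
           s_embedding X I S dm A (2 * n + 1) f \<and> preimage_proper X (2 * n + 1) f"
proof -
  interpret smooth_stratification n X I S dm A using assms by unfold_locales
  show ?thesis by (rule proper_embedding_exists)
qed

end
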